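(* Let $E=E(R/\mathfrak m)$ and let $0\neq N\subseteq E$ be an $R$-submodule. The following are equivalent: (i) $N$ is simple-$\mathcal F$-divisible; (ii) $\mathrm{Ann}_{\hat R}(N)$ is a maximal element of the set $\{P\in\mathrm{Spec}(\hat R): P\cap R\notin\mathcal F\}$. If in addition the extension $R\subseteq\hat R$ satisfies going up, then (i) and (ii) are further equivalent to: (iii) $N$ is strongly coprime and $\mathrm{Ann}_R(N)\in\mathcal F^*$.
   Context: Throughout, $R$ is a commutative Noetherian local ring with maximal ideal $\mathfrak m$, $\hat R$ its $\mathfrak m$-adic completion, $E(R/\mathfrak m)$ the injective hull of $R/\mathfrak m$ (naturally an $\hat R$-module). $\mathcal F$ is a Gabriel topology on $R$: a nonempty set of ideals of $R$ such that (1) if $\mathfrak a\in\mathcal F$ and $\mathfrak a\subseteq\mathfrak b$ then $\mathfrak b\in\mathcal F$; (2) if $\mathfrak a,\mathfrak b\in\mathcal F$ then $\mathfrak a\cap\mathfrak b\in\mathcal F$; (3) if $\mathfrak b$ is an ideal and there is $\mathfrak a\in\mathcal F$ with $(\mathfrak b:r)\in\mathcal F$ for all $r\in\mathfrak a$, then $\mathfrak b\in\mathcal F$. A module $X$ is $\mathcal F$-divisible if $\mathfrak aX=X$ for all $\mathfrak a\in\mathcal F$. $N$ is simple-$\mathcal F$-divisible if $N\ne0$, $N$ is $\mathcal F$-divisible, and no submodule $0\neq V\subsetneq N$ is $\mathcal F$-divisible. $\mathcal F^*$ denotes the set of maximal elements (under inclusion) of $\mathrm{Spec}(R)\setminus\mathcal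 F$. A module $N\neq0$ is strongly coprime if every nonzero $R$-endomorphism of $N$ is surjective. $R\subseteq\hat R$ satisfies going up if for primes $\mathfrak p\subseteq\mathfrak q$ of $R$ and a prime $P$ of $\hat R$ with $P\cap R=\mathfrak p$ there is a prime $Q\supseteq P$ of $\hat R$ with $Q\cap R=\mathfrak q$. *)

theory Defs
  imports "HOL-Algebra.Ideal_Product" "HOL-Algebra.Module" "HOL-Algebra.Ring_Divisibility"
begin

definition noetherian_local :: "'a ring \<Rightarrow> 'a set \<Rightarrow> bool" where
  "noetherian_local R m \<longleftrightarrow> cring R \<and> noetherian_ring R \<and> maximalideal m R \<and>
     (\<forall>I. maximalideal I R \<longrightarrow> I = m)"

fun ideal_pow :: "'a ring \<Rightarrow> 'a set \<Rightarrow> nat \<Rightarrow> 'a set" where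
  "ideal_pow R m 0 = carrier R"
| "ideal_pow R m (Suc n) = ideal_prod R m (ideal_pow R m n)"

text \<open>An element of the completion is a compatible sequence of cosets
  x n \<in> R/m^n with x (n+1) \<subseteq> x n.\<close>

definition compl_rep :: "'a ring \<Rightarrow> 'a set \<Rightarrow> (nat \<Rightarrow> 'a set) \<Rightarrow> nat \<Rightarrow> 'a" where
  "compl_rep R m x n = (SOME a. a \<in> carrier R \<and> x n = ideal_pow R m n +>\<^bsub>R\<^esub> a)"

definition completion :: "'a ring \<Rightarrow> 'a set \<Rightarrow> (nat \<Rightarrow> 'a set) ring" where
  "completion R m =
    \<lparr> carrier = {x. \<forall>n. x n \<in> a_rcosets\<^bsub>R\<^esub> (ideal_pow R m n) \<and> x (Suc n) \<subseteq> x n},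
      monoid.mult = (\<lambda>x y n. ideal_pow R m n +>\<^bsub>R\<^esub> (compl_rep R m x n \<otimes>\<^bsub>R\<^esub> compl_rep R m y n)),
      one = (\<lambda>n. ideal_pow R m n +>\<^bsub>R\<^esub> \<one>\<^bsub>R\<^esub>),
      zero = (\<lambda>n. ideal_pow R m n +>\<^bsub>R\<^esub> \<zero>\<^bsub>R\<^esub>),
      add = (\<lambda>x y n. ideal_pow R m n +>\<^bsub>R\<^esub> (compl_rep R m x n \<oplus>\<^bsub>R\<^esub> compl_rep R m y n)) \<rparr>"

definition compl_canon :: "'a ring \<Rightarrow> 'a set \<Rightarrow> 'a \<Rightarrow> nat \<Rightarrow> 'a set" where
  "compl_canon R m r = (\<lambda>n. ideal_pow R m n +>\<^bsub>R\<^esub> r)"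

definition contraction :: "'a ring \<Rightarrow> 'a set \<Rightarrow> (nat \<Rightarrow> 'a set) set \<Rightarrow> 'a set" where
  "contraction R m P = {r \<in> carrier R. compl_canon R m r \<in> P}"

definition going_up_to_completion :: "'a ring \<Rightarrow> 'a set \<Rightarrow> bool" where
  "going_up_to_completion R m \<longleftrightarrow>
    (\<forall>p q P. primeideal p R \<and> primeideal q R \<and> p \<subseteq> q \<and>
       primeideal P (completion R m) \<and> contraction R m P = p \<longrightarrow>
       (\<exists>Q. primeideal Q (completion R m) \<and> P \<subseteq> Q \<and> contraction R m Q = q))"

text \<open>Injectivity via Baer's criterion (HOL cannot quantify over modules of all types).\<close>
definition baer_injective :: "'a ring \<Rightarrow> ('a, 'b) module \<Rightarrow> bool" where
  "baer_injective R E \<longleftrightarrow>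
    (\<forall>I g. ideal I R \<and> g \<in> I \<rightarrow> carrier E \<and>
       (\<forall>a\<in>I. \<forall>b\<in>I. g (a \<oplus>\<^bsub>R\<^esub> b) = g a \<oplus>\<^bsub>E\<^esub> g b) \<and>
       (\<forall>r\<in>carrier R. \<forall>a\<in>I. g (r \<otimes>\<^bsub>R\<^esub> a) = r \<odot>\<^bsub>E\<^esub> g a)
     \<longrightarrow> (\<exists>e\<in>carrier E. \<forall>a\<in>I. g a = a \<odot>\<^bsub>E\<^esub> e))"

text \<open>E is an injective hull of R/m: an injective module which is an essential
  extension of a cyclic submodule R e with Ann(e) = m (i.e. R e \<cong> R/m).\<close>
definition injective_hull_residue :: "'a ring \<Rightarrow> 'a set \<Rightarrow> ('a, 'b) module \<Rightarrow> bool" where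
  "injective_hull_residue R m E \<longleftrightarrow> module R E \<and> baer_injective R E \<and>
    (\<exists>e\<in>carrier E. {r \<in> carrier R. r \<odot>\<^bsub>E\<^esub> e = \<zero>\<^bsub>E\<^esub>} = m \<and>
       (\<forall>V. submodule V R E \<and> (\<exists>v\<in>V. v \<noteq> \<zero>\<^bsub>E\<^esub>) \<longrightarrow>
          (\<exists>v\<in>V \<inter> {r \<odot>\<^bsub>E\<^esub> e |r. r \<in> carrier R}. v \<noteq> \<zero>\<^bsub>E\<^esub>)))"

text \<open>The natural completion-module structure on E: every element of E is killed by
  some power of m, and x acts on e through a representative of x modulo m^n.\<close>
definition hat_smult :: "'a ring \<Rightarrow> 'a set \<Rightarrow> ('a, 'b) module \<Rightarrow> (nat \<Rightarrow> 'a set) \<Rightarrow> 'b \<Rightarrow> 'b" where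
  "hat_smult R m E x e =
     compl_rep R m x (LEAST n. \<forall>r\<in>ideal_pow R m n. r \<odot>\<^bsub>E\<^esub> e = \<zero>\<^bsub>E\<^esub>) \<odot>\<^bsub>E\<^esub> e"

definition hat_ann :: "'a ring \<Rightarrow> 'a set \<Rightarrow> ('a, 'b) module \<Rightarrow> 'b set \<Rightarrow> (nat \<Rightarrow> 'a set) set" where
  "hat_ann R m E N = {x \<in> carrier (completion R m). \<forall>e\<in>N. hat_smult R m E x e = \<zero>\<^bsub>E\<^esub>}"

definition mod_ann :: "'a ring \<Rightarrow> ('a, 'b) module \<Rightarrow> 'b set \<Rightarrow> 'a set" where
  "mod_ann R E N = {r \<in> carrier R. \<forall>e\<in>N. r \<odot>\<^bsub>E\<^esub> e = \<zero>\<^bsub>E\<^esub>}"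

definition ideal_colon :: "'a ring \<Rightarrow> 'a set \<Rightarrow> 'a \<Rightarrow> 'a set" where
  "ideal_colon R b r = {x \<in> carrier R. r \<otimes>\<^bsub>R\<^esub> x \<in> b}"

definition gabriel_topology :: "'a ring \<Rightarrow> 'a set set \<Rightarrow> bool" where
  "gabriel_topology R F \<longleftrightarrow> F \<noteq> {} \<and> (\<forall>a\<in>F. ideal a R) \<and>
    (\<forall>a b. a \<in> F \<and> ideal b R \<and> a \<subseteq> b \<longrightarrow> b \<in> F) \<and>
    (\<forall>a\<in>F. \<forall>b\<in>F. a \<inter> b \<in> F) \<and>
    (\<forall>b. ideal b R \<and> (\<exists>a\<in>F. \<forall>r\<in>a. ideal_colon R b r \<in> F) \<longrightarrow> b \<in> F)"

definition gen_submodule :: "'a ring \<Rightarrow> ('a, 'b) module \<Rightarrow> 'b set \<Rightarrow> 'b set" where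
  "gen_submodule R E S = \<Inter>{V. submodule V R E \<and> S \<subseteq> V}"

definition ideal_smult :: "'a ring \<Rightarrow> ('a, 'b) module \<Rightarrow> 'a set \<Rightarrow> 'b set \<Rightarrow> 'b set" where
  "ideal_smult R E a X = gen_submodule R E {r \<odot>\<^bsub>E\<^esub> x |r x. r \<in> a \<and> x \<in> X}"

definition F_divisible :: "'a ring \<Rightarrow> ('a, 'b) module \<Rightarrow> 'a set set \<Rightarrow> 'b set \<Rightarrow> bool" where
  "F_divisible R E F X \<longleftrightarrow> (\<forall>a\<in>F. ideal_smult R E a X = X)"

definition simple_F_divisible :: "'a ring \<Rightarrow> ('a, 'b) module \<Rightarrow> 'a set set \<Rightarrow> 'b set \<Rightarrow> bool" where
  "simple_F_divisible R E F N \<longleftrightarrow> N \<noteq> {\<zero>\<^bsub>E\<^esub>} \<and> F_divisible R E F N \<and>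
     \<not> (\<exists>V. submodule V R E \<and> V \<noteq> {\<zero>\<^bsub>E\<^esub>} \<and> V \<subset> N \<and> F_divisible R E F V)"

definition F_star :: "'a ring \<Rightarrow> 'a set set \<Rightarrow> 'a set set" where
  "F_star R F = {P. primeideal P R \<and> P \<notin> F \<and>
     (\<forall>Q. primeideal Q R \<and> Q \<notin> F \<and> P \<subseteq> Q \<longrightarrow> Q = P)}"

definition module_endo :: "'a ring \<Rightarrow> ('a, 'b) module \<Rightarrow> 'b set \<Rightarrow> ('b \<Rightarrow> 'b) \<Rightarrow> bool" where
  "module_endo R E N f \<longleftrightarrow> f \<in> N \<rightarrow> N \<and>
     (\<forall>x\<in>N. \<forall>y\<in>N. f (x \<oplus>\<^bsub>E\<^esub> y) = f x \<oplus>\<^bsub>E\<^esub> f y) \<and>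
     (\<forall>r\<in>carrier R. \<forall>x\<in>N. f (r \<odot>\<^bsub>E\<^esub> x) = r \<odot>\<^bsub>E\<^esub> f x)"

definition strongly_coprime :: "'a ring \<Rightarrow> ('a, 'b) module \<Rightarrow> 'b set \<Rightarrow> bool" where
  "strongly_coprime R E N \<longleftrightarrow> N \<noteq> {\<zero>\<^bsub>E\<^esub>} \<and>
     (\<forall>f. module_endo R E N f \<and> (\<exists>x\<in>N. f x \<noteq> \<zero>\<^bsub>E\<^esub>) \<longrightarrow> f ` N = N)"

end

theory Submission
  imports Defs
begin

text \<open>Let \<open>e\<^sub>0\<close> span the socle of \<open>E\<close>. Linear algebra over the residue field, applied successively to the
  elements killed by \<open>m^n\<close>, shows that every homomorphism from a submodule of \<open>E\<close> to \<open>E\<close> is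
  multiplication by an element of the completion. Hence submodules of \<open>E\<close> and finitely generated
  ideals of the completion determine each other through their annihilators; this duality also
  replaces the convergence arguments in the proof that the completion is noetherian.

  If \<open>N\<close> is simple divisible, multiplication by an element of the completion is zero or onto on \<open>N\<close>,
  so \<open>Ann N\<close> is prime, and a larger prime \<open>Q\<close> with contraction outside \<open>F\<close> would give the smaller
  divisible submodule killed by \<open>Q\<close>. Conversely, the annihilator of a divisible submodule has
  contraction outside \<open>F\<close>, and ideals maximal with this property are prime. The third condition
  reduces to the second once going up is known to exclude strict inclusions between primes of the
  completion with the same contraction; this uses Krull's principal ideal theorem.\<close>

section \<open>Ideals and primes in noetherian rings\<close>

text \<open>The duality comes in two stages, and this fixes the order of the parts. For ideals of
  the completion it rests on an induction over finitely many generators, while noetherianness of the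
  completion is itself deduced from that finite form; only then is every ideal the annihilator of a
  submodule of \<open>E\<close>. For submodules a single separating homomorphism is enough, so this
  half is available at once.

  Noetherianness of the completion is then used three times: for the full duality, for the existence
  of ideals maximal with contraction outside \<open>F\<close>, and for Krull's theorem.

  Krull's theorem enters because incomparability, familiar from integral extensions, is not
  automatic here: the completion need not be integral over \<open>R\<close>, and primes over a given
  prime have to be kept apart by comparing heights. Only ideals of the ring itself occur in its
  proof: an ideal of a localization is represented by its contraction, and finite length by
  stabilization of descending chains.\<close>

locale plain_cring = cring R for R :: "'a ring" (structure)

text \<open>The general part has locales of its own because it serves twice: for \<open>R\<close>
  and, through the interpretation \<open>hat\<close>, for the completion, whose noetherianness
  becomes available only at a late stage.\<close>

locale noetherian_cring = plain_cring R + noetherian_ring R for R :: "'a ring" (structure)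

context noetherian_ring
begin

lemma ideal_set_has_maximal:
  assumes "\<And>I. I \<in> S \<Longrightarrow> ideal I R" "S \<noteq> {}"
  shows "\<exists>M\<in>S. \<forall>I\<in>S. M \<subseteq> I \<longrightarrow> I = M"
proof (rule subset_Zorn_nonempty[OF assms(2)])
  fix C assume C: "C \<noteq> {}" "subset.chain S C"
  then have "subset.chain {I. ideal I R} C"
    using assms(1) by (auto simp: subset_chain_def)
  from ideal_chain_is_trivial[OF C(1) this] C(2) show "\<Union>C \<in> S"
    by (auto simp: subset_chain_def)
qed

end

context plain_cring
begin

section \<open>Elementary facts on ideals and primes\<close>

lemma ideal_carr: "ideal I R \<Longrightarrow> a \<in> I \<Longrightarrow> a \<in> carrier R"
  by (rule ideal.Icarr)

lemma ideal_mult_left: "ideal I R \<Longrightarrow> a \<in> I \<Longrightarrow> x \<in> carrier R \<Longrightarrow> x \<otimes> a \<in> I"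
  by (rule ideal.I_l_closed)

lemma ideal_intro:
  assumes "J \<subseteq> carrier R" "\<zero> \<in> J" "\<And>a b. a \<in> J \<Longrightarrow> b \<in> J \<Longrightarrow> a \<oplus> b \<in> J"
    "\<And>a x. a \<in> J \<Longrightarrow> x \<in> carrier R \<Longrightarrow> x \<otimes> a \<in> J"
  shows "ideal J R"
proof (rule idealI)
  show "ring R" by unfold_locales
  have "\<ominus> a \<in> J" if "a \<in> J" for a
    using assms(4)[OF that, of "\<ominus> \<one>"] that assms(1) by (auto simp: l_minus)
  then show "subgroup J (add_monoid R)"
    using assms by (intro add.subgroupI) (auto simp: simp flip: a_inv_def)
  show "x \<otimes> a \<in> J" "a \<otimes> x \<in> J" if "a \<in> J" "x \<in> carrier R" for a x
    using assms(4)[OF that] that assms(1) by (auto simp: m_comm)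
qed

lemma eq_sum_imp_minus: "a \<in> carrier R \<Longrightarrow> b \<in> carrier R \<Longrightarrow> c = a \<oplus> b \<Longrightarrow> b = c \<ominus> a"
  by (metis a_comm a_minus_def add.inv_solve_right add.m_closed)

lemma set_add_memI: "a \<in> I \<Longrightarrow> b \<in> J \<Longrightarrow> a \<oplus> b \<in> I <+>\<^bsub>R\<^esub> J"
  by (auto simp: set_add_def')

lemma set_add_memE:
  assumes "x \<in> I <+>\<^bsub>R\<^esub> J" obtains a b where "a \<in> I" "b \<in> J" "x = a \<oplus> b"
  using assms by (auto simp: set_add_def')

lemma ideal_sum_left: "ideal I R \<Longrightarrow> ideal J R \<Longrightarrow> I \<subseteq> I <+>\<^bsub>R\<^esub> J"
proof
  fix x assume "ideal I R" "ideal J R" "x \<in> I"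
  then have "x \<oplus> \<zero> \<in> I <+>\<^bsub>R\<^esub> J" "x \<in> carrier R"
    by (auto intro!: set_add_memI additive_subgroup.zero_closed ideal.axioms(1) intro: ideal_carr)
  then show "x \<in> I <+>\<^bsub>R\<^esub> J" by simp
qed

lemma ideal_sum_right: "ideal I R \<Longrightarrow> ideal J R \<Longrightarrow> J \<subseteq> I <+>\<^bsub>R\<^esub> J"
proof
  fix x assume "ideal I R" "ideal J R" "x \<in> J"
  then have "\<zero> \<oplus> x \<in> I <+>\<^bsub>R\<^esub> J" "x \<in> carrier R"
    by (auto intro!: set_add_memI additive_subgroup.zero_closed ideal.axioms(1) intro: ideal_carr)
  then show "x \<in> I <+>\<^bsub>R\<^esub> J" by simp
qed

lemma ideal_add: "ideal I R \<Longrightarrow> a \<in> I \<Longrightarrow> b \<in> I \<Longrightarrow> a \<oplus> b \<in> I"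
  by (simp add: additive_subgroup.a_closed ideal.axioms(1))

lemma ideal_uminus: "ideal I R \<Longrightarrow> a \<in> I \<Longrightarrow> \<ominus> a \<in> I"
  by (simp add: additive_subgroup.a_inv_closed ideal.axioms(1))

lemma ideal_minus: "ideal I R \<Longrightarrow> a \<in> I \<Longrightarrow> b \<in> I \<Longrightarrow> a \<ominus> b \<in> I"
  by (simp add: minus_eq ideal_add ideal_uminus)

lemma ideal_zero: "ideal I R \<Longrightarrow> \<zero> \<in> I"
  by (simp add: additive_subgroup.zero_closed ideal.axioms(1))

lemma ideal_sum_minimal:
  assumes "ideal L R" "I \<subseteq> L" "J \<subseteq> L" shows "I <+>\<^bsub>R\<^esub> J \<subseteq> L"
  using assms by (auto elim!: set_add_memE intro!: ideal_add)

lemma set_add_mono: "I \<subseteq> I' \<Longrightarrow> J \<subseteq> J' \<Longrightarrow> I <+>\<^bsub>R\<^esub> J \<subseteq> I' <+>\<^bsub>R\<^esub> J'"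
  by (auto simp: set_add_def')

lemma ideal_eq_carrier: "ideal I R \<Longrightarrow> \<one> \<in> I \<Longrightarrow> I = carrier R"
  by (rule ideal.one_imp_carrier)

lemma prime_one: "primeideal p R \<Longrightarrow> \<one> \<notin> p"
  using ideal_eq_carrier primeideal.I_notcarr primeideal.axioms(1) by metis

lemma prime_mult_notin:
  assumes "primeideal p R" "s \<in> carrier R - p" "t \<in> carrier R - p"
  shows "s \<otimes> t \<in> carrier R - p"
  using assms primeideal.I_prime by fastforce

section \<open>Colon ideals and saturations\<close>

lemma ideal_colon_ideal:
  assumes "ideal J R" "a \<in> carrier R"
  shows "ideal (ideal_colon R J a) R"
proof (rule ideal_intro)
  fix b x assume *: "b \<in> ideal_colon R J a" "x \<in> carrier R"
  then have "b \<in> carrier R" "a \<otimes> b \<in> J" by (auto simp: ideal_colon_def)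
  moreover have "a \<otimes> (x \<otimes> b) = x \<otimes> (a \<otimes> b)"
    using * assms calculation by (auto simp: m_ac)
  ultimately show "x \<otimes> b \<in> ideal_colon R J a"
    using * assms by (auto simp: ideal_colon_def intro: ideal_mult_left)
qed (use assms in \<open>auto simp: ideal_colon_def r_distr ideal_add ideal_zero\<close>)

text \<open>For an ideal \<open>K\<close>, this is the contraction of its extension to the
  localization at \<open>p\<close>. Ideals with \<open>sat p K \<subseteq> K\<close> therefore stand
  for the ideals of that localization.\<close>

definition sat :: "'a set \<Rightarrow> 'a set \<Rightarrow> 'a set" where
  "sat p K = {f \<in> carrier R. \<exists>s \<in> carrier R - p. s \<otimes> f \<in> K}"

lemma sat_mono: "K \<subseteq> L \<Longrightarrow> sat p K \<subseteq> sat p L"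
  by (auto simp: sat_def)

lemma sat_incl:
  assumes "primeideal p R" "ideal K R" shows "K \<subseteq> sat p K"
proof
  fix x assume "x \<in> K"
  then have "x \<in> carrier R" "\<one> \<otimes> x \<in> K" using assms(2) ideal_carr by fastforce+
  then show "x \<in> sat p K" using prime_one[OF assms(1)] by (auto simp: sat_def intro!: bexI[of _ \<one>])
qed

text \<open>For \<open>q = p\<close> this is idempotence. For a smaller \<open>q\<close> it says
  that an ideal coming from the localization at \<open>q\<close> is already saturated at
  \<open>p\<close>, because elements outside \<open>p\<close> lie outside \<open>q\<close>.\<close>

lemma sat_sat:
  assumes "primeideal p R" "q \<subseteq> p" "primeideal q R"
  shows "sat p (sat q K) \<subseteq> sat q K"
proof
  fix f assume "f \<in> sat p (sat q K)"
  then obtain s t where "f \<in> carrier R" "s \<in> carrier R - p" "t \<in> carrier R - q" "t \<otimes> (s \<otimes> f) \<in> K"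
    by (auto simp: sat_def)
  moreover from this assms have "t \<otimes> s \<in> carrier R - q" by (intro prime_mult_notin) auto
  moreover have "t \<otimes> (s \<otimes> f) = t \<otimes> s \<otimes> f" using calculation by (auto simp: m_assoc)
  ultimately show "f \<in> sat q K" by (auto simp: sat_def)
qed

lemma sat_ideal:
  assumes p: "primeideal p R" and K: "ideal K R" shows "ideal (sat p K) R"
proof (rule ideal_intro)
  show "sat p K \<subseteq> carrier R" by (auto simp: sat_def)
  show "\<zero> \<in> sat p K" using sat_incl[OF p K] ideal_zero[OF K] by auto
next
  fix a b assume "a \<in> sat p K" "b \<in> sat p K"
  then obtain s t where st: "s \<in> carrier R - p" "t \<in> carrier R - p" "s \<otimes> a \<in> K" "t \<otimes> b \<in> K"
    "a \<in> carrier R" "b \<in> carrier R"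
    by (auto simp: sat_def)
  have "(s \<otimes> t) \<otimes> (a \<oplus> b) = t \<otimes> (s \<otimes> a) \<oplus> s \<otimes> (t \<otimes> b)"
    using st by (simp add: r_distr m_ac)
  also have "\<dots> \<in> K" using st K by (auto intro!: ideal_add ideal_mult_left)
  finally show "a \<oplus> b \<in> sat p K"
    using st prime_mult_notin[OF p st(1,2)] unfolding sat_def by blast
next
  fix a x assume a: "a \<in> sat p K" and x: "x \<in> carrier R"
  then obtain s where s: "s \<in> carrier R - p" "s \<otimes> a \<in> K" "a \<in> carrier R" by (auto simp: sat_def)
  have "s \<otimes> (x \<otimes> a) = x \<otimes> (s \<otimes> a)" using s x by (simp add: m_ac)
  also have "\<dots> \<in> K" using s x K by (auto intro!: ideal_mult_left)
  finally show "x \<otimes> a \<in> sat p K" using s x unfolding sat_def by blast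
qed

section \<open>Principal ideals, powers, products and minimal primes\<close>

lemma mem_PIdl: "x \<in> PIdl a \<longleftrightarrow> (\<exists>c\<in>carrier R. x = c \<otimes> a)"
  by (auto simp: cgenideal_def)

lemma prime_pow:
  assumes "primeideal P R" "y \<in> carrier R" "y [^] (n::nat) \<in> P" shows "y \<in> P"
  using assms(3)
proof (induction n)
  case 0 then show ?case using prime_one[OF assms(1)] by simp
next
  case (Suc n) then show ?case using primeideal.I_prime[OF assms(1), of "y [^] n" y] assms(2) by auto
qed

lemma ideal_pow_ideal: "ideal I R \<Longrightarrow> ideal (ideal_pow R I n) R"
  by (induction n) (auto simp: oneideal intro: ideal_prod_is_ideal)

lemma pow_in_ideal_pow: "y \<in> I \<Longrightarrow> y \<in> carrier R \<Longrightarrow> y [^] n \<in> ideal_pow R I n"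
proof (induction n)
  case (Suc n)
  then show ?case using ideal_prod.prod[of y I "y [^] n" "ideal_pow R I n" R]
    by (simp add: m_comm)
qed auto

lemma ideal_pow_antimono_Suc: "ideal I R \<Longrightarrow> ideal_pow R I (Suc n) \<subseteq> ideal_pow R I n"
  using ideal_prod_inter[of I "ideal_pow R I n"] ideal_pow_ideal by auto

lemma ideal_prod_le:
  assumes "ideal L R" "\<And>i j. i \<in> I \<Longrightarrow> j \<in> J \<Longrightarrow> i \<otimes> j \<in> L"
  shows "ideal_prod R I J \<subseteq> L"
proof
  fix x assume "x \<in> ideal_prod R I J"
  then show "x \<in> L" by induction (use assms ideal_add in auto)
qed

lemma exists_minimal_prime:
  assumes "primeideal Q R" "S \<subseteq> Q"
  obtains P where "primeideal P R" "S \<subseteq> P" "P \<subseteq> Q"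
    "\<And>L. primeideal L R \<Longrightarrow> S \<subseteq> L \<Longrightarrow> L \<subseteq> P \<Longrightarrow> L = P"
proof -
  \<comment> \<open>Complements turn minimal primes into maximal sets, and the union of a chain into
    the complement of an intersection of primes; along a chain such an intersection is again
    prime.\<close>
  define A where "A = uminus ` {P. primeideal P R \<and> S \<subseteq> P \<and> P \<subseteq> Q}"
  have "\<exists>M\<in>A. \<forall>X\<in>A. M \<subseteq> X \<longrightarrow> X = M"
  proof (rule subset_Zorn_nonempty)
    show "A \<noteq> {}" using assms by (auto simp: A_def)
  next
    fix C assume C: "C \<noteq> {}" "subset.chain A C"
    define D where "D = uminus ` C"
    have D: "D \<noteq> {}" "\<And>P. P \<in> D \<Longrightarrow> primeideal P R \<and> S \<subseteq> P \<and> P \<subseteq> Q"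
      using C by (auto simp: D_def A_def subset_chain_def)
    have D_chain: "P \<subseteq> P' \<or> P' \<subseteq> P" if "P \<in> D" "P' \<in> D" for P P'
    proof -
      obtain X Y where "P = - X" "P' = - Y" "X \<in> C" "Y \<in> C" using \<open>P \<in> D\<close> \<open>P' \<in> D\<close> by (auto simp: D_def)
      moreover from this have "X \<subseteq> Y \<or> Y \<subseteq> X" using C(2) unfolding subset_chain_def by blast
      ultimately show ?thesis by blast
    qed
    have "primeideal (\<Inter>D) R"
    proof (rule primeidealI)
      show "ideal (\<Inter>D) R" using D by (intro i_Intersect) (auto dest: primeideal.axioms(1))
      show "cring R" by unfold_locales
      show "carrier R \<noteq> \<Inter>D" using D prime_one by fastforce
    next
      fix a b assume ab: "a \<in> carrier R" "b \<in> carrier R" "a \<otimes> b \<in> \<Inter>D"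
      show "a \<in> \<Inter>D \<or> b \<in> \<Inter>D"
      proof (rule ccontr)
        assume "\<not> (a \<in> \<Inter>D \<or> b \<in> \<Inter>D)"
        then obtain P P' where P: "P \<in> D" "P' \<in> D" "a \<notin> P" "b \<notin> P'" by auto
        then obtain L where "L \<in> D" "a \<notin> L" "b \<notin> L" using D_chain[of P P'] by blast
        then show False using D(2)[of L] ab primeideal.I_prime[of L R a b] by auto
      qed
    qed
    moreover have "\<Union>C = - \<Inter>D" by (auto simp: D_def)
    moreover have "S \<subseteq> \<Inter>D" "\<Inter>D \<subseteq> Q" using D by auto
    ultimately show "\<Union>C \<in> A" unfolding A_def by blast
  qed
  then obtain P where "primeideal P R" "S \<subseteq> P" "P \<subseteq> Q"
    and "\<forall>X\<in>A. - P \<subseteq> X \<longrightarrow> X = - P" by (auto simp: A_def)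
  moreover have "L = P" if L: "primeideal L R" "S \<subseteq> L" "L \<subseteq> P" for L
  proof -
    have "- L \<in> A" using L \<open>P \<subseteq> Q\<close> by (auto simp: A_def)
    then have "- L = - P" using \<open>\<forall>X\<in>A. _\<close> L by blast
    then show ?thesis by blast
  qed
  ultimately show thesis using that by blast
qed

end

section \<open>Saturated ideals: descending chains, Nakayama's lemma, Krull's theorem\<close>

context noetherian_cring
begin

text \<open>A maximal one among the annihilators of nonzero elements of \<open>R/J\<close> is prime:
  if \<open>y\<close> does not kill \<open>a\<close> modulo \<open>J\<close>, the annihilator of
  \<open>a y\<close> contains that of \<open>a\<close>, hence equals it.\<close>

lemma associated_prime:
  assumes J: "ideal J R" and ne: "J \<noteq> carrier R"
  obtains a where "a \<in> carrier R - J" "primeideal (ideal_colon R J a) R"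
proof -
  define S where "S = ideal_colon R J ` (carrier R - J)"
  have S: "\<And>I. I \<in> S \<Longrightarrow> ideal I R" "S \<noteq> {}"
    using ideal_colon_ideal[OF J] ne ideal_carr[OF J] by (auto simp: S_def)
  obtain M where M: "M \<in> S" "\<And>I. I \<in> S \<Longrightarrow> M \<subseteq> I \<Longrightarrow> I = M"
    using ideal_set_has_maximal[OF S] by blast
  then obtain a where a: "a \<in> carrier R - J" "M = ideal_colon R J a" by (auto simp: S_def)
  have "primeideal M R"
  proof (rule primeidealI)
    show "ideal M R" using S M by auto
    show "cring R" by unfold_locales
    have "\<one> \<notin> M" using a by (auto simp: ideal_colon_def)
    then show "carrier R \<noteq> M" by auto
  next
    fix x y assume xy: "x \<in> carrier R" "y \<in> carrier R" "x \<otimes> y \<in> M"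
    show "x \<in> M \<or> y \<in> M"
    proof (rule ccontr)
      assume n: "\<not> (x \<in> M \<or> y \<in> M)"
      then have ay: "a \<otimes> y \<in> carrier R - J" using a xy by (auto simp: ideal_colon_def)
      have "M \<subseteq> ideal_colon R J (a \<otimes> y)"
      proof
        fix z assume "z \<in> M"
        then have z: "z \<in> carrier R" "a \<otimes> z \<in> J" using a by (auto simp: ideal_colon_def)
        have "a \<otimes> y \<otimes> z = y \<otimes> (a \<otimes> z)" using a xy z by (simp add: m_ac)
        then show "z \<in> ideal_colon R J (a \<otimes> y)" using z xy J
          by (auto simp: ideal_colon_def intro: ideal_mult_left)
      qed
      then have "ideal_colon R J (a \<otimes> y) = M" using M(2) ay by (auto simp: S_def)
      moreover have "a \<otimes> y \<otimes> x = a \<otimes> (x \<otimes> y)" using a xy by (simp add: m_ac)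
      then have "x \<in> ideal_colon R J (a \<otimes> y)" using xy a by (auto simp: ideal_colon_def)
      ultimately show False using n by simp
    qed
  qed
  then show thesis using a that by blast
qed

text \<open>Behind this is the fact that a noetherian local ring with a single prime is artinian,
  for the localization of \<open>R/J0\<close> at \<open>p\<close>. Lengths are avoided by noetherian
  induction: choose \<open>J\<close> maximal among the saturated ideals with an unstable chain above
  them, and compare the chain with the one obtained by adjoining an element \<open>a\<close> whose
  annihilator modulo \<open>J\<close> is \<open>p\<close>.\<close>

lemma saturated_dcc:
  assumes p: "primeideal p R" and J0: "ideal J0 R"
    and min: "\<And>L. primeideal L R \<Longrightarrow> J0 \<subseteq> L \<Longrightarrow> L \<subseteq> p \<Longrightarrow> L = p"
    and I: "\<And>n. ideal (I n) R" "\<And>n. sat p (I n) \<subseteq> I n" "\<And>n. I (Suc n) \<subseteq> I n" "\<And>n. J0 \<subseteq> I n"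
  shows "\<exists>n. \<forall>k\<ge>n. I k = I n"
proof (rule ccontr)
  assume contra: "\<not> ?thesis"
  define chain where "chain J I \<longleftrightarrow> (\<forall>n. ideal (I n) R \<and> sat p (I n) \<subseteq> I n \<and> I (Suc n) \<subseteq> I n \<and> J \<subseteq> I n)"
    for J and I :: "nat \<Rightarrow> 'a set"
  define S where "S = {J. ideal J R \<and> J0 \<subseteq> J \<and> sat p J \<subseteq> J \<and>
      (\<exists>I. chain J I \<and> \<not> (\<exists>n. \<forall>k\<ge>n. I k = I n))}"
  have "sat p J0 \<subseteq> I n" for n
    using sat_mono[OF I(4)[of n], of p] I(2)[of n] by blast
  then have "chain (sat p J0) I" using I by (auto simp: chain_def)
  moreover have "ideal (sat p J0) R" "J0 \<subseteq> sat p J0" "sat p (sat p J0) \<subseteq> sat p J0"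
    by (intro sat_ideal p J0 sat_incl sat_sat subset_refl)+
  ultimately have "sat p J0 \<in> S" using contra by (auto simp: S_def)
  moreover have "\<And>I. I \<in> S \<Longrightarrow> ideal I R" by (simp add: S_def)
  ultimately obtain J where J: "J \<in> S" "\<And>L. L \<in> S \<Longrightarrow> J \<subseteq> L \<Longrightarrow> L = J"
    using ideal_set_has_maximal[of S] by blast
  then obtain I where "ideal J R" "J0 \<subseteq> J" and satJ: "sat p J \<subseteq> J" and "chain J I"
    and nstab: "\<not> (\<exists>n. \<forall>k\<ge>n. I k = I n)" by (auto simp: S_def)
  then have I: "\<And>n. ideal (I n) R" "\<And>n. sat p (I n) \<subseteq> I n" "\<And>n. I (Suc n) \<subseteq> I n" "\<And>n. J \<subseteq> I n"
    by (auto simp: chain_def)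
  have anti: "I k \<subseteq> I n" if "n \<le> k" for n k
    using lift_Suc_antimono_le[of I, OF I(3) that] .
  have "J \<noteq> carrier R" 
  proof
    assume "J = carrier R"
    then have "I n = carrier R" for n using I(4)[of n] ideal_carr[OF I(1)] by auto
    then show False using nstab by auto
  qed
  then obtain a where a: "a \<in> carrier R - J" "primeideal (ideal_colon R J a) R"
    using associated_prime \<open>ideal J R\<close> by blast
  \<comment> \<open>\<open>J0 \<subseteq> J\<close> puts the colon ideal above \<open>J0\<close>,
    and saturation of \<open>J\<close> puts it inside \<open>p\<close>; minimality of
    \<open>p\<close> leaves only \<open>p\<close>.\<close>
  have colon: "ideal_colon R J a = p"
  proof (rule min[OF a(2)])
    show "J0 \<subseteq> ideal_colon R J a"
      using \<open>J0 \<subseteq> J\<close> a J0 \<open>ideal J R\<close> by (auto simp: ideal_colon_def intro: ideal_carr ideal_mult_left)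
    show "ideal_colon R J a \<subseteq> p"
    proof
      fix s assume s: "s \<in> ideal_colon R J a"
      show "s \<in> p"
      proof (rule ccontr)
        assume "s \<notin> p"
        then have "a \<in> sat p J" using s a unfolding sat_def ideal_colon_def
          by (auto simp: m_comm intro!: bexI[of _ s])
        then show False using satJ a by auto
      qed
    qed
  qed
  have PI: "ideal (PIdl a) R" using a by (auto intro: cgenideal_ideal)
  have aP: "a \<in> PIdl a" using a by (auto intro: cgenideal_self)
  \<comment> \<open>Adjoining \<open>a\<close> moves the chain above the strictly larger ideal
    \<open>J'\<close>, where chains stabilize by the choice of \<open>J\<close>.\<close>
  define I' where "I' n = sat p (I n <+>\<^bsub>R\<^esub> PIdl a)" for n
  define J' where "J' = sat p (J <+>\<^bsub>R\<^esub> PIdl a)"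
  have J'id: "ideal J' R" unfolding J'_def by (intro sat_ideal p add_ideals PI \<open>ideal J R\<close>)
  have J'sat: "sat p J' \<subseteq> J'" unfolding J'_def by (intro sat_sat p subset_refl)
  have JJ': "J \<subseteq> J'" "a \<in> J'" 
    using sat_incl[OF p, of "J <+>\<^bsub>R\<^esub> PIdl a"] add_ideals[OF \<open>ideal J R\<close> PI]
      ideal_sum_left[OF \<open>ideal J R\<close> PI] ideal_sum_right[OF \<open>ideal J R\<close> PI] aP
    unfolding J'_def by blast+
  have stab: "\<exists>n. \<forall>k\<ge>n. K k = K n" if "chain J' K" for K
  proof (rule ccontr)
    assume "\<not> ?thesis"
    then have "J' \<in> S" using J'id J'sat JJ' \<open>J0 \<subseteq> J\<close> that by (auto simp: S_def)
    then have "J' = J" using J JJ' by blast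
    then show False using JJ' a by blast
  qed
  show False
  proof (cases "\<forall>n. a \<in> I n")
    case True
    have "J' \<subseteq> I n" for n
    proof -
      have "PIdl a \<subseteq> I n" using True ideal_mult_left[OF I(1)[of n]] by (auto simp: mem_PIdl)
      then have "J <+>\<^bsub>R\<^esub> PIdl a \<subseteq> I n" using I by (intro ideal_sum_minimal) auto
      then show ?thesis using sat_mono[of "J <+>\<^bsub>R\<^esub> PIdl a" "I n" p] I(2)[of n] unfolding J'_def by blast
    qed
    then have "chain J' I" using I by (auto simp: chain_def)
    then show False using stab nstab by blast
  next
    case False
    then obtain n2 where n2: "a \<notin> I n2" by blast
    have "chain J' I'" unfolding chain_def
    proof (intro allI conjI)
      fix n
      show "ideal (I' n) R" unfolding I'_def by (intro sat_ideal p add_ideals PI I)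
      show "sat p (I' n) \<subseteq> I' n" unfolding I'_def by (intro sat_sat p subset_refl)
      show "I' (Suc n) \<subseteq> I' n" unfolding I'_def by (intro sat_mono set_add_mono I subset_refl)
      show "J' \<subseteq> I' n" unfolding I'_def J'_def by (intro sat_mono set_add_mono I subset_refl)
    qed
    then obtain n1 where n1: "\<And>k. k \<ge> n1 \<Longrightarrow> I' k = I' n1" using stab by blast
    \<comment> \<open>From \<open>n1\<close> on the enlarged chain is stable. From \<open>n2\<close>
      on the members no longer contain \<open>a\<close>, so \<open>c a \<in> I n\<close> forces
      \<open>c \<in> p\<close>, that is \<open>c a \<in> J\<close>; hence the members are stable as
      well.\<close>
    define n where "n = max n1 n2"
    have "I k = I n" if "k \<ge> n" for k
    proof
      show "I k \<subseteq> I n" using anti[OF that] .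
      show "I n \<subseteq> I k"
      proof
        fix f assume f: "f \<in> I n"
        have "I n \<subseteq> I' n" unfolding I'_def
          by (meson I(1) PI add_ideals ideal_sum_left order_trans p sat_incl)
        moreover have "I' n = I' k" using n1[of n] n1[of k] that by (simp add: n_def)
        ultimately have "f \<in> sat p (I k <+>\<^bsub>R\<^esub> PIdl a)" using f by (auto simp: I'_def)
        then obtain s where s: "s \<in> carrier R - p" "s \<otimes> f \<in> I k <+>\<^bsub>R\<^esub> PIdl a" "f \<in> carrier R"
          by (auto simp: sat_def)
        then obtain g c where g: "g \<in> I k" "c \<in> carrier R" "s \<otimes> f = g \<oplus> c \<otimes> a"
          by (auto elim!: set_add_memE simp: mem_PIdl)
        have gc: "g \<in> carrier R" using g I ideal_carr by blast
        have "c \<otimes> a = s \<otimes> f \<ominus> g" using g gc s a by (intro eq_sum_imp_minus) auto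
        moreover have "s \<otimes> f \<in> I n" using f s I(1) by (auto intro: ideal_mult_left)
        moreover have "g \<in> I n" using g anti[OF that] by blast
        ultimately have ca: "c \<otimes> a \<in> I n" using ideal_minus[OF I(1)] by simp
        have "c \<in> p"
        proof (rule ccontr)
          assume "c \<notin> p"
          then have "a \<in> sat p (I n)" using ca a g by (auto simp: sat_def)
          then have "a \<in> I n2" using I(2)[of n] anti[of n2 n] by (auto simp: n_def)
          then show False using n2 by simp
        qed
        then have "c \<otimes> a \<in> J" using colon a g by (auto simp: ideal_colon_def m_comm)
        then have "c \<otimes> a \<in> I k" using I(4) by blast
        then have "s \<otimes> f \<in> I k" using g ideal_add[OF I(1)] by simp
        then show "f \<in> I k" using s I(2)[of k] by (auto simp: sat_def)
      qed
    qed
    then show False using nstab by blast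
  qed
qed

text \<open>Nakayama's lemma for the quotient \<open>I/K\<close> localized at \<open>p\<close>. A
  maximal proper saturated \<open>L\<close> between \<open>K\<close> and \<open>I\<close> reduces it
  to a quotient generated by one element \<open>a\<close>, where the determinant trick shrinks to
  \<open>(s - c) a = l\<close> with \<open>s\<close> outside and \<open>c\<close> inside
  \<open>p\<close>.\<close>

lemma saturated_nakayama:
  assumes p: "primeideal p R" and K: "ideal K R" "sat p K \<subseteq> K" and I: "ideal I R" "sat p I \<subseteq> I"
    and sub: "K \<subseteq> I" "I \<subseteq> sat p (K <+>\<^bsub>R\<^esub> ideal_prod R p I)"
  shows "I \<subseteq> K"
proof (rule ccontr)
  assume contra: "\<not> I \<subseteq> K"
  define S where "S = {L. ideal L R \<and> sat p L \<subseteq> L \<and> K \<subseteq> L \<and> L \<subset> I}"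
  have "K \<in> S" using contra K sub by (auto simp: S_def)
  moreover have "\<And>I. I \<in> S \<Longrightarrow> ideal I R" by (simp add: S_def)
  ultimately obtain L where L: "L \<in> S" "\<And>L'. L' \<in> S \<Longrightarrow> L \<subseteq> L' \<Longrightarrow> L' = L"
    using ideal_set_has_maximal[of S] by blast
  then have Lid: "ideal L R" "sat p L \<subseteq> L" "K \<subseteq> L" "L \<subset> I" by (auto simp: S_def)
  then obtain a where a: "a \<in> I" "a \<notin> L" by blast
  have ac: "a \<in> carrier R" using a I ideal_carr by blast
  have PI: "ideal (PIdl a) R" using ac by (auto intro: cgenideal_ideal)
  have pid: "ideal p R" using p by (rule primeideal.axioms(1))
  define L' where "L' = sat p (L <+>\<^bsub>R\<^esub> PIdl a)"
  have LPid: "ideal (L <+>\<^bsub>R\<^esub> PIdl a) R" by (intro add_ideals Lid PI)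
  have "L \<subseteq> L'" "a \<in> L'"
    using sat_incl[OF p LPid] ideal_sum_left[OF Lid(1) PI] ideal_sum_right[OF Lid(1) PI] cgenideal_self[OF ac]
    unfolding L'_def by blast+
  have "L' \<subseteq> I"
  proof -
    have "PIdl a \<subseteq> I" using a I by (auto simp: mem_PIdl intro: ideal_mult_left)
    then have "L <+>\<^bsub>R\<^esub> PIdl a \<subseteq> I" using Lid I by (intro ideal_sum_minimal) auto
    then show ?thesis using sat_mono[of "L <+>\<^bsub>R\<^esub> PIdl a" I p] I unfolding L'_def by blast
  qed
  have L'id: "ideal L' R" "sat p L' \<subseteq> L'" unfolding L'_def by (intro sat_ideal sat_sat p LPid subset_refl)+
  \<comment> \<open>By maximality of \<open>L\<close>, the element \<open>a\<close> generates
    \<open>I\<close> over \<open>L\<close> up to saturation.\<close>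
  have I_eq: "I = L'"
  proof (rule ccontr)
    assume "I \<noteq> L'"
    then have "L' \<in> S" using L'id \<open>L' \<subseteq> I\<close> \<open>L \<subseteq> L'\<close> Lid by (auto simp: S_def)
    then show False using L(2) \<open>L \<subseteq> L'\<close> \<open>a \<in> L'\<close> a by blast
  qed
  define T where "T = {c \<otimes> a |c. c \<in> p}"
  have pa: "ideal_prod R p (PIdl a) \<subseteq> T"
  proof
    fix x assume "x \<in> ideal_prod R p (PIdl a)"
    then show "x \<in> T"
    proof induction
      case (prod i j)
      then obtain c where c: "c \<in> carrier R" "j = c \<otimes> a" by (auto simp: mem_PIdl)
      have ic: "i \<in> carrier R" using prod pid ideal_carr by blast
      then have "i \<otimes> j = (c \<otimes> i) \<otimes> a" using c ac by (simp add: m_ac)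
      moreover have "c \<otimes> i \<in> p" using c prod pid by (auto intro: ideal_mult_left)
      ultimately show ?case by (auto simp: T_def)
    next
      case (sum s t)
      then obtain c d where cd: "c \<in> p" "d \<in> p" "s = c \<otimes> a" "t = d \<otimes> a" by (auto simp: T_def)
      then have "s \<oplus> t = (c \<oplus> d) \<otimes> a" using pid ac by (auto simp: l_distr ideal_carr)
      then show ?case using cd pid ideal_add by (auto simp: T_def)
    qed
  qed
  have ppid: "ideal (ideal_prod R p (PIdl a)) R" by (intro ideal_prod_is_ideal pid PI)
  have Tid: "ideal (L <+>\<^bsub>R\<^esub> ideal_prod R p (PIdl a)) R" by (intro add_ideals Lid ppid)
  have "ideal_prod R p I \<subseteq> sat p (L <+>\<^bsub>R\<^esub> ideal_prod R p (PIdl a))"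
  proof (rule ideal_prod_le)
    show "ideal (sat p (L <+>\<^bsub>R\<^esub> ideal_prod R p (PIdl a))) R" by (intro sat_ideal p Tid)
    fix i j assume ij: "i \<in> p" "j \<in> I"
    then obtain s where s: "s \<in> carrier R - p" "s \<otimes> j \<in> L <+>\<^bsub>R\<^esub> PIdl a" "j \<in> carrier R"
      using I_eq by (auto simp: L'_def sat_def)
    then obtain l w where lw: "l \<in> L" "w \<in> PIdl a" "s \<otimes> j = l \<oplus> w"
      by (auto elim!: set_add_memE)
    have c: "i \<in> carrier R" "l \<in> carrier R" "w \<in> carrier R"
      using ij pid lw Lid PI ideal_carr by blast+
    have "s \<otimes> (i \<otimes> j) = i \<otimes> (s \<otimes> j)" using c s by (simp add: m_ac)
    also have "\<dots> = i \<otimes> l \<oplus> i \<otimes> w" using lw c by (simp add: r_distr)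
    also have "\<dots> \<in> L <+>\<^bsub>R\<^esub> ideal_prod R p (PIdl a)"
      using c lw ij Lid by (intro set_add_memI ideal_prod.prod) (auto intro: ideal_mult_left)
    finally show "i \<otimes> j \<in> sat p (L <+>\<^bsub>R\<^esub> ideal_prod R p (PIdl a))" using s c by (auto simp: sat_def)
  qed
  moreover have "K \<subseteq> sat p (L <+>\<^bsub>R\<^esub> ideal_prod R p (PIdl a))"
    using Lid sat_incl[OF p Tid] ideal_sum_left[OF Lid(1) ppid] by blast
  ultimately have "K <+>\<^bsub>R\<^esub> ideal_prod R p I \<subseteq> sat p (L <+>\<^bsub>R\<^esub> ideal_prod R p (PIdl a))"
    by (intro ideal_sum_minimal sat_ideal p Tid)
  then have "sat p (K <+>\<^bsub>R\<^esub> ideal_prod R p I) \<subseteq> sat p (L <+>\<^bsub>R\<^esub> ideal_prod R p (PIdl a))"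
    using sat_mono sat_sat[OF p subset_refl p] by blast
  then have "a \<in> sat p (L <+>\<^bsub>R\<^esub> ideal_prod R p (PIdl a))" using sub a by blast
  then obtain s where s: "s \<in> carrier R - p" "s \<otimes> a \<in> L <+>\<^bsub>R\<^esub> ideal_prod R p (PIdl a)"
    by (auto simp: sat_def)
  then obtain l c where lc: "l \<in> L" "c \<in> p" "s \<otimes> a = l \<oplus> c \<otimes> a"
    using pa by (auto elim!: set_add_memE simp: T_def)
  have cc: "c \<in> carrier R" "l \<in> carrier R" using lc pid Lid ideal_carr by blast+
  have "s \<ominus> c \<notin> p"
  proof
    assume "s \<ominus> c \<in> p"
    then have "(s \<ominus> c) \<oplus> c \<in> p" using lc pid ideal_add by auto
    moreover have "(s \<ominus> c) \<oplus> c = s" using s cc by (simp add: minus_eq a_assoc l_neg)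
    ultimately show False using s by simp
  qed
  moreover have "(s \<ominus> c) \<otimes> a = l"
    using s cc lc ac by (simp add: minus_eq l_distr l_minus a_assoc r_neg)
  ultimately have "a \<in> sat p L" using s cc ac lc by (auto simp: sat_def intro!: bexI[of _ "s \<ominus> c"])
  then show False using Lid a by blast
qed

text \<open>Krull's principal ideal theorem for the noetherian domain \<open>R/P\<close>, with all localizations
  replaced by saturations.\<close>

lemma principal_ideal_theorem:
  assumes P: "primeideal P R" and Q: "primeideal Q R" and p: "primeideal p R"
    and PQ: "P \<subset> Q" and Qp: "Q \<subset> p" and x: "x \<in> p"
    and min: "\<And>L. primeideal L R \<Longrightarrow> P \<subseteq> L \<Longrightarrow> x \<in> L \<Longrightarrow> L \<subseteq> p \<Longrightarrow> L = p"
  shows False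
proof -
  have id: "ideal P R" "ideal Q R" "ideal p R" using P Q p by (auto dest: primeideal.axioms(1))
  have xc: "x \<in> carrier R" using x id ideal_carr by blast
  have xQ: "x \<notin> Q" using min[OF Q] PQ Qp by blast
  define W where "W n = P <+>\<^bsub>R\<^esub> ideal_pow R Q n" for n
  have Wid: "ideal (W n) R" for n unfolding W_def by (intro add_ideals id ideal_pow_ideal)
  \<comment> \<open>\<open>S n\<close> is the preimage in \<open>R\<close> of the
    \<open>n\<close>-th symbolic power of \<open>Q/P\<close>.\<close>
  define S where "S n = sat Q (W n)" for n
  have Sid: "ideal (S n) R" for n unfolding S_def by (intro sat_ideal Q Wid)
  have SQ: "sat Q (S n) \<subseteq> S n" for n unfolding S_def by (intro sat_sat Q subset_refl)
  have Sp: "sat p (S n) \<subseteq> S n" for n unfolding S_def using Qp by (intro sat_sat Q p) auto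
  have W_Suc: "W (Suc n) \<subseteq> W n" for n
    unfolding W_def by (intro set_add_mono subset_refl ideal_pow_antimono_Suc id)
  have S_Suc: "S (Suc n) \<subseteq> S n" for n unfolding S_def by (intro sat_mono W_Suc)
  have WS: "W n \<subseteq> S n" for n unfolding S_def by (intro sat_incl Q Wid)
  have PS: "P \<subseteq> S n" for n
    using WS[of n] ideal_sum_left[OF id(1) ideal_pow_ideal[OF id(2), of n]] unfolding W_def by blast
  have Px: "ideal (PIdl x) R" using xc by (rule cgenideal_ideal)
  \<comment> \<open>These ideals contain \<open>P + (x)\<close>, over which \<open>p\<close> is
    minimal, so they stabilize although the chain \<open>S n\<close> is not yet known to do
    so.\<close>
  define I where "I n = sat p (S n <+>\<^bsub>R\<^esub> PIdl x)" for n
  have SxId: "ideal (S n <+>\<^bsub>R\<^esub> PIdl x) R" for n by (intro add_ideals Sid Px)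
  have SI: "S n <+>\<^bsub>R\<^esub> PIdl x \<subseteq> I n" for n unfolding I_def by (intro sat_incl p SxId)
  have "\<exists>n. \<forall>k\<ge>n. I k = I n"
  proof (rule saturated_dcc[OF p, of "P <+>\<^bsub>R\<^esub> PIdl x"])
    show "ideal (P <+>\<^bsub>R\<^esub> PIdl x) R" by (intro add_ideals id Px)
    fix L assume L: "primeideal L R" "P <+>\<^bsub>R\<^esub> PIdl x \<subseteq> L" "L \<subseteq> p"
    moreover have "P \<subseteq> L" "x \<in> L"
      using L(2) ideal_sum_left[OF id(1) Px] ideal_sum_right[OF id(1) Px] cgenideal_self[OF xc] by blast+
    ultimately show "L = p" using min by blast
  next
    fix n
    show "ideal (I n) R" unfolding I_def by (intro sat_ideal p SxId)
    show "sat p (I n) \<subseteq> I n" unfolding I_def by (intro sat_sat p subset_refl)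
    show "I (Suc n) \<subseteq> I n" unfolding I_def by (intro sat_mono set_add_mono S_Suc subset_refl)
    show "P <+>\<^bsub>R\<^esub> PIdl x \<subseteq> I n" using SI[of n] set_add_mono[OF PS[of n] subset_refl] by blast
  qed
  then obtain n where n: "I (Suc n) = I n" by (metis le_SucI order_refl)
  \<comment> \<open>Stability gives \<open>s f = g + c x\<close> with \<open>g\<close> in
    \<open>S (Suc n)\<close>. Then \<open>c x \<in> S n\<close>, and as \<open>x\<close> lies
    outside \<open>Q\<close> already \<open>c \<in> S n\<close>. So \<open>S n\<close> is
    \<open>S (Suc n) + p (S n)\<close> up to saturation, and Nakayama's lemma applies at
    \<open>p\<close>.\<close>
  have "S n \<subseteq> S (Suc n)"
  proof (rule saturated_nakayama[OF p Sid Sp Sid Sp S_Suc])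
    show "S n \<subseteq> sat p (S (Suc n) <+>\<^bsub>R\<^esub> ideal_prod R p (S n))"
    proof
      fix f assume f: "f \<in> S n"
      then have "f \<in> I (Suc n)" using SI[of n] ideal_sum_left[OF Sid[of n] Px] n by blast
      then obtain s where s: "s \<in> carrier R - p" "s \<otimes> f \<in> S (Suc n) <+>\<^bsub>R\<^esub> PIdl x" "f \<in> carrier R"
        by (auto simp: I_def sat_def)
      then obtain g c where g: "g \<in> S (Suc n)" "c \<in> carrier R" "s \<otimes> f = g \<oplus> c \<otimes> x"
        by (auto elim!: set_add_memE simp: mem_PIdl)
      have gc: "g \<in> carrier R" using g Sid ideal_carr by blast
      have "c \<otimes> x = s \<otimes> f \<ominus> g" using g gc s xc by (intro eq_sum_imp_minus) auto
      moreover have "s \<otimes> f \<in> S n" using f s Sid by (auto intro: ideal_mult_left)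
      moreover have "g \<in> S n" using g S_Suc by blast
      ultimately have "c \<otimes> x \<in> S n" using ideal_minus[OF Sid] by simp
      then have "x \<otimes> c \<in> S n" using g xc by (simp add: m_comm)
      then have "c \<in> sat Q (S n)" using xQ xc g by (auto simp: sat_def)
      then have "x \<otimes> c \<in> ideal_prod R p (S n)" using SQ x by (intro ideal_prod.prod) auto
      then have "s \<otimes> f \<in> S (Suc n) <+>\<^bsub>R\<^esub> ideal_prod R p (S n)"
        using g xc by (auto simp: m_comm intro!: set_add_memI)
      then show "f \<in> sat p (S (Suc n) <+>\<^bsub>R\<^esub> ideal_prod R p (S n))" using s by (auto simp: sat_def)
    qed
  qed
  have "sat Q P \<subseteq> P"
    using primeideal.I_prime[OF P] PQ by (auto simp: sat_def)
  \<comment> \<open>Nakayama's lemma a second time, now at \<open>Q\<close>: equality of two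
    consecutive symbolic powers makes the \<open>n\<close>-th one vanish modulo \<open>P\<close>, so
    the \<open>n\<close>-th power of every element of \<open>Q\<close> lies in
    \<open>P\<close>.\<close>
  have "S n \<subseteq> P"
  proof (rule saturated_nakayama[OF Q id(1) \<open>sat Q P \<subseteq> P\<close> Sid SQ PS])
    have "W (Suc n) \<subseteq> P <+>\<^bsub>R\<^esub> ideal_prod R Q (S n)"
    proof -
      have "ideal_pow R Q n \<subseteq> S n"
        using WS[of n] ideal_sum_right[OF id(1) ideal_pow_ideal[OF id(2), of n]] unfolding W_def by blast
      then have "ideal_pow R Q (Suc n) \<subseteq> ideal_prod R Q (S n)"
        unfolding ideal_pow.simps
        by (intro ideal_prod_le ideal_prod_is_ideal id Sid ideal_prod.prod) auto
      then show ?thesis unfolding W_def by (intro set_add_mono) auto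
    qed
    then show "S n \<subseteq> sat Q (P <+>\<^bsub>R\<^esub> ideal_prod R Q (S n))"
      using \<open>S n \<subseteq> S (Suc n)\<close> sat_mono unfolding S_def by blast
  qed
  have "Q \<subseteq> P"
  proof
    fix y assume y: "y \<in> Q"
    then have yc: "y \<in> carrier R" using id ideal_carr by blast
    have "y [^] n \<in> S n"
      using pow_in_ideal_pow[OF y yc, of n] WS[of n] ideal_sum_right[OF id(1) ideal_pow_ideal[OF id(2), of n]]
      unfolding W_def by blast
    then show "y \<in> P" using \<open>S n \<subseteq> P\<close> prime_pow[OF P yc] by blast
  qed
  then show False using PQ by blast
qed

end

section \<open>The completion\<close>

declare ideal_pow.simps(2) [simp del]

locale noetherian_local_ring = noetherian_cring R for R :: "'a ring" (structure) +
  fixes m :: "'a set"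
  assumes maximal: "maximalideal m R" and maximal_unique: "maximalideal I R \<Longrightarrow> I = m"
begin

abbreviation pw :: "nat \<Rightarrow> 'a set" where "pw \<equiv> ideal_pow R m"
abbreviation Rhat :: "(nat \<Rightarrow> 'a set) ring" where "Rhat \<equiv> completion R m"

section \<open>The maximal ideal and its powers\<close>

lemma m_ideal: "ideal m R"
  using maximal by (rule maximalideal.axioms(1))

lemma m_prime: "primeideal m R"
  using maximal by (rule maximalideal_prime)

lemma pw_ideal: "ideal (pw n) R"
  by (rule ideal_pow_ideal[OF m_ideal])

lemma pw_antimono: "k \<le> n \<Longrightarrow> pw n \<subseteq> pw k"
  using lift_Suc_antimono_le[of pw, OF ideal_pow_antimono_Suc[OF m_ideal]] .

lemma proper_ideal_subset_m:
  assumes I: "ideal I R" "I \<noteq> carrier R" shows "I \<subseteq> m"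
proof -
  define S where "S = {J. ideal J R \<and> J \<noteq> carrier R \<and> I \<subseteq> J}"
  have "\<exists>M\<in>S. \<forall>J\<in>S. M \<subseteq> J \<longrightarrow> J = M"
    by (rule ideal_set_has_maximal) (use I in \<open>auto simp: S_def\<close>)
  then obtain M where M: "M \<in> S" "\<And>J. J \<in> S \<Longrightarrow> M \<subseteq> J \<Longrightarrow> J = M" by blast
  have "maximalideal M R"
  proof (rule maximalidealI)
    show "ideal M R" "carrier R \<noteq> M" using M(1) by (auto simp: S_def)
    fix J assume J: "ideal J R" "M \<subseteq> J" "J \<subseteq> carrier R"
    show "J = M \<or> J = carrier R"
    proof (rule disjCI)
      assume "J \<noteq> carrier R"
      then have "J \<in> S" using J M(1) by (auto simp: S_def)
      then show "J = M" using M(2) J(2) by blast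
    qed
  qed
  then have "M = m" by (rule maximal_unique)
  then show ?thesis using M(1) by (auto simp: S_def)
qed

lemma unit_mod_m:
  assumes u: "u \<in> carrier R" "u \<notin> m" obtains v where "v \<in> carrier R" "v \<otimes> u = \<one>"
proof -
  have "PIdl u = carrier R"
    using proper_ideal_subset_m[OF cgenideal_ideal[OF u(1)]] cgenideal_self[OF u(1)] u(2) by blast
  then have "\<one> \<in> PIdl u" by simp
  then show thesis using that unfolding mem_PIdl by metis
qed

text \<open>Elements of the completion are handled as limits of sequences converging at the fixed
  rate \<open>m^n\<close>. The term \<open>r n\<close> alone determines the \<open>n\<close>-th
  coset, so the ring operations can be computed termwise.\<close>

definition compat :: "(nat \<Rightarrow> 'a) \<Rightarrow> bool" where
  "compat r \<longleftrightarrow> (\<forall>n. r n \<in> carrier R) \<and> (\<forall>n. r (Suc n) \<ominus> r n \<in> pw n)"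

definition lim :: "(nat \<Rightarrow> 'a) \<Rightarrow> nat \<Rightarrow> 'a set" where
  "lim r n = pw n +> r n"

lemma coset_eq_iff: "a \<in> carrier R \<Longrightarrow> b \<in> carrier R \<Longrightarrow> pw n +> a = pw n +> b \<longleftrightarrow> a \<ominus> b \<in> pw n"
  using quotient_eq_iff_same_a_r_cos[OF pw_ideal] by blast

lemma coset_self: "a \<in> carrier R \<Longrightarrow> a \<in> pw n +> a"
  using abelian_subgroup.a_rcos_self[OF abelian_subgroupI3[OF ideal.axioms(1)[OF pw_ideal] is_abelian_group]] .

lemma coset_mem: "a \<in> carrier R \<Longrightarrow> b \<in> pw n +> a \<Longrightarrow> b \<in> carrier R \<and> b \<ominus> a \<in> pw n"
proof -
  assume a: "a \<in> carrier R" "b \<in> pw n +> a"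
  then obtain h where h: "h \<in> pw n" "b = h \<oplus> a" by (auto simp: a_r_coset_def')
  have "h \<in> carrier R" using ideal_carr[OF pw_ideal] h by blast
  moreover from this have "h = b \<ominus> a" using h a eq_sum_imp_minus[of a h b] a_comm[of a h] by simp
  ultimately show ?thesis using h a by (metis a_closed)
qed

lemma minus_trans:
  "a \<in> carrier R \<Longrightarrow> b \<in> carrier R \<Longrightarrow> c \<in> carrier R \<Longrightarrow> ideal I R \<Longrightarrow> a \<ominus> b \<in> I \<Longrightarrow> b \<ominus> c \<in> I \<Longrightarrow> a \<ominus> c \<in> I"
proof -
  assume *: "a \<in> carrier R" "b \<in> carrier R" "c \<in> carrier R" "ideal I R" "a \<ominus> b \<in> I" "b \<ominus> c \<in> I"
  then have "(a \<ominus> b) \<oplus> (b \<ominus> c) \<in> I" by (intro ideal_add)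
  moreover have "(a \<ominus> b) \<oplus> (b \<ominus> c) = a \<ominus> c" using * by algebra
  ultimately show ?thesis by simp
qed

lemma compat_minus:
  assumes "compat r" "k \<le> n" shows "r n \<ominus> r k \<in> pw k"
  using assms(2)
proof (induction n rule: dec_induct)
  case base
  then show ?case using assms(1) ideal_zero[OF pw_ideal] by (simp add: compat_def a_minus_def r_neg)
next
  case (step n)
  then have "r (Suc n) \<ominus> r n \<in> pw k" using assms(1) pw_antimono[of k n] by (auto simp: compat_def)
  then show ?case using step.IH minus_trans[OF _ _ _ pw_ideal, of "r (Suc n)" "r n" "r k" k] assms(1) by (auto simp: compat_def)
qed

lemma lim_carrier: "compat r \<Longrightarrow> lim r \<in> carrier Rhat"
proof -
  assume r: "compat r"
  have "lim r n \<in> a_rcosets (pw n)" for n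
    using r ideal_carr[OF pw_ideal] by (auto simp: lim_def compat_def intro!: a_rcosetsI)
  moreover have "lim r (Suc n) \<subseteq> lim r n" for n
  proof
    fix b assume "b \<in> lim r (Suc n)"
    then have b: "b \<in> carrier R" "b \<ominus> r (Suc n) \<in> pw (Suc n)"
      using r coset_mem[of "r (Suc n)" b "Suc n"] by (auto simp: lim_def compat_def)
    then have "b \<ominus> r n \<in> pw n"
      using r pw_antimono[of n "Suc n"] minus_trans[OF _ _ _ pw_ideal, of b "r (Suc n)" "r n"] 
      by (auto simp: compat_def)
    then have "pw n +> b = pw n +> r n" using r b coset_eq_iff by (auto simp: compat_def)
    then show "b \<in> lim r n" using coset_self[OF b(1)] by (auto simp: lim_def)
  qed
  ultimately show ?thesis by (simp add: completion_def)
qed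

lemma lim_eq_iff:
  "compat r \<Longrightarrow> compat s \<Longrightarrow> lim r = lim s \<longleftrightarrow> (\<forall>n. r n \<ominus> s n \<in> pw n)"
  by (auto simp: lim_def fun_eq_iff coset_eq_iff compat_def)

lemma rep_prop:
  assumes "x \<in> carrier Rhat"
  shows "compl_rep R m x n \<in> carrier R" "x n = pw n +> compl_rep R m x n"
proof -
  have "x n \<in> a_rcosets (pw n)" using assms by (auto simp: completion_def)
  then have "\<exists>a. a \<in> carrier R \<and> x n = pw n +> a" by (auto simp: A_RCOSETS_def')
  from someI_ex[OF this] show "compl_rep R m x n \<in> carrier R" "x n = pw n +> compl_rep R m x n"
    by (auto simp: compl_rep_def)
qed

lemma compat_rep: "x \<in> carrier Rhat \<Longrightarrow> compat (compl_rep R m x)"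
proof -
  assume x: "x \<in> carrier Rhat"
  have "compl_rep R m x (Suc n) \<ominus> compl_rep R m x n \<in> pw n" for n
  proof -
    have "compl_rep R m x (Suc n) \<in> x (Suc n)" using rep_prop[OF x] coset_self by metis
    then have "compl_rep R m x (Suc n) \<in> x n" using x by (auto simp: completion_def)
    then show ?thesis using rep_prop[OF x] coset_mem by metis
  qed
  then show ?thesis using rep_prop[OF x] by (auto simp: compat_def)
qed

lemma lim_rep: "x \<in> carrier Rhat \<Longrightarrow> lim (compl_rep R m x) = x"
  using rep_prop(2) by (auto simp: lim_def fun_eq_iff)

lemma Rhat_cases:
  assumes "x \<in> carrier Rhat" obtains r where "compat r" "x = lim r"
  using that compat_rep lim_rep assms by metis

text \<open>The choice made by \<open>compl_rep\<close> need not return \<open>r\<close>, only a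
  sequence congruent to it at every level. This is what frees the operations and the action on
  \<open>E\<close> from that choice.\<close>

lemma rep_lim: "compat r \<Longrightarrow> compl_rep R m (lim r) n \<ominus> r n \<in> pw n"
  using compat_rep[OF lim_carrier, of r] lim_eq_iff[of "compl_rep R m (lim r)" r] lim_rep[OF lim_carrier, of r] by blast

section \<open>Ring operations on limits\<close>

lemma compat_add: "compat r \<Longrightarrow> compat s \<Longrightarrow> compat (\<lambda>n. r n \<oplus> s n)"
proof -
  assume *: "compat r" "compat s"
  have "(r (Suc n) \<oplus> s (Suc n)) \<ominus> (r n \<oplus> s n) = (r (Suc n) \<ominus> r n) \<oplus> (s (Suc n) \<ominus> s n)" for n
  proof -
    have "r (Suc n) \<in> carrier R" "s (Suc n) \<in> carrier R" "r n \<in> carrier R" "s n \<in> carrier R"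
      using * by (auto simp: compat_def)
    then show ?thesis by algebra
  qed
  then show ?thesis using * by (auto simp: compat_def intro!: ideal_add[OF pw_ideal])
qed

lemma mult_minus_mem:
  assumes "ideal I R" "a \<in> carrier R" "b \<in> carrier R" "c \<in> carrier R" "d \<in> carrier R"
    "a \<ominus> c \<in> I" "b \<ominus> d \<in> I"
  shows "a \<otimes> b \<ominus> c \<otimes> d \<in> I"
proof -
  have "a \<otimes> b \<ominus> c \<otimes> d = b \<otimes> (a \<ominus> c) \<oplus> c \<otimes> (b \<ominus> d)" using assms by algebra
  then show ?thesis using assms by (auto intro!: ideal_add ideal_mult_left)
qed

lemma add_minus_mem:
  assumes "ideal I R" "a \<in> carrier R" "b \<in> carrier R" "c \<in> carrier R" "d \<in> carrier R"
    "a \<ominus> c \<in> I" "b \<ominus> d \<in> I"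
  shows "(a \<oplus> b) \<ominus> (c \<oplus> d) \<in> I"
proof -
  have "(a \<oplus> b) \<ominus> (c \<oplus> d) = (a \<ominus> c) \<oplus> (b \<ominus> d)" using assms by algebra
  then show ?thesis using assms by (auto intro!: ideal_add ideal_mult_left)
qed

lemma compat_mult: "compat r \<Longrightarrow> compat s \<Longrightarrow> compat (\<lambda>n. r n \<otimes> s n)"
  using mult_minus_mem[OF pw_ideal] by (auto simp: compat_def)

lemma compat_const: "a \<in> carrier R \<Longrightarrow> compat (\<lambda>_. a)"
  using ideal_zero[OF pw_ideal] by (auto simp: compat_def a_minus_def r_neg)

lemma lim_add: "compat r \<Longrightarrow> compat s \<Longrightarrow> lim r \<oplus>\<^bsub>Rhat\<^esub> lim s = lim (\<lambda>n. r n \<oplus> s n)"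
  using rep_lim[of r] rep_lim[of s] compat_rep[OF lim_carrier, of r] compat_rep[OF lim_carrier, of s]
  by (auto simp: completion_def lim_def[of "\<lambda>n. r n \<oplus> s n"] fun_eq_iff coset_eq_iff compat_def
      intro!: add_minus_mem[OF pw_ideal])

lemma lim_mult: "compat r \<Longrightarrow> compat s \<Longrightarrow> lim r \<otimes>\<^bsub>Rhat\<^esub> lim s = lim (\<lambda>n. r n \<otimes> s n)"
  using rep_lim[of r] rep_lim[of s] compat_rep[OF lim_carrier, of r] compat_rep[OF lim_carrier, of s]
  by (auto simp: completion_def lim_def[of "\<lambda>n. r n \<otimes> s n"] fun_eq_iff coset_eq_iff compat_def
      intro!: mult_minus_mem[OF pw_ideal])

lemma lim_zero: "\<zero>\<^bsub>Rhat\<^esub> = lim (\<lambda>_. \<zero>)"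
  by (auto simp: completion_def lim_def)

lemma lim_one: "\<one>\<^bsub>Rhat\<^esub> = lim (\<lambda>_. \<one>)"
  by (auto simp: completion_def lim_def)

lemma canon_lim: "compl_canon R m r = lim (\<lambda>_. r)"
  by (auto simp: compl_canon_def lim_def)

lemma canon_carrier: "r \<in> carrier R \<Longrightarrow> compl_canon R m r \<in> carrier Rhat"
  by (simp add: canon_lim lim_carrier compat_const)

lemma canon_add: "r \<in> carrier R \<Longrightarrow> s \<in> carrier R \<Longrightarrow>
    compl_canon R m (r \<oplus> s) = compl_canon R m r \<oplus>\<^bsub>Rhat\<^esub> compl_canon R m s"
  by (simp add: canon_lim lim_add compat_const)

lemma canon_mult: "r \<in> carrier R \<Longrightarrow> s \<in> carrier R \<Longrightarrow>
    compl_canon R m (r \<otimes> s) = compl_canon R m r \<otimes>\<^bsub>Rhat\<^esub> compl_canon R m s"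
  by (simp add: canon_lim lim_mult compat_const)

lemma canon_zero: "compl_canon R m \<zero> = \<zero>\<^bsub>Rhat\<^esub>"
  by (simp add: canon_lim lim_zero)

lemma canon_one: "compl_canon R m \<one> = \<one>\<^bsub>Rhat\<^esub>"
  by (simp add: canon_lim lim_one)

lemma compat_carr: "compat r \<Longrightarrow> r n \<in> carrier R"
  by (simp add: compat_def)

lemma Rhat_cring: "cring Rhat"
proof (rule cringI)
  show "abelian_group Rhat"
  proof (rule abelian_groupI)
    fix x assume "x \<in> carrier Rhat"
    then obtain r where r: "compat r" "x = lim r" by (rule Rhat_cases)
    \<comment> \<open>The negative is taken as the product with the constant sequence
      \<open>-1\<close>, whose compatibility is covered by \<open>compat_mult\<close> and
      \<open>compat_const\<close>.\<close>
    have "compat (\<lambda>n. \<ominus> \<one> \<otimes> r n)" by (intro compat_mult compat_const r) auto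
    moreover have "lim (\<lambda>n. \<ominus> \<one> \<otimes> r n) \<oplus>\<^bsub>Rhat\<^esub> x = \<zero>\<^bsub>Rhat\<^esub>"
      using calculation r compat_carr[OF r(1)] by (simp add: lim_add lim_zero l_minus l_neg)
    ultimately show "\<exists>y\<in>carrier Rhat. y \<oplus>\<^bsub>Rhat\<^esub> x = \<zero>\<^bsub>Rhat\<^esub>" using lim_carrier by blast
  qed (auto elim!: Rhat_cases simp: lim_zero lim_add compat_const compat_add lim_carrier a_ac compat_carr)
  show "comm_monoid Rhat"
    by (rule comm_monoidI)
      (auto elim!: Rhat_cases simp: lim_one lim_mult compat_const compat_mult lim_carrier m_ac compat_carr)
qed (auto elim!: Rhat_cases simp: lim_mult lim_add compat_mult compat_add lim_carrier l_distr compat_carr)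

end

sublocale noetherian_local_ring \<subseteq> hat: plain_cring "completion R m"
  using Rhat_cring by (simp add: plain_cring_def)

context noetherian_local_ring
begin

section \<open>Contraction of ideals to the base ring\<close>

lemma contraction_ideal: "ideal Q Rhat \<Longrightarrow> ideal (contraction R m Q) R"
  by (rule ideal_intro) (auto simp: contraction_def canon_add canon_mult canon_zero canon_carrier
      hat.ideal_zero hat.ideal_add hat.ideal_mult_left)

lemma contraction_prime:
  assumes Q: "primeideal Q Rhat" shows "primeideal (contraction R m Q) R"
proof (rule primeidealI)
  show "ideal (contraction R m Q) R" using Q by (intro contraction_ideal primeideal.axioms(1))
  show "cring R" by unfold_locales
  have "\<one> \<notin> contraction R m Q" using hat.prime_one[OF Q] by (auto simp: contraction_def canon_one)
  then show "carrier R \<noteq> contraction R m Q" by auto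
  fix a b assume "a \<in> carrier R" "b \<in> carrier R" "a \<otimes> b \<in> contraction R m Q"
  then show "a \<in> contraction R m Q \<or> b \<in> contraction R m Q"
    using primeideal.I_prime[OF Q, of "compl_canon R m a" "compl_canon R m b"]
    by (auto simp: contraction_def canon_mult canon_carrier)
qed

end

section \<open>Homomorphisms between submodules of the injective hull\<close>

locale residue_hull = R?: noetherian_local_ring R m + M?: module R E
  for R :: "'a ring" (structure) and m :: "'a set" and E :: "('a, 'b) module" +
  fixes e\<^sub>0 :: 'b
  assumes e0_closed: "e\<^sub>0 \<in> carrier E"
    and e0_ann: "{r \<in> carrier R. r \<odot>\<^bsub>E\<^esub> e\<^sub>0 = \<zero>\<^bsub>E\<^esub>} = m"
    and e0_essential: "\<lbrakk>submodule V R E; v \<in> V; v \<noteq> \<zero>\<^bsub>E\<^esub>\<rbrakk> \<Longrightarrow>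
      \<exists>t\<in>carrier R. t \<odot>\<^bsub>E\<^esub> e\<^sub>0 \<in> V \<and> t \<odot>\<^bsub>E\<^esub> e\<^sub>0 \<noteq> \<zero>\<^bsub>E\<^esub>"
    and baer: "baer_injective R E"
begin

abbreviation act :: "(nat \<Rightarrow> 'a set) \<Rightarrow> 'b \<Rightarrow> 'b" where "act \<equiv> hat_smult R m E"

definition kills :: "nat \<Rightarrow> 'b \<Rightarrow> bool" where
  "kills n e \<longleftrightarrow> (\<forall>r\<in>pw n. r \<odot>\<^bsub>E\<^esub> e = \<zero>\<^bsub>E\<^esub>)"

definition linear_on :: "'b set \<Rightarrow> ('b \<Rightarrow> 'b) \<Rightarrow> bool" where
  "linear_on V f \<longleftrightarrow> f \<in> V \<rightarrow> carrier E \<and> (\<forall>x\<in>V. \<forall>y\<in>V. f (x \<oplus>\<^bsub>E\<^esub> y) = f x \<oplus>\<^bsub>E\<^esub> f y) \<and>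
     (\<forall>r\<in>carrier R. \<forall>x\<in>V. f (r \<odot>\<^bsub>E\<^esub> x) = r \<odot>\<^bsub>E\<^esub> f x)"

section \<open>Submodules of the hull and their homomorphisms\<close>

lemma sub_carr: "submodule V R E \<Longrightarrow> e \<in> V \<Longrightarrow> e \<in> carrier E"
  using submoduleE(1) by blast

lemma sub_smult: "submodule V R E \<Longrightarrow> e \<in> V \<Longrightarrow> r \<in> carrier R \<Longrightarrow> r \<odot>\<^bsub>E\<^esub> e \<in> V"
  using submoduleE(4) by blast

lemma sub_add: "submodule V R E \<Longrightarrow> e \<in> V \<Longrightarrow> f \<in> V \<Longrightarrow> e \<oplus>\<^bsub>E\<^esub> f \<in> V"
  using submoduleE(5) by blast

lemma sub_minus: "submodule V R E \<Longrightarrow> e \<in> V \<Longrightarrow> f \<in> V \<Longrightarrow> e \<ominus>\<^bsub>E\<^esub> f \<in> V"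
  using submoduleE(3,5) by (simp add: a_minus_def)

lemma sub_zero: "submodule V R E \<Longrightarrow> \<zero>\<^bsub>E\<^esub> \<in> V"
  using submoduleE(2)[of V] sub_carr[of V] sub_smult[of V _ \<zero>] by (metis ex_in_conv smult_l_null R.zero_closed)

lemma submodule_intro:
  assumes "V \<subseteq> carrier E" "\<zero>\<^bsub>E\<^esub> \<in> V" "\<And>e f. e \<in> V \<Longrightarrow> f \<in> V \<Longrightarrow> e \<oplus>\<^bsub>E\<^esub> f \<in> V"
    "\<And>r e. r \<in> carrier R \<Longrightarrow> e \<in> V \<Longrightarrow> r \<odot>\<^bsub>E\<^esub> e \<in> V"
  shows "submodule V R E"
proof (rule submoduleI)
  fix a assume "a \<in> V"
  then show "\<ominus>\<^bsub>E\<^esub> a \<in> V" using assms(4)[of "\<ominus> \<one>" a] assms(1) by (auto simp: smult_l_minus)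
qed (use assms in auto)

lemma smult_diff_l:
  "a \<in> carrier R \<Longrightarrow> b \<in> carrier R \<Longrightarrow> e \<in> carrier E \<Longrightarrow> (a \<ominus> b) \<odot>\<^bsub>E\<^esub> e = a \<odot>\<^bsub>E\<^esub> e \<ominus>\<^bsub>E\<^esub> b \<odot>\<^bsub>E\<^esub> e"
  by (simp add: a_minus_def smult_l_distr smult_l_minus)

lemma smult_diff_r:
  "a \<in> carrier R \<Longrightarrow> e \<in> carrier E \<Longrightarrow> f \<in> carrier E \<Longrightarrow> a \<odot>\<^bsub>E\<^esub> (e \<ominus>\<^bsub>E\<^esub> f) = a \<odot>\<^bsub>E\<^esub> e \<ominus>\<^bsub>E\<^esub> a \<odot>\<^bsub>E\<^esub> f"
  by (simp add: a_minus_def smult_r_distr smult_r_minus)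

lemma smult_swap:
  "a \<in> carrier R \<Longrightarrow> b \<in> carrier R \<Longrightarrow> e \<in> carrier E \<Longrightarrow> a \<odot>\<^bsub>E\<^esub> (b \<odot>\<^bsub>E\<^esub> e) = b \<odot>\<^bsub>E\<^esub> (a \<odot>\<^bsub>E\<^esub> e)"
  by (metis R.m_comm smult_assoc1)

lemma E_diff_zero: "e \<in> carrier E \<Longrightarrow> f \<in> carrier E \<Longrightarrow> e \<ominus>\<^bsub>E\<^esub> f = \<zero>\<^bsub>E\<^esub> \<longleftrightarrow> e = f"
  by (metis M.minus_equality M.minus_minus M.r_neg a_minus_def M.a_inv_closed M.minus_eq M.a_comm)

lemma E_diff_self: "e \<in> carrier E \<Longrightarrow> e \<ominus>\<^bsub>E\<^esub> e = \<zero>\<^bsub>E\<^esub>"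
  by (simp add: E_diff_zero)

lemma smult_eqI:
  assumes "a \<in> carrier R" "b \<in> carrier R" "e \<in> carrier E" "(a \<ominus> b) \<odot>\<^bsub>E\<^esub> e = \<zero>\<^bsub>E\<^esub>"
  shows "a \<odot>\<^bsub>E\<^esub> e = b \<odot>\<^bsub>E\<^esub> e"
  using assms by (simp add: smult_diff_l E_diff_zero)

lemma mod_ann_ideal: "X \<subseteq> carrier E \<Longrightarrow> ideal (mod_ann R E X) R"
  by (rule ideal_intro) (auto simp: mod_ann_def smult_l_distr smult_assoc1 subset_iff)

lemma linear_closed: "linear_on V f \<Longrightarrow> e \<in> V \<Longrightarrow> f e \<in> carrier E"
  by (auto simp: linear_on_def)

lemma linear_zero: 
  assumes "submodule V R E" "linear_on V f" shows "f \<zero>\<^bsub>E\<^esub> = \<zero>\<^bsub>E\<^esub>"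
proof -
  have "f (\<zero> \<odot>\<^bsub>E\<^esub> \<zero>\<^bsub>E\<^esub>) = \<zero> \<odot>\<^bsub>E\<^esub> f \<zero>\<^bsub>E\<^esub>"
    using sub_zero[OF assms(1)] assms(2) R.zero_closed unfolding linear_on_def by blast
  then show ?thesis using linear_closed[OF assms(2) sub_zero[OF assms(1)]] by simp
qed

lemma linear_diff:
  assumes V: "submodule V R E" and f: "linear_on V f" and e: "e \<in> V" "e' \<in> V"
  shows "f (e \<ominus>\<^bsub>E\<^esub> e') = f e \<ominus>\<^bsub>E\<^esub> f e'"
proof -
  have c: "e \<in> carrier E" "e' \<in> carrier E" using V e sub_carr by auto
  have "f ((\<ominus> \<one>) \<odot>\<^bsub>E\<^esub> e') = (\<ominus> \<one>) \<odot>\<^bsub>E\<^esub> f e'" using f e by (simp add: linear_on_def)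
  then have "f (\<ominus>\<^bsub>E\<^esub> e') = \<ominus>\<^bsub>E\<^esub> f e'" using c linear_closed[OF f] e by (simp add: smult_l_minus)
  moreover have "\<ominus>\<^bsub>E\<^esub> e' \<in> V" using V e submoduleE(3) by blast
  ultimately show ?thesis using f e by (simp add: a_minus_def linear_on_def)
qed

lemma linear_image_submodule:
  assumes V: "submodule V R E" and f: "linear_on V f" shows "submodule (f ` V) R E"
proof (rule submodule_intro)
  show "f ` V \<subseteq> carrier E" using f by (auto simp: linear_on_def)
  show "\<zero>\<^bsub>E\<^esub> \<in> f ` V" using linear_zero[OF assms] sub_zero[OF V] by (metis imageI)
next
  fix a b assume "a \<in> f ` V" "b \<in> f ` V"
  then obtain e e' where "e \<in> V" "e' \<in> V" "a = f e" "b = f e'" by blast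
  then have "a \<oplus>\<^bsub>E\<^esub> b = f (e \<oplus>\<^bsub>E\<^esub> e')" "e \<oplus>\<^bsub>E\<^esub> e' \<in> V" using f V sub_add by (auto simp: linear_on_def)
  then show "a \<oplus>\<^bsub>E\<^esub> b \<in> f ` V" by blast
next
  fix r a assume "r \<in> carrier R" "a \<in> f ` V"
  then obtain e where "e \<in> V" "a = f e" by blast
  then have "r \<odot>\<^bsub>E\<^esub> a = f (r \<odot>\<^bsub>E\<^esub> e)" "r \<odot>\<^bsub>E\<^esub> e \<in> V"
    using f V sub_smult \<open>r \<in> carrier R\<close> by (auto simp: linear_on_def)
  then show "r \<odot>\<^bsub>E\<^esub> a \<in> f ` V" by blast
qed

lemma linear_preimage_submodule:
  assumes V: "submodule V R E" and f: "linear_on V f" and U: "submodule U R E"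
  shows "submodule {e \<in> V. f e \<in> U} R E"
  by (rule submodule_intro)
    (use V f U in \<open>auto simp: linear_on_def linear_zero[OF V f] intro: sub_carr sub_zero sub_add sub_smult\<close>)

lemma zero_submodule: "submodule {\<zero>\<^bsub>E\<^esub>} R E"
  by (rule submodule_intro) auto

lemma linear_minus:
  assumes V: "submodule V R E" and "linear_on V f" "linear_on V g"
  shows "linear_on V (\<lambda>e. f e \<ominus>\<^bsub>E\<^esub> g e)"
proof -
  have "(a \<oplus>\<^bsub>E\<^esub> b) \<ominus>\<^bsub>E\<^esub> (c \<oplus>\<^bsub>E\<^esub> d) = (a \<ominus>\<^bsub>E\<^esub> c) \<oplus>\<^bsub>E\<^esub> (b \<ominus>\<^bsub>E\<^esub> d)"
    if "a \<in> carrier E" "b \<in> carrier E" "c \<in> carrier E" "d \<in> carrier E" for a b c d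
    using that by (simp add: a_minus_def M.minus_add M.a_ac)
  then show ?thesis using assms unfolding linear_on_def
    by (auto simp: smult_diff_r Pi_iff)
qed

lemma linear_smult: "submodule V R E \<Longrightarrow> r \<in> carrier R \<Longrightarrow> linear_on V (\<lambda>e. r \<odot>\<^bsub>E\<^esub> e)"
  using sub_carr by (auto simp: linear_on_def smult_r_distr smult_swap)

section \<open>The socle of the hull\<close>

lemma e0_nonzero: "e\<^sub>0 \<noteq> \<zero>\<^bsub>E\<^esub>"
  using prime_one[OF m_prime] e0_ann e0_closed by fastforce

lemma m_e0: "a \<in> m \<Longrightarrow> a \<odot>\<^bsub>E\<^esub> e\<^sub>0 = \<zero>\<^bsub>E\<^esub>"
  using e0_ann by blast

lemma smult_e0_eq_iff:
  "a \<in> carrier R \<Longrightarrow> b \<in> carrier R \<Longrightarrow> a \<odot>\<^bsub>E\<^esub> e\<^sub>0 = b \<odot>\<^bsub>E\<^esub> e\<^sub>0 \<longleftrightarrow> a \<ominus> b \<in> m"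
proof -
  assume "a \<in> carrier R" "b \<in> carrier R"
  then have "a \<odot>\<^bsub>E\<^esub> e\<^sub>0 = b \<odot>\<^bsub>E\<^esub> e\<^sub>0 \<longleftrightarrow> (a \<ominus> b) \<odot>\<^bsub>E\<^esub> e\<^sub>0 = \<zero>\<^bsub>E\<^esub>" "a \<ominus> b \<in> carrier R"
    using e0_closed by (simp_all add: smult_diff_l E_diff_zero)
  then show ?thesis using e0_ann by blast
qed

text \<open>Essentiality only yields a nonzero multiple \<open>t e\<^sub>0\<close> inside
  \<open>R v\<close>; such a \<open>t\<close> lies outside \<open>m\<close>, so it is a unit and can
  be divided out.\<close>

lemma essential_elem:
  assumes "v \<in> carrier E" "v \<noteq> \<zero>\<^bsub>E\<^esub>" obtains s where "s \<in> carrier R" "s \<odot>\<^bsub>E\<^esub> v = e\<^sub>0"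
proof -
  define V where "V = {r \<odot>\<^bsub>E\<^esub> v |r. r \<in> carrier R}"
  have "submodule V R E"
  proof (rule submodule_intro)
    show "V \<subseteq> carrier E" using assms by (auto simp: V_def)
    show "\<zero>\<^bsub>E\<^esub> \<in> V" using assms by (auto simp: V_def intro!: exI[of _ \<zero>])
    fix e f assume "e \<in> V" "f \<in> V"
    then show "e \<oplus>\<^bsub>E\<^esub> f \<in> V" using assms by (auto simp: V_def simp flip: smult_l_distr)
  next
    fix r e assume "r \<in> carrier R" "e \<in> V"
    then show "r \<odot>\<^bsub>E\<^esub> e \<in> V" using assms by (auto simp: V_def simp flip: smult_assoc1)
  qed
  moreover have "v \<in> V" using assms by (auto simp: V_def intro!: exI[of _ \<one>])
  ultimately obtain t where t: "t \<in> carrier R" "t \<odot>\<^bsub>E\<^esub> e\<^sub>0 \<in> V" "t \<odot>\<^bsub>E\<^esub> e\<^sub>0 \<noteq> \<zero>\<^bsub>E\<^esub>"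
    using e0_essential[OF _ _ assms(2)] by blast
  then obtain r where rt: "r \<in> carrier R" "t \<in> carrier R" "t \<odot>\<^bsub>E\<^esub> e\<^sub>0 = r \<odot>\<^bsub>E\<^esub> v"
    by (auto simp: V_def)
  then have "t \<notin> m" using t m_e0 by blast
  then obtain u where u: "u \<in> carrier R" "u \<otimes> t = \<one>" using unit_mod_m rt by blast
  have "(u \<otimes> r) \<odot>\<^bsub>E\<^esub> v = (u \<otimes> t) \<odot>\<^bsub>E\<^esub> e\<^sub>0"
    using smult_assoc1[of u r v] smult_assoc1[of u t e\<^sub>0] u(1) assms(1) e0_closed rt by simp
  then have "(u \<otimes> r) \<odot>\<^bsub>E\<^esub> v = e\<^sub>0" using u e0_closed by simp
  then show thesis using that u rt by blast
qed

text \<open>The socle of \<open>E\<close> is a line over the residue field: if \<open>f\<close> is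
  nonzero, some \<open>s f\<close> equals \<open>e\<^sub>0\<close>, and since \<open>m\<close> kills
  \<open>f\<close> the factor \<open>s\<close> must be a unit.\<close>

lemma socle:
  assumes "f \<in> carrier E" "\<And>a. a \<in> m \<Longrightarrow> a \<odot>\<^bsub>E\<^esub> f = \<zero>\<^bsub>E\<^esub>"
  obtains t where "t \<in> carrier R" "f = t \<odot>\<^bsub>E\<^esub> e\<^sub>0"
proof (cases "f = \<zero>\<^bsub>E\<^esub>")
  case True
  then show ?thesis using that[of \<zero>] e0_closed by simp
next
  case False
  then obtain s where s: "s \<in> carrier R" "s \<odot>\<^bsub>E\<^esub> f = e\<^sub>0" using essential_elem assms by blast
  then have "s \<notin> m" using assms(2) e0_nonzero by auto
  then obtain u where u: "u \<in> carrier R" "u \<otimes> s = \<one>" using unit_mod_m s by blast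
  have "f = (u \<otimes> s) \<odot>\<^bsub>E\<^esub> f" using u assms by simp
  also have "\<dots> = u \<odot>\<^bsub>E\<^esub> e\<^sub>0" using smult_assoc1[of u s f] u(1) s assms(1) by simp
  finally show ?thesis using that u by blast
qed

section \<open>Elements killed by powers of the maximal ideal\<close>

lemma kills_mono: "kills k e \<Longrightarrow> k \<le> n \<Longrightarrow> kills n e"
  using pw_antimono by (auto simp: kills_def)

lemma kills_Suc:
  assumes "e \<in> carrier E" "\<And>a. a \<in> m \<Longrightarrow> kills n (a \<odot>\<^bsub>E\<^esub> e)" shows "kills (Suc n) e"
proof -
  have "pw (Suc n) \<subseteq> mod_ann R E {e}"
    unfolding ideal_pow.simps
  proof (rule ideal_prod_le)
    show "ideal (mod_ann R E {e}) R" using assms mod_ann_ideal by simp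
    fix i j assume ij: "i \<in> m" "j \<in> pw n"
    then have c: "i \<in> carrier R" "j \<in> carrier R" using ideal_carr m_ideal pw_ideal by blast+
    have "(i \<otimes> j) \<odot>\<^bsub>E\<^esub> e = j \<odot>\<^bsub>E\<^esub> (i \<odot>\<^bsub>E\<^esub> e)" using c assms by (simp add: smult_assoc1 smult_swap)
    then show "i \<otimes> j \<in> mod_ann R E {e}" using assms(2) ij c by (auto simp: mod_ann_def kills_def)
  qed
  then show ?thesis by (auto simp: kills_def mod_ann_def)
qed

lemma kills_smult_Suc:
  assumes "e \<in> carrier E" "kills (Suc n) e" "a \<in> m" shows "kills n (a \<odot>\<^bsub>E\<^esub> e)"
  unfolding kills_def
proof
  fix r assume r: "r \<in> pw n"
  have c: "a \<in> carrier R" "r \<in> carrier R" using r assms ideal_carr m_ideal pw_ideal by blast+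
  have "a \<otimes> r \<in> pw (Suc n)" using assms r by (auto simp: ideal_pow.simps intro: ideal_prod.prod)
  then have "(a \<otimes> r) \<odot>\<^bsub>E\<^esub> e = \<zero>\<^bsub>E\<^esub>" using assms by (simp add: kills_def)
  then show "r \<odot>\<^bsub>E\<^esub> (a \<odot>\<^bsub>E\<^esub> e) = \<zero>\<^bsub>E\<^esub>" using c assms by (simp add: smult_assoc1 smult_swap)
qed

text \<open>Consider a counterexample \<open>e\<close> with maximal annihilator. If
  \<open>s e = e\<^sub>0\<close>, then \<open>s\<close> kills \<open>a e\<close> for every
  \<open>a \<in> m\<close> but does not kill \<open>e\<close>, so each \<open>a e\<close> is killed
  by a power of \<open>m\<close>. Finitely many generators of \<open>m\<close> give a common
  exponent \<open>n\<close>, and then \<open>e\<close> is killed by the next power.\<close>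

lemma killed: 
  assumes "e \<in> carrier E" shows "\<exists>n. kills n e"
proof (rule ccontr)
  assume contra: "\<nexists>n. kills n e"
  define S where "S = {mod_ann R E {e} |e. e \<in> carrier E \<and> (\<nexists>n. kills n e)}"
  have "\<exists>M\<in>S. \<forall>I\<in>S. M \<subseteq> I \<longrightarrow> I = M"
    by (rule ideal_set_has_maximal) (use assms contra in \<open>auto simp: S_def intro!: mod_ann_ideal\<close>)
  then obtain M where M: "M \<in> S" "\<And>I. I \<in> S \<Longrightarrow> M \<subseteq> I \<Longrightarrow> I = M" by blast
  then obtain e where e: "e \<in> carrier E" "\<nexists>n. kills n e" "M = mod_ann R E {e}" by (auto simp: S_def)
  note max = M(2)[unfolded e(3)]
  have "e \<noteq> \<zero>\<^bsub>E\<^esub>"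
  proof
    assume "e = \<zero>\<^bsub>E\<^esub>"
    then have "kills 0 e" by (simp add: kills_def)
    then show False using e by blast
  qed
  then obtain s where s: "s \<in> carrier R" "s \<odot>\<^bsub>E\<^esub> e = e\<^sub>0" using essential_elem e by blast
  have ex: "\<exists>n. kills n (a \<odot>\<^bsub>E\<^esub> e)" if a: "a \<in> m" for a
  proof (rule ccontr)
    assume n: "\<nexists>n. kills n (a \<odot>\<^bsub>E\<^esub> e)"
    have ac: "a \<in> carrier R" using a ideal_carr m_ideal by blast
    have "mod_ann R E {a \<odot>\<^bsub>E\<^esub> e} \<in> S" using n ac e unfolding S_def by blast
    moreover have "mod_ann R E {e} \<subseteq> mod_ann R E {a \<odot>\<^bsub>E\<^esub> e}"
      using ac e smult_swap[of _ a e] by (auto simp: mod_ann_def)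
    ultimately have eq: "mod_ann R E {a \<odot>\<^bsub>E\<^esub> e} = mod_ann R E {e}" by (rule max)
    have "s \<odot>\<^bsub>E\<^esub> (a \<odot>\<^bsub>E\<^esub> e) = \<zero>\<^bsub>E\<^esub>" using s ac e a by (simp add: smult_swap[of s a] m_e0)
    then have "s \<in> mod_ann R E {e}" using s eq by (auto simp: mod_ann_def)
    then show False using s e0_nonzero by (auto simp: mod_ann_def)
  qed
  obtain A where A: "A \<subseteq> carrier R" "finite A" "m = Idl A" using finetely_gen[OF m_ideal] by blast
  have Am: "A \<subseteq> m" using A genideal_self by blast
  then have "\<forall>a\<in>A. \<exists>n. kills n (a \<odot>\<^bsub>E\<^esub> e)" using ex by blast
  then obtain f where f: "\<And>a. a \<in> A \<Longrightarrow> kills (f a) (a \<odot>\<^bsub>E\<^esub> e)" by metis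
  obtain n where n: "\<And>a. a \<in> A \<Longrightarrow> f a \<le> n"
    using finite_nat_set_iff_bounded_le[of "f ` A"] A by auto
  have kn: "kills n (a \<odot>\<^bsub>E\<^esub> e)" if "a \<in> A" for a using f n kills_mono that by blast
  define X where "X = (\<lambda>j. j \<odot>\<^bsub>E\<^esub> e) ` pw n"
  have Xc: "X \<subseteq> carrier E" using e ideal_carr[OF pw_ideal] by (auto simp: X_def)
  have sw: "j \<odot>\<^bsub>E\<^esub> (a \<odot>\<^bsub>E\<^esub> e) = a \<odot>\<^bsub>E\<^esub> (j \<odot>\<^bsub>E\<^esub> e)" if "j \<in> pw n" "a \<in> carrier R" for a j
    using that e ideal_carr[OF pw_ideal] smult_swap by blast
  have "A \<subseteq> mod_ann R E X" using kn A(1) sw by (auto simp: mod_ann_def X_def kills_def subset_iff)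
  then have "m \<subseteq> mod_ann R E X" using A genideal_minimal[OF mod_ann_ideal[OF Xc]] by simp
  then have "a \<odot>\<^bsub>E\<^esub> (j \<odot>\<^bsub>E\<^esub> e) = \<zero>\<^bsub>E\<^esub>" if "a \<in> m" "j \<in> pw n" for a j
    using that unfolding mod_ann_def X_def by blast
  then have "kills n (a \<odot>\<^bsub>E\<^esub> e)" if "a \<in> m" for a
    using that sw[of _ a] ideal_carr[OF m_ideal that] by (auto simp: kills_def)
  then show False using kills_Suc e by blast
qed

lemma kills_submodule:
  assumes "submodule V R E" shows "submodule {e \<in> V. kills n e} R E"
proof (rule submodule_intro)
  fix r e assume *: "r \<in> carrier R" "e \<in> {e \<in> V. kills n e}"
  then have "j \<odot>\<^bsub>E\<^esub> (r \<odot>\<^bsub>E\<^esub> e) = \<zero>\<^bsub>E\<^esub>" if "j \<in> pw n" for j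
    using that smult_swap[of j r e] ideal_carr[OF pw_ideal that] sub_carr[OF assms] by (auto simp: kills_def)
  then show "r \<odot>\<^bsub>E\<^esub> e \<in> {e \<in> V. kills n e}" using * sub_smult[OF assms] by (auto simp: kills_def)
qed (use sub_carr[OF assms] sub_zero[OF assms] sub_add[OF assms] ideal_carr[OF pw_ideal]
    in \<open>auto simp: kills_def smult_r_distr\<close>)

text \<open>Linear algebra over the residue field: \<open>h\<close> and all \<open>s \<in> S\<close> act on \<open>V\<close> as functionals with
  values in the socle \<open>R e\<^sub>0\<close>.\<close>

lemma socle_functional_combination:
  assumes "finite S" "S \<subseteq> carrier R" "submodule V R E" "linear_on V h"
    and "\<And>s a e. s \<in> S \<Longrightarrow> a \<in> m \<Longrightarrow> e \<in> V \<Longrightarrow> a \<odot>\<^bsub>E\<^esub> (s \<odot>\<^bsub>E\<^esub> e) = \<zero>\<^bsub>E\<^esub>"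
    and "\<And>a e. a \<in> m \<Longrightarrow> e \<in> V \<Longrightarrow> a \<odot>\<^bsub>E\<^esub> h e = \<zero>\<^bsub>E\<^esub>"
    and "\<And>e. e \<in> V \<Longrightarrow> (\<And>s. s \<in> S \<Longrightarrow> s \<odot>\<^bsub>E\<^esub> e = \<zero>\<^bsub>E\<^esub>) \<Longrightarrow> h e = \<zero>\<^bsub>E\<^esub>"
  shows "\<exists>y \<in> Idl S. \<forall>e\<in>V. h e = y \<odot>\<^bsub>E\<^esub> e"
  using assms
proof (induction S arbitrary: V)
  case empty
  have "\<zero> \<in> Idl {}" by (rule ideal_zero[OF genideal_ideal]) simp
  then show ?case using empty.prems sub_carr by (intro bexI[of _ \<zero>]) auto
next
  case (insert s S)
  note V = \<open>submodule V R E\<close> and lin = \<open>linear_on V h\<close>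
  have S: "S \<subseteq> carrier R" "s \<in> carrier R" using insert.prems(1) by auto
  define V' where "V' = {e \<in> V. s \<odot>\<^bsub>E\<^esub> e \<in> {\<zero>\<^bsub>E\<^esub>}}"
  have V': "submodule V' R E"
    unfolding V'_def by (rule linear_preimage_submodule[OF V linear_smult[OF V S(2)] zero_submodule])
  have "V' \<subseteq> V" by (auto simp: V'_def)
  have "\<exists>y \<in> Idl S. \<forall>e\<in>V'. h e = y \<odot>\<^bsub>E\<^esub> e"
  proof (rule insert.IH[OF S(1) V'])
    show "linear_on V' h" using lin \<open>V' \<subseteq> V\<close> unfolding linear_on_def by blast
    fix e assume "e \<in> V'" "\<And>s. s \<in> S \<Longrightarrow> s \<odot>\<^bsub>E\<^esub> e = \<zero>\<^bsub>E\<^esub>"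
    then show "h e = \<zero>\<^bsub>E\<^esub>" using insert.prems(6)[of e] by (auto simp: V'_def)
  qed (use insert.prems \<open>V' \<subseteq> V\<close> in auto)
  then obtain y where y: "y \<in> Idl S" "\<And>e. e \<in> V' \<Longrightarrow> h e = y \<odot>\<^bsub>E\<^esub> e" by blast
  have sub: "Idl S \<subseteq> Idl (insert s S)" using insert.prems(1) by (intro subset_Idl_subset) auto
  have id: "ideal (Idl (insert s S)) R" "ideal (Idl S) R" using genideal_ideal insert.prems(1) by auto
  have sI: "s \<in> Idl (insert s S)" using genideal_self[OF insert.prems(1)] by blast
  have yc: "y \<in> carrier R" using y id ideal_carr by blast
  show ?case
  proof (cases "\<forall>e\<in>V. s \<odot>\<^bsub>E\<^esub> e = \<zero>\<^bsub>E\<^esub>")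
    case True
    then have "V' = V" by (auto simp: V'_def)
    then show ?thesis using y sub by blast
  next
    case False
    then obtain e' where e': "e' \<in> V" "s \<odot>\<^bsub>E\<^esub> e' \<noteq> \<zero>\<^bsub>E\<^esub>" by blast
    have e'c: "e' \<in> carrier E" using e' V sub_carr by blast
    obtain u where u: "u \<in> carrier R" "u \<odot>\<^bsub>E\<^esub> (s \<odot>\<^bsub>E\<^esub> e') = e\<^sub>0"
      using essential_elem[of "s \<odot>\<^bsub>E\<^esub> e'"] e' e'c S by auto
    \<comment> \<open>On \<open>d\<close> the functional \<open>s\<close> takes the value
      \<open>e\<^sub>0\<close>, so every element of \<open>V\<close> is a multiple
      \<open>b d\<close> plus an element of the kernel \<open>V'\<close>.\<close>
    define d where "d = u \<odot>\<^bsub>E\<^esub> e'"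
    have d: "d \<in> V" "s \<odot>\<^bsub>E\<^esub> d = e\<^sub>0" "d \<in> carrier E"
      using u e' V e'c S sub_smult by (auto simp: d_def smult_swap)
    have yS: "a \<odot>\<^bsub>E\<^esub> (y \<odot>\<^bsub>E\<^esub> d) = \<zero>\<^bsub>E\<^esub>" if a: "a \<in> m" for a
    proof -
      have ac: "a \<in> carrier R" using a m_ideal ideal_carr by blast
      have "S \<subseteq> mod_ann R E {a \<odot>\<^bsub>E\<^esub> d}"
        using insert.prems(4)[OF _ a d(1)] S d ac by (auto simp: mod_ann_def smult_swap[of _ a])
      then have "Idl S \<subseteq> mod_ann R E {a \<odot>\<^bsub>E\<^esub> d}"
        using ac d by (intro genideal_minimal mod_ann_ideal) auto
      then have "y \<odot>\<^bsub>E\<^esub> (a \<odot>\<^bsub>E\<^esub> d) = \<zero>\<^bsub>E\<^esub>" using y by (auto simp: mod_ann_def)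
      then show ?thesis using ac yc d by (simp add: smult_swap[of a y])
    qed
    have ld: "h d \<in> carrier E" using linear_closed[OF lin d(1)] .
    \<comment> \<open>The error of \<open>y\<close> at \<open>d\<close> lies in the socle, hence is
      some \<open>t e\<^sub>0 = t s d\<close>. Adding \<open>t s\<close> to \<open>y\<close> repairs
      the value at \<open>d\<close> without disturbing those on \<open>V'\<close>.\<close>
    have "a \<odot>\<^bsub>E\<^esub> (h d \<ominus>\<^bsub>E\<^esub> y \<odot>\<^bsub>E\<^esub> d) = \<zero>\<^bsub>E\<^esub>" if "a \<in> m" for a
      using that yS insert.prems(5) d ld yc ideal_carr[OF m_ideal that]
      by (simp add: smult_diff_r E_diff_self)
    then obtain t where t: "t \<in> carrier R" "h d \<ominus>\<^bsub>E\<^esub> y \<odot>\<^bsub>E\<^esub> d = t \<odot>\<^bsub>E\<^esub> e\<^sub>0"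
      using socle[of "h d \<ominus>\<^bsub>E\<^esub> y \<odot>\<^bsub>E\<^esub> d"] ld yc d by auto
    have "h e = (y \<oplus> t \<otimes> s) \<odot>\<^bsub>E\<^esub> e" if e: "e \<in> V" for e
    proof -
      have ec: "e \<in> carrier E" using e V sub_carr by blast
      obtain b where b: "b \<in> carrier R" "s \<odot>\<^bsub>E\<^esub> e = b \<odot>\<^bsub>E\<^esub> e\<^sub>0"
        using socle[of "s \<odot>\<^bsub>E\<^esub> e"] insert.prems(4)[of s _ e] e ec S by auto
      have bd: "b \<odot>\<^bsub>E\<^esub> d \<in> V" using b d V sub_smult by blast
      have "s \<odot>\<^bsub>E\<^esub> (e \<ominus>\<^bsub>E\<^esub> b \<odot>\<^bsub>E\<^esub> d) = \<zero>\<^bsub>E\<^esub>"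
        using b d ec S by (simp add: smult_diff_r smult_swap[of s b] E_diff_self e0_closed)
      then have "e \<ominus>\<^bsub>E\<^esub> b \<odot>\<^bsub>E\<^esub> d \<in> V'" using sub_minus[OF V e bd] by (simp add: V'_def)
      then have "h (e \<ominus>\<^bsub>E\<^esub> b \<odot>\<^bsub>E\<^esub> d) = y \<odot>\<^bsub>E\<^esub> (e \<ominus>\<^bsub>E\<^esub> b \<odot>\<^bsub>E\<^esub> d)" by (rule y)
      moreover have "h (b \<odot>\<^bsub>E\<^esub> d) = b \<odot>\<^bsub>E\<^esub> h d" using lin b d by (simp add: linear_on_def)
      ultimately have eq: "h e \<ominus>\<^bsub>E\<^esub> b \<odot>\<^bsub>E\<^esub> h d = y \<odot>\<^bsub>E\<^esub> e \<ominus>\<^bsub>E\<^esub> b \<odot>\<^bsub>E\<^esub> (y \<odot>\<^bsub>E\<^esub> d)"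
        using linear_diff[OF V lin e bd] yc ec b d by (simp add: smult_diff_r smult_swap[of y b])
      have cc: "h e \<in> carrier E" "b \<odot>\<^bsub>E\<^esub> h d \<in> carrier E" "y \<odot>\<^bsub>E\<^esub> e \<in> carrier E"
        "b \<odot>\<^bsub>E\<^esub> (y \<odot>\<^bsub>E\<^esub> d) \<in> carrier E"
        using linear_closed[OF lin e] ld yc ec b d by auto
      have "h e = (h e \<ominus>\<^bsub>E\<^esub> b \<odot>\<^bsub>E\<^esub> h d) \<oplus>\<^bsub>E\<^esub> b \<odot>\<^bsub>E\<^esub> h d"
        using cc by (simp add: a_minus_def M.a_assoc M.l_neg)
      also have "\<dots> = y \<odot>\<^bsub>E\<^esub> e \<oplus>\<^bsub>E\<^esub> (b \<odot>\<^bsub>E\<^esub> h d \<ominus>\<^bsub>E\<^esub> b \<odot>\<^bsub>E\<^esub> (y \<odot>\<^bsub>E\<^esub> d))"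
        unfolding eq using cc by (simp add: a_minus_def M.a_ac)
      also have "b \<odot>\<^bsub>E\<^esub> h d \<ominus>\<^bsub>E\<^esub> b \<odot>\<^bsub>E\<^esub> (y \<odot>\<^bsub>E\<^esub> d) = b \<odot>\<^bsub>E\<^esub> (t \<odot>\<^bsub>E\<^esub> e\<^sub>0)"
        unfolding t(2)[symmetric] using ld yc d b by (simp add: smult_diff_r)
      also have "\<dots> = (t \<otimes> s) \<odot>\<^bsub>E\<^esub> e"
        using t b S ec e0_closed by (simp add: smult_swap[of b t] smult_assoc1)
      also have "y \<odot>\<^bsub>E\<^esub> e \<oplus>\<^bsub>E\<^esub> (t \<otimes> s) \<odot>\<^bsub>E\<^esub> e = (y \<oplus> t \<otimes> s) \<odot>\<^bsub>E\<^esub> e"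
        using yc t S ec by (simp add: smult_l_distr)
      finally show ?thesis .
    qed
    moreover have "y \<oplus> t \<otimes> s \<in> Idl (insert s S)"
      using y sub sI t ideal_add[OF id(1)] ideal_mult_left[OF id(1)] by auto
    ultimately show ?thesis by blast
  qed
qed

text \<open>\<open>hat_smult\<close> evaluates at the least level \<open>k\<close> killing
  \<open>e\<close>, whereas computations with several elements need a common level. The passage is
  harmless because \<open>r n\<close> and \<open>r k\<close> differ by an element of
  \<open>m^k\<close>, which kills \<open>e\<close>.\<close>

lemma act_lim:
  assumes r: "compat r" and e: "e \<in> carrier E" "kills n e"
  shows "act (lim r) e = r n \<odot>\<^bsub>E\<^esub> e"
proof -
  define k where "k = (LEAST n. \<forall>r\<in>pw n. r \<odot>\<^bsub>E\<^esub> e = \<zero>\<^bsub>E\<^esub>)"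
  have "kills k e" unfolding k_def kills_def by (rule LeastI[of _ n]) (use e in \<open>simp add: kills_def\<close>)
  have "k \<le> n" unfolding k_def by (rule Least_le) (use e in \<open>simp add: kills_def\<close>)
  have "act (lim r) e = compl_rep R m (lim r) k \<odot>\<^bsub>E\<^esub> e" by (simp add: hat_smult_def k_def)
  also have "\<dots> = r k \<odot>\<^bsub>E\<^esub> e"
    using rep_prop(1)[OF lim_carrier[OF r]] rep_lim[OF r, of k] compat_carr[OF r] e \<open>kills k e\<close>
    by (intro smult_eqI) (auto simp: kills_def)
  also have "\<dots> = r n \<odot>\<^bsub>E\<^esub> e"
    using compat_carr[OF r] compat_minus[OF r \<open>k \<le> n\<close>] e \<open>kills k e\<close>
    by (intro smult_eqI[symmetric]) (auto simp: kills_def)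
  finally show ?thesis .
qed

text \<open>Surjectivity in Matlis' isomorphism between the completion and the endomorphisms of \<open>E\<close>; allowing
  a submodule as the domain makes any extension of homomorphisms unnecessary.\<close>

lemma linear_is_act:
  assumes N: "submodule N R E" and f: "linear_on N f"
  obtains x where "x \<in> carrier Rhat" "\<And>e. e \<in> N \<Longrightarrow> f e = act x e"
proof -
  \<comment> \<open>The term \<open>r n\<close> represents \<open>f\<close> on the elements of
    \<open>N\<close> killed by \<open>m^n\<close>. By \<open>killed\<close> these exhaust
    \<open>N\<close>, so a compatible choice yields an element of the completion acting as
    \<open>f\<close>.\<close>
  let ?P = "\<lambda>n r. r \<in> carrier R \<and> (\<forall>e\<in>N. kills n e \<longrightarrow> f e = r \<odot>\<^bsub>E\<^esub> e)"
  have "\<exists>r. \<forall>n. ?P n (r n) \<and> r (Suc n) \<ominus> r n \<in> pw n"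
  proof (rule dependent_nat_choice)
    \<comment> \<open>\<open>pw 0\<close> is the whole ring, so an element of level 0 is zero and
      any \<open>r 0\<close> would do.\<close>
    have "f e = \<zero> \<odot>\<^bsub>E\<^esub> e" if e: "e \<in> N" "kills 0 e" for e
    proof -
      have "e = \<one> \<odot>\<^bsub>E\<^esub> e" using sub_carr[OF N] e by simp
      also have "\<dots> = \<zero>\<^bsub>E\<^esub>" using e(2) unfolding kills_def by simp
      finally show ?thesis using linear_zero[OF N f] by simp
    qed
    then show "\<exists>r. ?P 0 r" by (intro exI[of _ \<zero>]) auto
  next
    fix r n assume r: "?P n r"
    define V where "V = {e \<in> N. kills (Suc n) e}"
    have V: "submodule V R E" unfolding V_def by (rule kills_submodule[OF N])
    have VN: "V \<subseteq> N" by (auto simp: V_def)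
    obtain S where S: "S \<subseteq> carrier R" "finite S" "pw n = Idl S" using finetely_gen[OF pw_ideal] by blast
    have Spw: "S \<subseteq> pw n" using S genideal_self by blast
    have fV: "linear_on V f" using f VN unfolding linear_on_def by blast
    \<comment> \<open>\<open>g\<close> vanishes at level \<open>n\<close>. Hence at level
      \<open>n+1\<close> its values lie in the socle, and it vanishes wherever the generators
      \<open>S\<close> of \<open>m^n\<close> do. It is therefore multiplication by some
      \<open>y \<in> m^n\<close>, and this membership is exactly the compatibility asked of the next
      term.\<close>
    define g where "g e = f e \<ominus>\<^bsub>E\<^esub> r \<odot>\<^bsub>E\<^esub> e" for e
    have g: "linear_on V g" unfolding g_def using r by (intro linear_minus linear_smult V fV) auto
    have g0: "g e = \<zero>\<^bsub>E\<^esub>" if "e \<in> V" "kills n e" for e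
      using r that VN sub_carr[OF V] by (auto simp: g_def E_diff_self)
    have "\<exists>y \<in> Idl S. \<forall>e\<in>V. g e = y \<odot>\<^bsub>E\<^esub> e"
    proof (rule socle_functional_combination[OF S(2,1) V g])
      fix s a e assume *: "s \<in> S" "a \<in> m" "e \<in> V"
      then have "kills n (a \<odot>\<^bsub>E\<^esub> e)" using sub_carr[OF V] by (intro kills_smult_Suc) (auto simp: V_def)
      then have "s \<odot>\<^bsub>E\<^esub> (a \<odot>\<^bsub>E\<^esub> e) = \<zero>\<^bsub>E\<^esub>" using * Spw by (auto simp: kills_def)
      then show "a \<odot>\<^bsub>E\<^esub> (s \<odot>\<^bsub>E\<^esub> e) = \<zero>\<^bsub>E\<^esub>"
        using * S smult_swap[of a s e] sub_carr[OF V] ideal_carr[OF m_ideal] by auto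
    next
      fix a e assume *: "a \<in> m" "e \<in> V"
      have ac: "a \<in> carrier R" using * ideal_carr[OF m_ideal] by blast
      have "kills n (a \<odot>\<^bsub>E\<^esub> e)" using * sub_carr[OF V] by (intro kills_smult_Suc) (auto simp: V_def)
      then have "g (a \<odot>\<^bsub>E\<^esub> e) = \<zero>\<^bsub>E\<^esub>" using g0 sub_smult[OF V *(2) ac] by blast
      then show "a \<odot>\<^bsub>E\<^esub> g e = \<zero>\<^bsub>E\<^esub>" using g ac * by (simp add: linear_on_def)
    next
      fix e assume *: "e \<in> V" "\<And>s. s \<in> S \<Longrightarrow> s \<odot>\<^bsub>E\<^esub> e = \<zero>\<^bsub>E\<^esub>"
      have "Idl S \<subseteq> mod_ann R E {e}" using * S sub_carr[OF V]
        by (intro genideal_minimal mod_ann_ideal) (auto simp: mod_ann_def)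
      then have "kills n e" using S by (auto simp: kills_def mod_ann_def)
      then show "g e = \<zero>\<^bsub>E\<^esub>" using g0 * by blast
    qed
    then obtain y where y: "y \<in> pw n" "\<And>e. e \<in> V \<Longrightarrow> g e = y \<odot>\<^bsub>E\<^esub> e" using S by blast
    have yc: "y \<in> carrier R" using y ideal_carr[OF pw_ideal] by blast
    have "f e = (r \<oplus> y) \<odot>\<^bsub>E\<^esub> e" if e: "e \<in> N" "kills (Suc n) e" for e
    proof -
      have c: "e \<in> carrier E" "f e \<in> carrier E" "r \<in> carrier R"
        using sub_carr[OF N] e linear_closed[OF f] r by auto
      have "f e = r \<odot>\<^bsub>E\<^esub> e \<oplus>\<^bsub>E\<^esub> g e" using c by (simp add: g_def a_minus_def M.a_ac M.r_neg1 M.r_neg)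
      also have "g e = y \<odot>\<^bsub>E\<^esub> e" using y e by (simp add: V_def)
      finally show ?thesis using c yc by (simp add: smult_l_distr)
    qed
    moreover have "(r \<oplus> y) \<ominus> r = y" using r yc eq_sum_imp_minus[of r y "r \<oplus> y"] by simp
    ultimately show "\<exists>r'. ?P (Suc n) r' \<and> r' \<ominus> r \<in> pw n" using r y yc by (intro exI[of _ "r \<oplus> y"]) auto
  qed
  then obtain r where r: "\<And>n. ?P n (r n)" "\<And>n. r (Suc n) \<ominus> r n \<in> pw n" by blast
  have c: "compat r" using r by (simp add: compat_def)
  have "f e = act (lim r) e" if e: "e \<in> N" for e
  proof -
    have ec: "e \<in> carrier E" using e sub_carr[OF N] by blast
    then obtain n where "kills n e" using killed by blast
    then show ?thesis using act_lim[OF c ec] r(1) e by simp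
  qed
  then show thesis using that lim_carrier[OF c] by blast
qed

end

section \<open>Annihilator duality\<close>

context residue_hull
begin

section \<open>The action of the completion on the hull\<close>

lemma act_rep:
  assumes "x \<in> carrier Rhat" "e \<in> carrier E"
  obtains a where "a \<in> carrier R" "act x e = a \<odot>\<^bsub>E\<^esub> e"
proof -
  obtain r n where "compat r" "x = lim r" "kills n e"
    using Rhat_cases[OF assms(1)] killed[OF assms(2)] by metis
  then show thesis using that act_lim[of r e n] compat_carr assms(2) by metis
qed

lemma act_closed: "x \<in> carrier Rhat \<Longrightarrow> e \<in> carrier E \<Longrightarrow> act x e \<in> carrier E"
  by (metis act_rep smult_closed)

lemma act_submodule: "submodule V R E \<Longrightarrow> x \<in> carrier Rhat \<Longrightarrow> e \<in> V \<Longrightarrow> act x e \<in> V"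
  by (metis act_rep sub_carr sub_smult)

lemma act_canon: "r \<in> carrier R \<Longrightarrow> e \<in> carrier E \<Longrightarrow> act (compl_canon R m r) e = r \<odot>\<^bsub>E\<^esub> e"
  using killed[of e] act_lim[OF compat_const] by (auto simp: canon_lim)

lemma act_add_l:
  assumes "x \<in> carrier Rhat" "y \<in> carrier Rhat" "e \<in> carrier E"
  shows "act (x \<oplus>\<^bsub>Rhat\<^esub> y) e = act x e \<oplus>\<^bsub>E\<^esub> act y e"
proof -
  obtain r s n where *: "compat r" "x = lim r" "compat s" "y = lim s" "kills n e"
    using Rhat_cases[OF assms(1)] Rhat_cases[OF assms(2)] killed[OF assms(3)] by metis
  have "act (x \<oplus>\<^bsub>Rhat\<^esub> y) e = (r n \<oplus> s n) \<odot>\<^bsub>E\<^esub> e"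
    using * act_lim[OF compat_add[OF *(1,3)] assms(3) *(5)] by (simp add: lim_add)
  then show ?thesis using * assms act_lim compat_carr by (simp add: smult_l_distr)
qed

lemma act_mult:
  assumes "x \<in> carrier Rhat" "y \<in> carrier Rhat" "e \<in> carrier E"
  shows "act (x \<otimes>\<^bsub>Rhat\<^esub> y) e = act x (act y e)"
proof -
  obtain r s n where *: "compat r" "x = lim r" "compat s" "y = lim s" "kills n e"
    using Rhat_cases[OF assms(1)] Rhat_cases[OF assms(2)] killed[OF assms(3)] by metis
  have c: "r n \<in> carrier R" "s n \<in> carrier R" using * compat_carr by auto
  have "kills n (s n \<odot>\<^bsub>E\<^esub> e)"
    using kills_submodule[OF carrier_is_submodule, of n] sub_smult[of "{e \<in> carrier E. kills n e}" e "s n"] c * assms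
    by auto
  then have "act x (s n \<odot>\<^bsub>E\<^esub> e) = r n \<odot>\<^bsub>E\<^esub> (s n \<odot>\<^bsub>E\<^esub> e)"
    using act_lim[OF *(1)] *(2) c assms by auto
  moreover have "act (x \<otimes>\<^bsub>Rhat\<^esub> y) e = (r n \<otimes> s n) \<odot>\<^bsub>E\<^esub> e"
    using * act_lim[OF compat_mult[OF *(1,3)] assms(3) *(5)] by (simp add: lim_mult)
  moreover have "act y e = s n \<odot>\<^bsub>E\<^esub> e" using * act_lim assms by simp
  ultimately show ?thesis using c assms by (simp add: smult_assoc1)
qed

lemma act_linear:
  assumes V: "submodule V R E" and x: "x \<in> carrier Rhat" shows "linear_on V (act x)"
  unfolding linear_on_def
proof (intro conjI ballI Pi_I)
  show "act x e \<in> carrier E" if "e \<in> V" for e using act_closed[OF x] sub_carr[OF V that] by simp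
  obtain r where r: "compat r" "x = lim r" using Rhat_cases[OF x] by blast
  have rc: "r n \<in> carrier R" for n using compat_carr[OF r(1)] .
  fix e f assume "e \<in> V" "f \<in> V"
  then have c: "e \<in> carrier E" "f \<in> carrier E" using sub_carr[OF V] by auto
  obtain i j where ij: "kills i e" "kills j f" using killed c by metis
  define n where "n = max i j"
  have k: "kills n e" "kills n f" using ij kills_mono by (auto simp: n_def)
  then have "kills n (e \<oplus>\<^bsub>E\<^esub> f)"
    using kills_submodule[OF carrier_is_submodule, of n] sub_add[of "{e \<in> carrier E. kills n e}" e f] c by auto
  then show "act x (e \<oplus>\<^bsub>E\<^esub> f) = act x e \<oplus>\<^bsub>E\<^esub> act x f"
    using c k r act_lim[OF r(1), of _ n] rc by (simp add: smult_r_distr)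
next
  fix t e assume t: "t \<in> carrier R" and "e \<in> V"
  then have c: "e \<in> carrier E" using sub_carr[OF V] by auto
  have "act x (t \<odot>\<^bsub>E\<^esub> e) = act (x \<otimes>\<^bsub>Rhat\<^esub> compl_canon R m t) e"
    using t c x by (simp add: act_mult canon_carrier act_canon)
  also have "\<dots> = act (compl_canon R m t \<otimes>\<^bsub>Rhat\<^esub> x) e"
    using t x by (simp add: hat.m_comm canon_carrier)
  also have "\<dots> = t \<odot>\<^bsub>E\<^esub> act x e"
    using t c x by (simp add: act_mult canon_carrier act_canon act_closed)
  finally show "act x (t \<odot>\<^bsub>E\<^esub> e) = t \<odot>\<^bsub>E\<^esub> act x e" .
qed

lemma act_zero_r: "x \<in> carrier Rhat \<Longrightarrow> act x \<zero>\<^bsub>E\<^esub> = \<zero>\<^bsub>E\<^esub>"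
  using linear_zero[OF carrier_is_submodule act_linear[OF carrier_is_submodule]] .

lemma act_zero_l: "e \<in> carrier E \<Longrightarrow> act \<zero>\<^bsub>Rhat\<^esub> e = \<zero>\<^bsub>E\<^esub>"
  using act_canon[of \<zero> e] by (simp add: canon_zero)

lemma act_one: "e \<in> carrier E \<Longrightarrow> act \<one>\<^bsub>Rhat\<^esub> e = e"
  using act_canon[of \<one> e] by (simp add: canon_one)

lemma act_diff_l:
  assumes "x \<in> carrier Rhat" "y \<in> carrier Rhat" "e \<in> carrier E"
  shows "act (x \<ominus>\<^bsub>Rhat\<^esub> y) e = act x e \<ominus>\<^bsub>E\<^esub> act y e"
proof -
  have "(x \<ominus>\<^bsub>Rhat\<^esub> y) \<oplus>\<^bsub>Rhat\<^esub> y = x"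
    using assms by (simp add: a_minus_def hat.a_assoc hat.l_neg)
  then have "act x e = act (x \<ominus>\<^bsub>Rhat\<^esub> y) e \<oplus>\<^bsub>E\<^esub> act y e"
    using act_add_l[of "x \<ominus>\<^bsub>Rhat\<^esub> y" y e] assms by simp
  then show ?thesis using assms act_closed
    by (simp add: a_minus_def M.a_assoc M.r_neg)
qed

text \<open>The containment of kernels makes g(e) \<mapsto> h(e) a well-defined homomorphism on the
  image of \<open>g\<close>. That image is again a submodule of \<open>E\<close>, so
  \<open>linear_is_act\<close> turns the map into an element of the completion.\<close>

lemma linear_factor:
  assumes V: "submodule V R E" and g: "linear_on V g" and h: "linear_on V h"
    and ker: "\<And>e. e \<in> V \<Longrightarrow> g e = \<zero>\<^bsub>E\<^esub> \<Longrightarrow> h e = \<zero>\<^bsub>E\<^esub>"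
  obtains c where "c \<in> carrier Rhat" "\<And>e. e \<in> V \<Longrightarrow> h e = act c (g e)"
proof -
  define f where "f w = h (SOME e. e \<in> V \<and> g e = w)" for w
  have f: "f (g e) = h e" if e: "e \<in> V" for e
  proof -
    define e' where "e' = (SOME e'. e' \<in> V \<and> g e' = g e)"
    have e': "e' \<in> V" "g e' = g e"
      using someI[of "\<lambda>e'. e' \<in> V \<and> g e' = g e" e] e by (auto simp: e'_def)
    have "g (e' \<ominus>\<^bsub>E\<^esub> e) = \<zero>\<^bsub>E\<^esub>"
      using linear_diff[OF V g e'(1) e] e' linear_closed[OF g e] by (simp add: E_diff_self)
    then have "h (e' \<ominus>\<^bsub>E\<^esub> e) = \<zero>\<^bsub>E\<^esub>" using ker sub_minus[OF V e'(1) e] by blast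
    then have "h e' = h e"
      using linear_diff[OF V h e'(1) e] linear_closed[OF h] e e' by (simp add: E_diff_zero)
    then show ?thesis by (simp add: f_def e'_def)
  qed
  have "linear_on (g ` V) f"
    unfolding linear_on_def
  proof (intro conjI ballI Pi_I)
    show "f w \<in> carrier E" if "w \<in> g ` V" for w using that f linear_closed[OF h] by auto
    fix w w' assume "w \<in> g ` V" "w' \<in> g ` V"
    then obtain e e' where e: "e \<in> V" "e' \<in> V" "w = g e" "w' = g e'" by blast
    then have "w \<oplus>\<^bsub>E\<^esub> w' = g (e \<oplus>\<^bsub>E\<^esub> e')" using g by (simp add: linear_on_def)
    then show "f (w \<oplus>\<^bsub>E\<^esub> w') = f w \<oplus>\<^bsub>E\<^esub> f w'"
      using f e sub_add[OF V e(1,2)] h by (simp add: linear_on_def)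
  next
    fix r w assume r: "r \<in> carrier R" and "w \<in> g ` V"
    then obtain e where e: "e \<in> V" "w = g e" by blast
    then have "r \<odot>\<^bsub>E\<^esub> w = g (r \<odot>\<^bsub>E\<^esub> e)" using g r by (simp add: linear_on_def)
    then show "f (r \<odot>\<^bsub>E\<^esub> w) = r \<odot>\<^bsub>E\<^esub> f w"
      using f e sub_smult[OF V e(1) r] h r by (simp add: linear_on_def)
  qed
  then obtain c where "c \<in> carrier Rhat" "\<And>w. w \<in> g ` V \<Longrightarrow> f w = act c w"
    using linear_is_act[OF linear_image_submodule[OF V g]] by blast
  then show thesis using that f by (metis imageI)
qed

text \<open>The induction of \<open>socle_functional_combination\<close> once more, without the
  restriction to socle values: \<open>x - y\<close> vanishes on the kernel of \<open>s\<close>, and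
  \<open>linear_factor\<close> replaces the choice of a vector dual to \<open>s\<close> by writing
  the difference as \<open>c s\<close>.\<close>

lemma hat_functional_combination:
  assumes "finite S" "S \<subseteq> carrier Rhat" "submodule V R E" "x \<in> carrier Rhat"
    and "\<And>e. e \<in> V \<Longrightarrow> (\<And>s. s \<in> S \<Longrightarrow> act s e = \<zero>\<^bsub>E\<^esub>) \<Longrightarrow> act x e = \<zero>\<^bsub>E\<^esub>"
  shows "\<exists>y \<in> Idl\<^bsub>Rhat\<^esub> S. \<forall>e\<in>V. act x e = act y e"
  using assms
proof (induction S arbitrary: V)
  case empty
  have "\<zero>\<^bsub>Rhat\<^esub> \<in> Idl\<^bsub>Rhat\<^esub> {}" by (rule hat.ideal_zero[OF hat.genideal_ideal]) simp
  then show ?case using empty.prems sub_carr act_zero_l by (intro bexI[of _ "\<zero>\<^bsub>Rhat\<^esub>"]) auto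
next
  case (insert s S)
  note V = \<open>submodule V R E\<close>
  have S: "S \<subseteq> carrier Rhat" "s \<in> carrier Rhat" using insert.prems(1) by auto
  define V' where "V' = {e \<in> V. act s e \<in> {\<zero>\<^bsub>E\<^esub>}}"
  have V': "submodule V' R E"
    unfolding V'_def by (rule linear_preimage_submodule[OF V act_linear[OF V S(2)] zero_submodule])
  have "\<exists>y \<in> Idl\<^bsub>Rhat\<^esub> S. \<forall>e\<in>V'. act x e = act y e"
    by (rule insert.IH[OF S(1) V' insert.prems(3)]) (use insert.prems(4) in \<open>auto simp: V'_def\<close>)
  then obtain y where y: "y \<in> Idl\<^bsub>Rhat\<^esub> S" "\<And>e. e \<in> V' \<Longrightarrow> act x e = act y e" by blast
  have sub: "Idl\<^bsub>Rhat\<^esub> S \<subseteq> Idl\<^bsub>Rhat\<^esub> (insert s S)"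
    using insert.prems(1) by (intro hat.subset_Idl_subset) auto
  have id: "ideal (Idl\<^bsub>Rhat\<^esub> (insert s S)) Rhat"
    using hat.genideal_ideal insert.prems(1) by auto
  have sI: "s \<in> Idl\<^bsub>Rhat\<^esub> (insert s S)" using hat.genideal_self[OF insert.prems(1)] by blast
  have yc: "y \<in> carrier Rhat" using y sub hat.ideal_carr[OF id] by blast
  have "linear_on V (\<lambda>e. act x e \<ominus>\<^bsub>E\<^esub> act y e)"
    by (intro linear_minus V act_linear yc insert.prems)
  moreover have "act x e \<ominus>\<^bsub>E\<^esub> act y e = \<zero>\<^bsub>E\<^esub>" if "e \<in> V" "act s e = \<zero>\<^bsub>E\<^esub>" for e
    using y(2)[of e] that act_closed[OF yc] sub_carr[OF V] by (simp add: V'_def E_diff_self)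
  ultimately obtain c where c: "c \<in> carrier Rhat"
    "\<And>e. e \<in> V \<Longrightarrow> act x e \<ominus>\<^bsub>E\<^esub> act y e = act c (act s e)"
    using linear_factor[OF V act_linear[OF V S(2)]] by blast
  have "act x e = act (y \<oplus>\<^bsub>Rhat\<^esub> c \<otimes>\<^bsub>Rhat\<^esub> s) e" if e: "e \<in> V" for e
  proof -
    have ec: "e \<in> carrier E" using e sub_carr[OF V] by blast
    have "act x e = act y e \<oplus>\<^bsub>E\<^esub> (act x e \<ominus>\<^bsub>E\<^esub> act y e)"
      using act_closed ec yc insert.prems(3) by (simp add: a_minus_def M.a_ac M.r_neg1 M.r_neg)
    then show ?thesis using c e ec yc S by (simp add: act_add_l act_mult)
  qed
  moreover have "y \<oplus>\<^bsub>Rhat\<^esub> c \<otimes>\<^bsub>Rhat\<^esub> s \<in> Idl\<^bsub>Rhat\<^esub> (insert s S)"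
    using y sub sI c hat.ideal_add[OF id] hat.ideal_mult_left[OF id] by auto
  ultimately show ?case by blast
qed

text \<open>The only use of the injectivity of \<open>E\<close>.\<close>

lemma ann_vector:
  assumes I: "ideal I R" and a: "a \<in> carrier R" "a \<notin> I"
  obtains v where "v \<in> carrier E" "\<And>i. i \<in> I \<Longrightarrow> i \<odot>\<^bsub>E\<^esub> v = \<zero>\<^bsub>E\<^esub>" "a \<odot>\<^bsub>E\<^esub> v = e\<^sub>0"
proof -
  \<comment> \<open>\<open>g\<close> sends \<open>i + t a\<close> to \<open>t e\<^sub>0\<close>.
    This is well defined because \<open>(I : a) \<subseteq> m\<close> and \<open>m\<close> kills
    \<open>e\<^sub>0\<close>; Baer's criterion realizes \<open>g\<close> as multiplication by the
    desired \<open>v\<close>.\<close>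
  define g where "g z = (SOME t. t \<in> carrier R \<and> z \<ominus> t \<otimes> a \<in> I) \<odot>\<^bsub>E\<^esub> e\<^sub>0" for z
  have colon: "ideal_colon R I a \<subseteq> m"
  proof (rule proper_ideal_subset_m[OF ideal_colon_ideal[OF I a(1)]])
    have "\<one> \<notin> ideal_colon R I a" using a by (simp add: ideal_colon_def)
    then show "ideal_colon R I a \<noteq> carrier R" by blast
  qed
  have g: "g z = t \<odot>\<^bsub>E\<^esub> e\<^sub>0" if t: "t \<in> carrier R" "z \<ominus> t \<otimes> a \<in> I" "z \<in> carrier R" for z t
  proof -
    define u where "u = (SOME t. t \<in> carrier R \<and> z \<ominus> t \<otimes> a \<in> I)"
    have u: "u \<in> carrier R" "z \<ominus> u \<otimes> a \<in> I"
      using someI[of "\<lambda>t. t \<in> carrier R \<and> z \<ominus> t \<otimes> a \<in> I" t] t by (auto simp: u_def)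
    have "(z \<ominus> t \<otimes> a) \<ominus> (z \<ominus> u \<otimes> a) \<in> I" by (rule ideal_minus[OF I t(2) u(2)])
    moreover have "(z \<ominus> t \<otimes> a) \<ominus> (z \<ominus> u \<otimes> a) = a \<otimes> (u \<ominus> t)" using u t a by algebra
    ultimately have "u \<ominus> t \<in> m" using u t colon by (auto simp: ideal_colon_def)
    then show ?thesis using u t smult_e0_eq_iff by (simp add: g_def u_def)
  qed
  define J where "J = I <+>\<^bsub>R\<^esub> PIdl a"
  have Pid: "ideal (PIdl a) R" using a by (auto intro: cgenideal_ideal)
  have Jid: "ideal J R" unfolding J_def by (intro add_ideals I Pid)
  have J_rep: "\<exists>t\<in>carrier R. z \<ominus> t \<otimes> a \<in> I" if z: "z \<in> J" for z
  proof -
    obtain i t where it: "i \<in> I" "t \<in> carrier R" "z = i \<oplus> t \<otimes> a"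
      using z by (auto simp: J_def mem_PIdl elim!: set_add_memE)
    have "i \<in> carrier R" using it I ideal_carr by blast
    then have "i = z \<ominus> t \<otimes> a" using it a eq_sum_imp_minus[of "t \<otimes> a" i z] R.a_comm[of i "t \<otimes> a"] by simp
    then have "z \<ominus> t \<otimes> a \<in> I" using it by metis
    then show ?thesis using it by blast
  qed
  have gg: "g \<in> J \<rightarrow> carrier E \<and> (\<forall>z\<in>J. \<forall>w\<in>J. g (z \<oplus> w) = g z \<oplus>\<^bsub>E\<^esub> g w) \<and>
       (\<forall>r\<in>carrier R. \<forall>z\<in>J. g (r \<otimes> z) = r \<odot>\<^bsub>E\<^esub> g z)"
  proof (intro conjI ballI Pi_I)
    fix z assume "z \<in> J"
    then obtain t where "t \<in> carrier R" "z \<ominus> t \<otimes> a \<in> I" "z \<in> carrier R"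
      using J_rep ideal_carr[OF Jid] by blast
    then show "g z \<in> carrier E" using g e0_closed by simp
  next
    fix z w assume zw: "z \<in> J" "w \<in> J"
    then obtain t u where tu: "t \<in> carrier R" "z \<ominus> t \<otimes> a \<in> I" "u \<in> carrier R" "w \<ominus> u \<otimes> a \<in> I"
      using J_rep by blast
    have c: "z \<in> carrier R" "w \<in> carrier R" using zw ideal_carr[OF Jid] by auto
    have "(z \<oplus> w) \<ominus> (t \<oplus> u) \<otimes> a = (z \<ominus> t \<otimes> a) \<oplus> (w \<ominus> u \<otimes> a)" using c tu a by algebra
    then have "(z \<oplus> w) \<ominus> (t \<oplus> u) \<otimes> a \<in> I" using ideal_add[OF I tu(2,4)] by simp
    then have "g (z \<oplus> w) = (t \<oplus> u) \<odot>\<^bsub>E\<^esub> e\<^sub>0" using g c tu by simp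
    then show "g (z \<oplus> w) = g z \<oplus>\<^bsub>E\<^esub> g w" using g c tu e0_closed by (simp add: smult_l_distr)
  next
    fix r z assume rz: "r \<in> carrier R" "z \<in> J"
    then obtain t where t: "t \<in> carrier R" "z \<ominus> t \<otimes> a \<in> I" using J_rep by blast
    have c: "z \<in> carrier R" using rz ideal_carr[OF Jid] by auto
    have "r \<otimes> z \<ominus> (r \<otimes> t) \<otimes> a = r \<otimes> (z \<ominus> t \<otimes> a)" using c rz t a by algebra
    then have "r \<otimes> z \<ominus> (r \<otimes> t) \<otimes> a \<in> I" using ideal_mult_left[OF I t(2) rz(1)] by simp
    then have "g (r \<otimes> z) = (r \<otimes> t) \<odot>\<^bsub>E\<^esub> e\<^sub>0" using g c t rz by simp
    then show "g (r \<otimes> z) = r \<odot>\<^bsub>E\<^esub> g z" using g c t rz e0_closed by (simp add: smult_assoc1)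
  qed
  then obtain v where v: "v \<in> carrier E" "\<And>z. z \<in> J \<Longrightarrow> g z = z \<odot>\<^bsub>E\<^esub> v"
    using baer[unfolded baer_injective_def, THEN spec, THEN spec, THEN mp, OF conjI[OF Jid gg]] by blast
  have "i \<odot>\<^bsub>E\<^esub> v = \<zero>\<^bsub>E\<^esub>" if i: "i \<in> I" for i
  proof -
    have ic: "i \<in> carrier R" using i I ideal_carr by blast
    then have "i \<ominus> \<zero> \<otimes> a \<in> I" using i a by (simp add: a_minus_def)
    then have "g i = \<zero>\<^bsub>E\<^esub>" using g[of \<zero> i] ic e0_closed by simp
    moreover have "i \<in> J" using ideal_sum_left[OF I Pid] i by (auto simp: J_def)
    ultimately show ?thesis using v by simp
  qed
  moreover have "a \<odot>\<^bsub>E\<^esub> v = e\<^sub>0"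
  proof -
    have "a \<ominus> \<one> \<otimes> a \<in> I" using a ideal_zero[OF I] by (simp add: a_minus_def R.r_neg)
    then have "g a = e\<^sub>0" using g[of \<one> a] a e0_closed by simp
    moreover have "a \<in> J" using ideal_sum_right[OF I Pid] cgenideal_self[OF a(1)] by (auto simp: J_def)
    ultimately show ?thesis using v by simp
  qed
  ultimately show thesis using that v by blast
qed

text \<open>If some \<open>r n\<close> were outside \<open>m^n\<close>, then
  \<open>ann_vector\<close> would give a vector killed by \<open>m^n\<close> which \<open>x\<close>
  sends to \<open>e\<^sub>0\<close>.\<close>

lemma act_faithful:
  assumes x: "x \<in> carrier Rhat" and "\<And>e. e \<in> carrier E \<Longrightarrow> act x e = \<zero>\<^bsub>E\<^esub>"
  shows "x = \<zero>\<^bsub>Rhat\<^esub>"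
proof -
  obtain r where r: "compat r" "x = lim r" using Rhat_cases[OF x] by blast
  have rc: "r n \<in> carrier R" for n using compat_carr[OF r(1)] .
  have "r n \<in> pw n" for n
  proof (rule ccontr)
    assume "r n \<notin> pw n"
    then obtain v where v: "v \<in> carrier E" "\<And>i. i \<in> pw n \<Longrightarrow> i \<odot>\<^bsub>E\<^esub> v = \<zero>\<^bsub>E\<^esub>" "r n \<odot>\<^bsub>E\<^esub> v = e\<^sub>0"
      using ann_vector[OF pw_ideal rc] by blast
    then have "act x v = e\<^sub>0" using act_lim[OF r(1) v(1), of n] r(2) by (simp add: kills_def)
    then show False using assms(2) v e0_nonzero by simp
  qed
  then have "r n \<ominus> \<zero> \<in> pw n" for n using rc by (simp add: a_minus_def)
  then show ?thesis using lim_eq_iff[OF r(1) compat_const[OF R.zero_closed]] r lim_zero by simp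
qed

text \<open>The finite form of the double annihilator property: \<open>x\<close> acts on all of
  \<open>E\<close> like some element of the generated ideal, and by faithfulness it is that
  element.\<close>

lemma ann_ann_fg:
  assumes S: "finite S" "S \<subseteq> carrier Rhat" and x: "x \<in> carrier Rhat"
    and ann: "\<And>e. e \<in> carrier E \<Longrightarrow> (\<And>s. s \<in> S \<Longrightarrow> act s e = \<zero>\<^bsub>E\<^esub>) \<Longrightarrow> act x e = \<zero>\<^bsub>E\<^esub>"
  shows "x \<in> Idl\<^bsub>Rhat\<^esub> S"
proof -
  obtain y where y: "y \<in> Idl\<^bsub>Rhat\<^esub> S" "\<And>e. e \<in> carrier E \<Longrightarrow> act x e = act y e"
    using hat_functional_combination[OF S carrier_is_submodule x ann] by blast
  have yc: "y \<in> carrier Rhat" using y hat.ideal_carr[OF hat.genideal_ideal[OF S(2)]] by blast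
  have "x \<ominus>\<^bsub>Rhat\<^esub> y = \<zero>\<^bsub>Rhat\<^esub>"
    by (rule act_faithful) (use x yc y(2) act_closed in \<open>auto simp: act_diff_l E_diff_self\<close>)
  then have "x = y" using x yc hat.r_right_minus_eq by blast
  then show ?thesis using y by simp
qed

text \<open>The counterpart of \<open>ann_vector\<close> with ring and module exchanged: the
  homomorphism on \<open>N + R e\<close> sending \<open>n + t e\<close> to
  \<open>t e\<^sub>0\<close> is well defined because \<open>(N : e) \<subseteq> m\<close>, and
  \<open>linear_is_act\<close> realizes it in the completion.\<close>

lemma separating_element:
  assumes N: "submodule N R E" and e: "e \<in> carrier E" "e \<notin> N"
  obtains x where "x \<in> carrier Rhat" "\<And>n. n \<in> N \<Longrightarrow> act x n = \<zero>\<^bsub>E\<^esub>" "act x e = e\<^sub>0"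
proof -
  define W where "W = {n \<oplus>\<^bsub>E\<^esub> r \<odot>\<^bsub>E\<^esub> e |n r. n \<in> N \<and> r \<in> carrier R}"
  define f where "f w = (SOME t. t \<in> carrier R \<and> w \<ominus>\<^bsub>E\<^esub> t \<odot>\<^bsub>E\<^esub> e \<in> N) \<odot>\<^bsub>E\<^esub> e\<^sub>0" for w
  have Nc: "n \<in> carrier E" if "n \<in> N" for n using that N sub_carr by blast
  have colon: "{r \<in> carrier R. r \<odot>\<^bsub>E\<^esub> e \<in> N} \<subseteq> m"
  proof (rule proper_ideal_subset_m)
    show "ideal {r \<in> carrier R. r \<odot>\<^bsub>E\<^esub> e \<in> N} R"
      by (rule ideal_intro) (use e N sub_zero sub_add sub_smult in \<open>auto simp: smult_l_distr smult_assoc1\<close>)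
    have "\<one> \<notin> {r \<in> carrier R. r \<odot>\<^bsub>E\<^esub> e \<in> N}" using e by simp
    then show "{r \<in> carrier R. r \<odot>\<^bsub>E\<^esub> e \<in> N} \<noteq> carrier R" by blast
  qed
  have f: "f (n \<oplus>\<^bsub>E\<^esub> t \<odot>\<^bsub>E\<^esub> e) = t \<odot>\<^bsub>E\<^esub> e\<^sub>0" if t: "n \<in> N" "t \<in> carrier R" for n t
  proof -
    let ?w = "n \<oplus>\<^bsub>E\<^esub> t \<odot>\<^bsub>E\<^esub> e"
    define u where "u = (SOME t. t \<in> carrier R \<and> ?w \<ominus>\<^bsub>E\<^esub> t \<odot>\<^bsub>E\<^esub> e \<in> N)"
    have "?w \<ominus>\<^bsub>E\<^esub> t \<odot>\<^bsub>E\<^esub> e = n" using t e Nc by (simp add: a_minus_def M.a_assoc M.r_neg)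
    then have u: "u \<in> carrier R" "?w \<ominus>\<^bsub>E\<^esub> u \<odot>\<^bsub>E\<^esub> e \<in> N"
      using someI[of "\<lambda>t. t \<in> carrier R \<and> ?w \<ominus>\<^bsub>E\<^esub> t \<odot>\<^bsub>E\<^esub> e \<in> N" t] t by (auto simp: u_def)
    have "?w \<ominus>\<^bsub>E\<^esub> u \<odot>\<^bsub>E\<^esub> e = n \<oplus>\<^bsub>E\<^esub> (t \<ominus> u) \<odot>\<^bsub>E\<^esub> e"
      using u t e Nc smult_diff_l[of t u e] by (simp add: M.minus_eq M.a_assoc)
    then have "(n \<oplus>\<^bsub>E\<^esub> (t \<ominus> u) \<odot>\<^bsub>E\<^esub> e) \<ominus>\<^bsub>E\<^esub> n \<in> N" using sub_minus[OF N] u t by simp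
    moreover have "(n \<oplus>\<^bsub>E\<^esub> (t \<ominus> u) \<odot>\<^bsub>E\<^esub> e) \<ominus>\<^bsub>E\<^esub> n = (t \<ominus> u) \<odot>\<^bsub>E\<^esub> e"
      using u t e Nc by (simp add: a_minus_def M.a_ac M.r_neg1 M.r_neg2 M.r_neg)
    ultimately have "t \<ominus> u \<in> m" using colon u t by auto
    then have "u \<odot>\<^bsub>E\<^esub> e\<^sub>0 = t \<odot>\<^bsub>E\<^esub> e\<^sub>0" using u t smult_e0_eq_iff[of t u] by simp
    then show ?thesis by (simp add: f_def u_def)
  qed
  have W_add: "(n \<oplus>\<^bsub>E\<^esub> t \<odot>\<^bsub>E\<^esub> e) \<oplus>\<^bsub>E\<^esub> (n' \<oplus>\<^bsub>E\<^esub> u \<odot>\<^bsub>E\<^esub> e) = (n \<oplus>\<^bsub>E\<^esub> n') \<oplus>\<^bsub>E\<^esub> (t \<oplus> u) \<odot>\<^bsub>E\<^esub> e"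
    if "n \<in> N" "n' \<in> N" "t \<in> carrier R" "u \<in> carrier R" for n n' t u
    using that Nc e by (simp add: smult_l_distr M.a_ac)
  have W_smult: "r \<odot>\<^bsub>E\<^esub> (n \<oplus>\<^bsub>E\<^esub> t \<odot>\<^bsub>E\<^esub> e) = r \<odot>\<^bsub>E\<^esub> n \<oplus>\<^bsub>E\<^esub> (r \<otimes> t) \<odot>\<^bsub>E\<^esub> e"
    if "n \<in> N" "t \<in> carrier R" "r \<in> carrier R" for n t r
    using that Nc e by (simp add: smult_r_distr smult_assoc1)
  have W_mem: "n \<oplus>\<^bsub>E\<^esub> t \<odot>\<^bsub>E\<^esub> e \<in> W" if "n \<in> N" "t \<in> carrier R" for n t
    using that unfolding W_def by blast
  have W: "submodule W R E"
  proof (rule submodule_intro)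
    show "W \<subseteq> carrier E" using Nc e by (auto simp: W_def)
    show "\<zero>\<^bsub>E\<^esub> \<in> W" using W_mem[OF sub_zero[OF N] R.zero_closed] e by simp
    fix a b assume "a \<in> W" "b \<in> W"
    then show "a \<oplus>\<^bsub>E\<^esub> b \<in> W"
      using W_add W_mem sub_add[OF N] by (auto simp: W_def)
  next
    fix r a assume "r \<in> carrier R" "a \<in> W"
    then show "r \<odot>\<^bsub>E\<^esub> a \<in> W"
      using W_smult W_mem sub_smult[OF N] by (auto simp: W_def)
  qed
  have "linear_on W f"
    unfolding linear_on_def
  proof (intro conjI ballI Pi_I)
    show "f w \<in> carrier E" if "w \<in> W" for w using that f e0_closed by (auto simp: W_def)
    fix a b assume "a \<in> W" "b \<in> W"
    then show "f (a \<oplus>\<^bsub>E\<^esub> b) = f a \<oplus>\<^bsub>E\<^esub> f b"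
      using f W_add sub_add[OF N] e0_closed by (auto simp: W_def smult_l_distr)
  next
    fix r a assume "r \<in> carrier R" "a \<in> W"
    then show "f (r \<odot>\<^bsub>E\<^esub> a) = r \<odot>\<^bsub>E\<^esub> f a"
      using f W_smult sub_smult[OF N] e0_closed by (auto simp: W_def smult_assoc1)
  qed
  then obtain x where x: "x \<in> carrier Rhat" "\<And>w. w \<in> W \<Longrightarrow> f w = act x w"
    using linear_is_act[OF W] by blast
  have "act x n = \<zero>\<^bsub>E\<^esub>" if n: "n \<in> N" for n
    using f[OF n R.zero_closed] x(2)[OF W_mem[OF n R.zero_closed]] Nc[OF n] e e0_closed by simp
  moreover have "act x e = e\<^sub>0"
    using f[OF sub_zero[OF N] R.one_closed] x(2)[OF W_mem[OF sub_zero[OF N] R.one_closed]] e e0_closed by simp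
  ultimately show thesis using that x by blast
qed

end

section \<open>The completion is noetherian\<close>

context residue_hull
begin

abbreviation Ann :: "'b set \<Rightarrow> (nat \<Rightarrow> 'a set) set" where "Ann \<equiv> hat_ann R m E"
abbreviation contr :: "(nat \<Rightarrow> 'a set) set \<Rightarrow> 'a set" where "contr \<equiv> contraction R m"
abbreviation canon :: "'a \<Rightarrow> nat \<Rightarrow> 'a set" where "canon \<equiv> compl_canon R m"

section \<open>Annihilators of submodules and of ideals\<close>

definition annE :: "(nat \<Rightarrow> 'a set) set \<Rightarrow> 'b set" where
  "annE Q = {e \<in> carrier E. \<forall>x\<in>Q. act x e = \<zero>\<^bsub>E\<^esub>}"

lemma Ann_ideal: "X \<subseteq> carrier E \<Longrightarrow> ideal (Ann X) Rhat"
  by (rule hat.ideal_intro)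
    (auto simp: hat_ann_def act_add_l act_mult act_zero_l act_zero_r subset_iff)

lemma annE_submodule:
  assumes "Q \<subseteq> carrier Rhat" shows "submodule (annE Q) R E"
proof (rule submodule_intro)
  have lin: "linear_on (carrier E) (act x)" if "x \<in> Q" for x
    using act_linear[OF carrier_is_submodule] that assms by blast
  show "annE Q \<subseteq> carrier E" "\<zero>\<^bsub>E\<^esub> \<in> annE Q" using assms act_zero_r by (auto simp: annE_def)
  show "e \<oplus>\<^bsub>E\<^esub> f \<in> annE Q" if "e \<in> annE Q" "f \<in> annE Q" for e f
    using that lin by (simp add: annE_def linear_on_def)
  show "r \<odot>\<^bsub>E\<^esub> e \<in> annE Q" if "r \<in> carrier R" "e \<in> annE Q" for r e
    using that lin by (simp add: annE_def linear_on_def)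
qed

text \<open>This half of the duality holds for arbitrary submodules, since
  \<open>separating_element\<close> detects every element outside \<open>N\<close>. The other half,
  \<open>Ann_annE\<close>, waits for finite generation of ideals.\<close>

lemma annE_Ann:
  assumes N: "submodule N R E" shows "annE (Ann N) = N"
proof
  show "N \<subseteq> annE (Ann N)" using sub_carr[OF N] by (auto simp: annE_def hat_ann_def)
  show "annE (Ann N) \<subseteq> N"
  proof
    fix e assume e: "e \<in> annE (Ann N)"
    show "e \<in> N"
    proof (rule ccontr)
      assume "e \<notin> N"
      then obtain x where x: "x \<in> carrier Rhat" "\<And>n. n \<in> N \<Longrightarrow> act x n = \<zero>\<^bsub>E\<^esub>" "act x e = e\<^sub>0"
        using separating_element[OF N] e unfolding annE_def by blast
      then have "x \<in> Ann N" by (simp add: hat_ann_def)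
      then show False using e x e0_nonzero by (simp add: annE_def)
    qed
  qed
qed

lemma contr_Ann: "X \<subseteq> carrier E \<Longrightarrow> contr (Ann X) = mod_ann R E X"
  by (auto simp: contraction_def hat_ann_def mod_ann_def canon_carrier act_canon subset_iff)

text \<open>\<open>Ann {e\<^sub>0}\<close> is the maximal ideal of the completion. Elements killed
  by generators of \<open>m\<close> lie in the socle \<open>R e\<^sub>0\<close>, on which
  \<open>Ann {e\<^sub>0}\<close> vanishes, so \<open>ann_ann_fg\<close> applies.\<close>

lemma Ann_e0_fg:
  assumes A: "A \<subseteq> carrier R" "finite A" "m = Idl A"
  shows "Ann {e\<^sub>0} = Idl\<^bsub>Rhat\<^esub> (canon ` A)"
proof
  have Ac: "canon ` A \<subseteq> carrier Rhat" using A canon_carrier by auto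
  show "Ann {e\<^sub>0} \<subseteq> Idl\<^bsub>Rhat\<^esub> (canon ` A)"
  proof
    fix x assume x: "x \<in> Ann {e\<^sub>0}"
    then have xc: "x \<in> carrier Rhat" "act x e\<^sub>0 = \<zero>\<^bsub>E\<^esub>" by (auto simp: hat_ann_def)
    show "x \<in> Idl\<^bsub>Rhat\<^esub> (canon ` A)"
    proof (rule ann_ann_fg[OF finite_imageI[OF A(2)] Ac xc(1)])
      fix e assume e: "e \<in> carrier E" "\<And>s. s \<in> canon ` A \<Longrightarrow> act s e = \<zero>\<^bsub>E\<^esub>"
      have "a \<odot>\<^bsub>E\<^esub> e = \<zero>\<^bsub>E\<^esub>" if "a \<in> A" for a
        using e(2)[of "canon a"] act_canon[of a e] that A(1) e(1) by auto
      then have "A \<subseteq> mod_ann R E {e}" using A(1) by (auto simp: mod_ann_def)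
      then have "m \<subseteq> mod_ann R E {e}" using A e genideal_minimal[OF mod_ann_ideal] by simp
      then have "a \<odot>\<^bsub>E\<^esub> e = \<zero>\<^bsub>E\<^esub>" if "a \<in> m" for a using that by (auto simp: mod_ann_def)
      then obtain t where "t \<in> carrier R" "e = t \<odot>\<^bsub>E\<^esub> e\<^sub>0" using socle[OF e(1)] by blast
      then show "act x e = \<zero>\<^bsub>E\<^esub>"
        using act_linear[OF carrier_is_submodule xc(1)] xc e0_closed by (simp add: linear_on_def)
    qed
  qed
  show "Idl\<^bsub>Rhat\<^esub> (canon ` A) \<subseteq> Ann {e\<^sub>0}"
  proof (rule hat.genideal_minimal[OF Ann_ideal])
    have "A \<subseteq> m" using A genideal_self by blast
    then show "canon ` A \<subseteq> Ann {e\<^sub>0}"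
      using A(1) e0_closed m_e0 by (auto simp: hat_ann_def canon_carrier act_canon subset_iff)
  qed (use e0_closed in auto)
qed

text \<open>An \<open>x \<in> I\<close> that does not kill \<open>e\<^sub>0\<close> acts on it like
  a unit \<open>r\<close> of \<open>R\<close>. Then \<open>x - r\<close> kills
  \<open>e\<^sub>0\<close>, hence lies in \<open>I\<close>, and so does the unit \<open>r\<close>.
  The lemma produces the element of \<open>m\<close> missed by \<open>I\<close> in
  \<open>Rhat_fg\<close>, and it shows that only one prime lies over \<open>m\<close>.\<close>

lemma proper_ideal_over_m:
  assumes I: "ideal I Rhat" "I \<noteq> carrier Rhat" and m: "m \<subseteq> contr I"
  shows "I = Ann {e\<^sub>0}"
proof
  obtain A where A: "A \<subseteq> carrier R" "finite A" "m = Idl A" using finetely_gen[OF m_ideal] by blast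
  have "A \<subseteq> m" using A genideal_self by blast
  then have "canon ` A \<subseteq> I" using m by (auto simp: contraction_def)
  then show le: "Ann {e\<^sub>0} \<subseteq> I" using Ann_e0_fg[OF A] hat.genideal_minimal[OF I(1)] by simp
  show "I \<subseteq> Ann {e\<^sub>0}"
  proof
    fix x assume x: "x \<in> I"
    show "x \<in> Ann {e\<^sub>0}"
    proof (rule ccontr)
      assume nx: "x \<notin> Ann {e\<^sub>0}"
      have xc: "x \<in> carrier Rhat" using x I hat.ideal_carr by blast
      obtain r where r: "r \<in> carrier R" "act x e\<^sub>0 = r \<odot>\<^bsub>E\<^esub> e\<^sub>0" using act_rep[OF xc e0_closed] by blast
      then have "r \<notin> m" using nx xc m_e0 by (auto simp: hat_ann_def)
      then obtain u where u: "u \<in> carrier R" "u \<otimes> r = \<one>" using unit_mod_m r by blast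
      have "x \<ominus>\<^bsub>Rhat\<^esub> canon r \<in> Ann {e\<^sub>0}"
        using r xc e0_closed by (simp add: hat_ann_def act_diff_l canon_carrier act_canon E_diff_self)
      then have "x \<ominus>\<^bsub>Rhat\<^esub> (x \<ominus>\<^bsub>Rhat\<^esub> canon r) \<in> I" using le x hat.ideal_minus[OF I(1)] by blast
      moreover have "x \<ominus>\<^bsub>Rhat\<^esub> (x \<ominus>\<^bsub>Rhat\<^esub> canon r) = canon r"
        using xc canon_carrier[OF r(1)]
        by (intro hat.eq_sum_imp_minus[symmetric]) (simp_all add: hat.minus_eq hat.a_assoc hat.l_neg)
      ultimately have "canon u \<otimes>\<^bsub>Rhat\<^esub> canon r \<in> I" using u hat.ideal_mult_left[OF I(1)] canon_carrier by simp
      then have "\<one>\<^bsub>Rhat\<^esub> \<in> I" using u r by (simp add: canon_one flip: canon_mult)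
      then show False using I hat.ideal_eq_carrier by blast
    qed
  qed
qed

section \<open>Finite generation of the ideals of the completion\<close>

definition fg :: "(nat \<Rightarrow> 'a set) set \<Rightarrow> bool" where
  "fg I \<longleftrightarrow> (\<exists>A \<subseteq> carrier Rhat. finite A \<and> I = Idl\<^bsub>Rhat\<^esub> A)"

text \<open>A form of Nakayama's lemma: on an element killed by \<open>m^n\<close> one applies
  \<open>I \<subseteq> Idl F + \<alpha> I\<close> to itself \<open>n\<close> times.\<close>

lemma complete_nakayama:
  assumes I: "ideal I Rhat" and F: "finite F" "F \<subseteq> I" and a: "a \<in> m"
    and sub: "\<And>z. z \<in> I \<Longrightarrow> \<exists>f\<in>Idl\<^bsub>Rhat\<^esub> F. \<exists>c\<in>I. z = f \<oplus>\<^bsub>Rhat\<^esub> c \<otimes>\<^bsub>Rhat\<^esub> canon a"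
  shows "I = Idl\<^bsub>Rhat\<^esub> F"
proof
  show "Idl\<^bsub>Rhat\<^esub> F \<subseteq> I" by (rule hat.genideal_minimal[OF I F(2)])
  have Fc: "F \<subseteq> carrier Rhat" using F I hat.ideal_carr by blast
  have ac: "a \<in> carrier R" using a ideal_carr[OF m_ideal] by blast
  have Fid: "ideal (Idl\<^bsub>Rhat\<^esub> F) Rhat" by (rule hat.genideal_ideal[OF Fc])
  have *: "act z e = \<zero>\<^bsub>E\<^esub>"
    if "kills n e" "e \<in> carrier E" "\<And>s. s \<in> F \<Longrightarrow> act s e = \<zero>\<^bsub>E\<^esub>" "z \<in> I" for n e z
    using that
  proof (induction n arbitrary: e z)
    case 0
    have "e = \<one> \<odot>\<^bsub>E\<^esub> e" using 0 by simp
    also have "\<dots> = \<zero>\<^bsub>E\<^esub>" using 0(1) unfolding kills_def by simp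
    finally show ?case using act_zero_r hat.ideal_carr[OF I] 0 by blast
  next
    case (Suc n)
    obtain f c where fc: "f \<in> Idl\<^bsub>Rhat\<^esub> F" "c \<in> I" "z = f \<oplus>\<^bsub>Rhat\<^esub> c \<otimes>\<^bsub>Rhat\<^esub> canon a"
      using sub[OF Suc.prems(4)] by blast
    have carr: "f \<in> carrier Rhat" "c \<in> carrier Rhat" "canon a \<in> carrier Rhat"
      using fc hat.ideal_carr[OF I] hat.ideal_carr[OF Fid] canon_carrier[OF ac] by auto
    have "act c (a \<odot>\<^bsub>E\<^esub> e) = \<zero>\<^bsub>E\<^esub>"
    proof (rule Suc.IH)
      show "kills n (a \<odot>\<^bsub>E\<^esub> e)" using kills_smult_Suc Suc.prems a by blast
      fix s assume s: "s \<in> F"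
      then show "act s (a \<odot>\<^bsub>E\<^esub> e) = \<zero>\<^bsub>E\<^esub>"
        using act_linear[OF carrier_is_submodule, of s] Suc.prems(2,3) ac Fc
        by (auto simp: linear_on_def)
    qed (use ac Suc.prems fc in auto)
    moreover have "F \<subseteq> Ann {e}" using Suc.prems Fc by (auto simp: hat_ann_def)
    then have "Idl\<^bsub>Rhat\<^esub> F \<subseteq> Ann {e}" using Suc.prems by (intro hat.genideal_minimal Ann_ideal) auto
    then have "act f e = \<zero>\<^bsub>E\<^esub>" using fc by (auto simp: hat_ann_def)
    ultimately show ?case using fc carr ac Suc.prems by (simp add: act_add_l act_mult act_canon)
  qed
  show "I \<subseteq> Idl\<^bsub>Rhat\<^esub> F"
  proof
    fix z assume z: "z \<in> I"
    show "z \<in> Idl\<^bsub>Rhat\<^esub> F"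
    proof (rule ann_ann_fg[OF F(1) Fc hat.ideal_carr[OF I z]])
      fix e assume "e \<in> carrier E" "\<And>s. s \<in> F \<Longrightarrow> act s e = \<zero>\<^bsub>E\<^esub>"
      then show "act z e = \<zero>\<^bsub>E\<^esub>" using * z killed by blast
    qed
  qed
qed

text \<open>Following Cohen, an ideal maximal among those that are not finitely generated is not the
  maximal ideal of the completion, hence misses some \<open>\<alpha> \<in> m\<close>; then \<open>I + (\<alpha>)\<close> is finitely
  generated, and so is \<open>(I : \<alpha>)\<close> unless it equals \<open>I\<close>.\<close>

lemma Rhat_fg:
  assumes "ideal I\<^sub>0 Rhat" shows "fg I\<^sub>0"
proof (rule ccontr)
  assume nfg: "\<not> fg I\<^sub>0"
  define S where "S = {I. ideal I Rhat \<and> \<not> fg I}"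
  have "\<exists>M\<in>S. \<forall>J\<in>S. M \<subseteq> J \<longrightarrow> J = M"
  proof (rule subset_Zorn_nonempty)
    show "S \<noteq> {}" using assms nfg by (auto simp: S_def)
    fix C assume C: "C \<noteq> {}" "subset.chain S C"
    then have ch: "subset.chain {I. ideal I Rhat} C" by (auto simp: S_def subset_chain_def)
    have id: "ideal (\<Union>C) Rhat" using hat.chain_Union_is_ideal[OF ch] C(1) by simp
    have "\<not> fg (\<Union>C)"
    proof
      assume "fg (\<Union>C)"
      then obtain A where A: "A \<subseteq> carrier Rhat" "finite A" "\<Union>C = Idl\<^bsub>Rhat\<^esub> A" by (auto simp: fg_def)
      have "A \<subseteq> \<Union>C" using A hat.genideal_self by blast
      then obtain X where X: "X \<in> C" "A \<subseteq> X"
        using finite_subset_Union_chain[OF A(2) _ C(1) ch] by blast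
      have "X \<in> S" using X C(2) by (auto simp: subset_chain_def)
      then have "Idl\<^bsub>Rhat\<^esub> A \<subseteq> X" using X hat.genideal_minimal[of X A] by (auto simp: S_def)
      then have "X = Idl\<^bsub>Rhat\<^esub> A" using X A by blast
      then show False using A \<open>X \<in> S\<close> by (auto simp: S_def fg_def)
    qed
    then show "\<Union>C \<in> S" using id by (simp add: S_def)
  qed
  then obtain I where "I \<in> S" and max: "\<And>J. J \<in> S \<Longrightarrow> I \<subseteq> J \<Longrightarrow> J = I" by blast
  then have I: "ideal I Rhat" "\<not> fg I" by (auto simp: S_def)
  have "carrier Rhat = Idl\<^bsub>Rhat\<^esub> {\<one>\<^bsub>Rhat\<^esub>}" by (simp add: hat.genideal_one)
  then have "fg (carrier Rhat)" unfolding fg_def by (intro exI[of _ "{\<one>\<^bsub>Rhat\<^esub>}"]) auto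
  then have "I \<noteq> carrier Rhat" using I by auto
  moreover have "fg (Ann {e\<^sub>0})"
  proof -
    obtain A where A: "A \<subseteq> carrier R" "finite A" "m = Idl A" using finetely_gen[OF m_ideal] by blast
    then show ?thesis unfolding fg_def Ann_e0_fg[OF A] using canon_carrier by (intro exI[of _ "canon ` A"]) auto
  qed
  ultimately obtain a where a: "a \<in> m" "a \<notin> contr I" using proper_ideal_over_m[OF I(1)] I(2) by blast
  have ac: "a \<in> carrier R" using a m_ideal ideal_carr by blast
  define \<alpha> where "\<alpha> = canon a"
  have \<alpha>: "\<alpha> \<in> carrier Rhat" "\<alpha> \<notin> I" using a ac canon_carrier by (auto simp: \<alpha>_def contraction_def)
  have P\<alpha>: "ideal (PIdl\<^bsub>Rhat\<^esub> \<alpha>) Rhat" "\<alpha> \<in> PIdl\<^bsub>Rhat\<^esub> \<alpha>"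
    using \<alpha> hat.cgenideal_ideal hat.cgenideal_self by auto
  define J where "J = I <+>\<^bsub>Rhat\<^esub> PIdl\<^bsub>Rhat\<^esub> \<alpha>"
  have J: "ideal J Rhat" unfolding J_def by (intro hat.add_ideals I P\<alpha>)
  have IJ: "I \<subseteq> J" "\<alpha> \<in> J"
    using hat.ideal_sum_left[OF I(1) P\<alpha>(1)] hat.ideal_sum_right[OF I(1) P\<alpha>(1)] P\<alpha>(2) by (auto simp: J_def)
  have "fg J" using max[of J] IJ \<alpha> J by (auto simp: S_def)
  then obtain A where A: "A \<subseteq> carrier Rhat" "finite A" "J = Idl\<^bsub>Rhat\<^esub> A" by (auto simp: fg_def)
  have "\<forall>z\<in>A. \<exists>i. i \<in> I \<and> (\<exists>c\<in>carrier Rhat. z = i \<oplus>\<^bsub>Rhat\<^esub> c \<otimes>\<^bsub>Rhat\<^esub> \<alpha>)"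
  proof
    fix z assume "z \<in> A"
    then have "z \<in> J" using A hat.genideal_self by blast
    then show "\<exists>i. i \<in> I \<and> (\<exists>c\<in>carrier Rhat. z = i \<oplus>\<^bsub>Rhat\<^esub> c \<otimes>\<^bsub>Rhat\<^esub> \<alpha>)"
      by (auto simp: J_def hat.mem_PIdl elim!: hat.set_add_memE) blast
  qed
  then obtain p where p: "\<And>z. z \<in> A \<Longrightarrow> p z \<in> I"
    "\<And>z. z \<in> A \<Longrightarrow> \<exists>c\<in>carrier Rhat. z = p z \<oplus>\<^bsub>Rhat\<^esub> c \<otimes>\<^bsub>Rhat\<^esub> \<alpha>" by metis
  \<comment> \<open>\<open>F\<close> collects the parts in \<open>I\<close> of the generators, so
    that \<open>I + (\<alpha>)\<close> equals \<open>Idl F + (\<alpha>)\<close>.\<close>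
  define F where "F = p ` A"
  have F: "finite F" "F \<subseteq> I" using A p by (auto simp: F_def)
  then have Fc: "F \<subseteq> carrier Rhat" using hat.ideal_carr[OF I(1)] by blast
  have Fid: "ideal (Idl\<^bsub>Rhat\<^esub> F) Rhat" by (rule hat.genideal_ideal[OF Fc])
  have FI: "Idl\<^bsub>Rhat\<^esub> F \<subseteq> I" by (rule hat.genideal_minimal[OF I(1) F(2)])
  have "J \<subseteq> Idl\<^bsub>Rhat\<^esub> F <+>\<^bsub>Rhat\<^esub> PIdl\<^bsub>Rhat\<^esub> \<alpha>"
    unfolding A(3)
  proof (rule hat.genideal_minimal)
    show "ideal (Idl\<^bsub>Rhat\<^esub> F <+>\<^bsub>Rhat\<^esub> PIdl\<^bsub>Rhat\<^esub> \<alpha>) Rhat" by (intro hat.add_ideals Fid P\<alpha>)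
    show "A \<subseteq> Idl\<^bsub>Rhat\<^esub> F <+>\<^bsub>Rhat\<^esub> PIdl\<^bsub>Rhat\<^esub> \<alpha>"
    proof
      fix z assume z: "z \<in> A"
      then obtain c where c: "c \<in> carrier Rhat" "z = p z \<oplus>\<^bsub>Rhat\<^esub> c \<otimes>\<^bsub>Rhat\<^esub> \<alpha>" using p by blast
      have "p z \<in> Idl\<^bsub>Rhat\<^esub> F" using z hat.genideal_self[OF Fc] by (auto simp: F_def)
      moreover have "c \<otimes>\<^bsub>Rhat\<^esub> \<alpha> \<in> PIdl\<^bsub>Rhat\<^esub> \<alpha>" using c by (auto simp: hat.mem_PIdl)
      ultimately show "z \<in> Idl\<^bsub>Rhat\<^esub> F <+>\<^bsub>Rhat\<^esub> PIdl\<^bsub>Rhat\<^esub> \<alpha>"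
        using hat.set_add_memI c(2) by metis
    qed
  qed
  \<comment> \<open>Subtracting \<open>f \<in> I\<close> puts \<open>c \<alpha>\<close> into
    \<open>I\<close>, so the coefficient \<open>c\<close> lies in the colon ideal: \<open>I\<close>
    is \<open>Idl F + \<alpha> (I : \<alpha>)\<close>.\<close>
  have dec: "\<exists>f\<in>Idl\<^bsub>Rhat\<^esub> F. \<exists>c\<in>ideal_colon Rhat I \<alpha>. z = f \<oplus>\<^bsub>Rhat\<^esub> c \<otimes>\<^bsub>Rhat\<^esub> \<alpha>"
    if z: "z \<in> I" for z
  proof -
    have "z \<in> Idl\<^bsub>Rhat\<^esub> F <+>\<^bsub>Rhat\<^esub> PIdl\<^bsub>Rhat\<^esub> \<alpha>" using z IJ \<open>J \<subseteq> _\<close> by blast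
    then obtain f c where fc: "f \<in> Idl\<^bsub>Rhat\<^esub> F" "c \<in> carrier Rhat" "z = f \<oplus>\<^bsub>Rhat\<^esub> c \<otimes>\<^bsub>Rhat\<^esub> \<alpha>"
      by (auto simp: hat.mem_PIdl elim!: hat.set_add_memE)
    have "f \<in> I" using fc FI by blast
    then have "c \<otimes>\<^bsub>Rhat\<^esub> \<alpha> = z \<ominus>\<^bsub>Rhat\<^esub> f"
      using fc \<alpha> hat.ideal_carr[OF I(1)] by (intro hat.eq_sum_imp_minus) auto
    then have "c \<otimes>\<^bsub>Rhat\<^esub> \<alpha> \<in> I" using hat.ideal_minus[OF I(1) z \<open>f \<in> I\<close>] by simp
    then have "c \<in> ideal_colon Rhat I \<alpha>" using fc \<alpha> by (simp add: ideal_colon_def hat.m_comm)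
    then show ?thesis using fc by blast
  qed
  define K where "K = ideal_colon Rhat I \<alpha>"
  have K: "ideal K Rhat" unfolding K_def by (rule hat.ideal_colon_ideal[OF I(1) \<alpha>(1)])
  have IK: "I \<subseteq> K"
    using hat.ideal_mult_left[OF I(1) _ \<alpha>(1)] hat.ideal_carr[OF I(1)] by (auto simp: K_def ideal_colon_def)
  \<comment> \<open>If the colon ideal is \<open>I\<close> itself, \<open>dec\<close> is the
    hypothesis of \<open>complete_nakayama\<close>. Otherwise maximality of \<open>I\<close> makes
    it finitely generated, and \<open>F\<close> together with the multiples by
    \<open>\<alpha>\<close> of its generators generates \<open>I\<close>.\<close>
  show False
  proof (cases "K = I")
    case True
    then have "I = Idl\<^bsub>Rhat\<^esub> F"
      using dec by (intro complete_nakayama[OF I(1) F a(1)]) (simp add: K_def \<alpha>_def)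
    then show False using I F Fc by (auto simp: fg_def)
  next
    case False
    then have "fg K" using max[of K] IK K by (auto simp: S_def)
    then obtain B where B: "B \<subseteq> carrier Rhat" "finite B" "K = Idl\<^bsub>Rhat\<^esub> B" by (auto simp: fg_def)
    define G where "G = F \<union> (\<lambda>b. \<alpha> \<otimes>\<^bsub>Rhat\<^esub> b) ` B"
    have "B \<subseteq> K" using B hat.genideal_self by blast
    then have GI: "G \<subseteq> I" using F by (auto simp: G_def K_def ideal_colon_def)
    then have Gc: "G \<subseteq> carrier Rhat" using hat.ideal_carr[OF I(1)] by blast
    have Gid: "ideal (Idl\<^bsub>Rhat\<^esub> G) Rhat" by (rule hat.genideal_ideal[OF Gc])
    have "K \<subseteq> ideal_colon Rhat (Idl\<^bsub>Rhat\<^esub> G) \<alpha>"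
      unfolding B(3)
    proof (rule hat.genideal_minimal[OF hat.ideal_colon_ideal[OF Gid \<alpha>(1)]])
      show "B \<subseteq> ideal_colon Rhat (Idl\<^bsub>Rhat\<^esub> G) \<alpha>"
        using B hat.genideal_self[OF Gc] by (auto simp: ideal_colon_def G_def)
    qed
    have "I = Idl\<^bsub>Rhat\<^esub> G"
    proof
      show "Idl\<^bsub>Rhat\<^esub> G \<subseteq> I" by (rule hat.genideal_minimal[OF I(1) GI])
      show "I \<subseteq> Idl\<^bsub>Rhat\<^esub> G"
      proof
        fix z assume "z \<in> I"
        then obtain f c where fc: "f \<in> Idl\<^bsub>Rhat\<^esub> F" "c \<in> K" "z = f \<oplus>\<^bsub>Rhat\<^esub> c \<otimes>\<^bsub>Rhat\<^esub> \<alpha>"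
          using dec unfolding K_def by blast
        have "f \<in> Idl\<^bsub>Rhat\<^esub> G" using fc hat.subset_Idl_subset[OF Gc, of F] by (auto simp: G_def)
        moreover have "c \<otimes>\<^bsub>Rhat\<^esub> \<alpha> \<in> Idl\<^bsub>Rhat\<^esub> G"
          using fc \<open>K \<subseteq> _\<close> \<alpha> hat.m_comm[of c \<alpha>] by (auto simp: ideal_colon_def)
        ultimately show "z \<in> Idl\<^bsub>Rhat\<^esub> G" using fc hat.ideal_add[OF Gid] by simp
      qed
    qed
    moreover have "finite G" using F B by (simp add: G_def)
    ultimately show False using I Gc by (auto simp: fg_def)
  qed
qed

lemma Rhat_noetherian: "noetherian_cring Rhat"
  using hat.noetherian_ringI Rhat_fg hat.plain_cring_axioms
  by (auto simp: fg_def noetherian_cring_def)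

text \<open>Now that every ideal has finitely many generators, \<open>ann_ann_fg\<close> gives the
  second half of the duality.\<close>

lemma Ann_annE:
  assumes Q: "ideal Q Rhat" shows "Ann (annE Q) = Q"
proof
  show "Q \<subseteq> Ann (annE Q)" using hat.ideal_carr[OF Q] by (auto simp: hat_ann_def annE_def)
  show "Ann (annE Q) \<subseteq> Q"
  proof
    fix x assume x: "x \<in> Ann (annE Q)"
    obtain S where S: "S \<subseteq> carrier Rhat" "finite S" "Q = Idl\<^bsub>Rhat\<^esub> S"
      using Rhat_fg[OF Q] by (auto simp: fg_def)
    show "x \<in> Q" unfolding S(3)
    proof (rule ann_ann_fg[OF S(2,1)])
      show "x \<in> carrier Rhat" using x by (simp add: hat_ann_def)
      fix e assume e: "e \<in> carrier E" "\<And>s. s \<in> S \<Longrightarrow> act s e = \<zero>\<^bsub>E\<^esub>"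
      have "S \<subseteq> Ann {e}" using e S by (auto simp: hat_ann_def)
      then have "Q \<subseteq> Ann {e}" unfolding S(3) using e by (intro hat.genideal_minimal Ann_ideal) auto
      then have "e \<in> annE Q" using e by (auto simp: annE_def hat_ann_def)
      then show "act x e = \<zero>\<^bsub>E\<^esub>" using x by (simp add: hat_ann_def)
    qed
  qed
qed

end

section \<open>Divisible submodules\<close>

lemma gabriel_nonempty: "gabriel_topology R F \<Longrightarrow> F \<noteq> {}"
  unfolding gabriel_topology_def by (elim conjE)

lemma gabriel_ideals: "gabriel_topology R F \<Longrightarrow> \<forall>a\<in>F. ideal a R"
  unfolding gabriel_topology_def by (elim conjE)

lemma gabriel_ideal: "gabriel_topology R F \<Longrightarrow> a \<in> F \<Longrightarrow> ideal a R"
  using gabriel_ideals by blast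

lemma gabriel_upwards:
  "gabriel_topology R F \<Longrightarrow> \<forall>a b. a \<in> F \<and> ideal b R \<and> a \<subseteq> b \<longrightarrow> b \<in> F"
  unfolding gabriel_topology_def by (elim conjE)

lemma gabriel_upward: "gabriel_topology R F \<Longrightarrow> a \<in> F \<Longrightarrow> ideal b R \<Longrightarrow> a \<subseteq> b \<Longrightarrow> b \<in> F"
  using gabriel_upwards by blast

lemma gabriel_colon:
  "gabriel_topology R F \<Longrightarrow> \<forall>b. ideal b R \<and> (\<exists>a\<in>F. \<forall>r\<in>a. ideal_colon R b r \<in> F) \<longrightarrow> b \<in> F"
  unfolding gabriel_topology_def by (elim conjE)

context plain_cring
begin

lemma gabriel_carrier: "gabriel_topology R F \<Longrightarrow> carrier R \<in> F"
proof -
  assume F: "gabriel_topology R F"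
  then obtain a where "a \<in> F" using gabriel_nonempty by blast
  then show ?thesis
    using gabriel_upward[OF F _ oneideal] ideal_carr[OF gabriel_ideal[OF F]] by blast
qed

text \<open>The third axiom applies with \<open>a\<close> as the test ideal: for
  \<open>r \<in> a\<close> the colon ideal \<open>(ab : r)\<close> contains
  \<open>b\<close>.\<close>

lemma gabriel_prod:
  assumes F: "gabriel_topology R F" and ab: "a \<in> F" "b \<in> F"
  shows "ideal_prod R a b \<in> F"
proof -
  have id: "ideal a R" "ideal b R" using gabriel_ideal[OF F] ab by auto
  have P: "ideal (ideal_prod R a b) R" by (intro ideal_prod_is_ideal id)
  have "ideal_colon R (ideal_prod R a b) r \<in> F" if r: "r \<in> a" for r
  proof (rule gabriel_upward[OF F ab(2) ideal_colon_ideal[OF P ideal_carr[OF id(1) r]]])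
    show "b \<subseteq> ideal_colon R (ideal_prod R a b) r"
      using r ideal_carr[OF id(2)] by (auto simp: ideal_colon_def intro: ideal_prod.prod)
  qed
  then show ?thesis using gabriel_colon[OF F] P ab(1) by blast
qed

end

context residue_hull
begin

section \<open>Primes of the completion with contraction outside the topology\<close>

lemma Rhat_ideal_set_has_maximal:
  "(\<And>I. I \<in> S \<Longrightarrow> ideal I Rhat) \<Longrightarrow> S \<noteq> {} \<Longrightarrow> \<exists>M\<in>S. \<forall>I\<in>S. M \<subseteq> I \<longrightarrow> I = M"
  using noetherian_ring.ideal_set_has_maximal[OF noetherian_cring.axioms(2)[OF Rhat_noetherian]] .

text \<open>Let \<open>Q\<close> be maximal among the ideals above \<open>I\<close> with contraction
  outside \<open>F\<close>. For \<open>x\<close> and \<open>y\<close> outside \<open>Q\<close>, the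
  contractions of \<open>Q + (x)\<close> and \<open>Q + (y)\<close> belong to \<open>F\<close>,
  hence so does their product. If \<open>x y\<close> were in \<open>Q\<close>, that product would
  lie in the contraction of \<open>Q\<close>.\<close>

lemma prime_outside_topology:
  assumes F: "gabriel_topology R F" and I: "ideal I Rhat" "contr I \<notin> F"
  obtains Q where "primeideal Q Rhat" "I \<subseteq> Q" "contr Q \<notin> F"
proof -
  define S where "S = {J. ideal J Rhat \<and> I \<subseteq> J \<and> contr J \<notin> F}"
  have "\<exists>M\<in>S. \<forall>J\<in>S. M \<subseteq> J \<longrightarrow> J = M"
    by (rule Rhat_ideal_set_has_maximal) (use I in \<open>auto simp: S_def\<close>)
  then obtain Q where Q: "Q \<in> S" and max: "\<And>J. J \<in> S \<Longrightarrow> Q \<subseteq> J \<Longrightarrow> J = Q" by blast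
  then have Qid: "ideal Q Rhat" "I \<subseteq> Q" "contr Q \<notin> F" by (auto simp: S_def)
  have bigger: "contr (Q <+>\<^bsub>Rhat\<^esub> PIdl\<^bsub>Rhat\<^esub> x) \<in> F" if x: "x \<in> carrier Rhat" "x \<notin> Q" for x
  proof (rule ccontr)
    assume n: "contr (Q <+>\<^bsub>Rhat\<^esub> PIdl\<^bsub>Rhat\<^esub> x) \<notin> F"
    have P: "ideal (PIdl\<^bsub>Rhat\<^esub> x) Rhat" by (rule hat.cgenideal_ideal[OF x(1)])
    have le: "Q \<subseteq> Q <+>\<^bsub>Rhat\<^esub> PIdl\<^bsub>Rhat\<^esub> x" "x \<in> Q <+>\<^bsub>Rhat\<^esub> PIdl\<^bsub>Rhat\<^esub> x"
      using hat.ideal_sum_left[OF Qid(1) P] hat.ideal_sum_right[OF Qid(1) P] hat.cgenideal_self[OF x(1)]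
      by auto
    have "Q <+>\<^bsub>Rhat\<^esub> PIdl\<^bsub>Rhat\<^esub> x \<in> S"
      using n le(1) Qid hat.add_ideals[OF Qid(1) P] by (auto simp: S_def)
    then show False using max le x by blast
  qed
  have "primeideal Q Rhat"
  proof (rule primeidealI)
    show "ideal Q Rhat" "cring Rhat" by (rule Qid Rhat_cring)+
    have "contr (carrier Rhat) = carrier R" by (auto simp: contraction_def canon_carrier)
    then show "carrier Rhat \<noteq> Q" using Qid gabriel_carrier[OF F] by auto
    fix x y assume xy: "x \<in> carrier Rhat" "y \<in> carrier Rhat" "x \<otimes>\<^bsub>Rhat\<^esub> y \<in> Q"
    show "x \<in> Q \<or> y \<in> Q"
    proof (rule ccontr)
      assume n: "\<not> (x \<in> Q \<or> y \<in> Q)"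
      let ?X = "contr (Q <+>\<^bsub>Rhat\<^esub> PIdl\<^bsub>Rhat\<^esub> x)" and ?Y = "contr (Q <+>\<^bsub>Rhat\<^esub> PIdl\<^bsub>Rhat\<^esub> y)"
      have "ideal_prod R ?X ?Y \<in> F" using n xy by (intro gabriel_prod[OF F] bigger) auto
      moreover have "ideal_prod R ?X ?Y \<subseteq> contr Q"
      proof (rule ideal_prod_le[OF contraction_ideal[OF Qid(1)]])
        fix i j assume "i \<in> ?X" "j \<in> ?Y"
        then have ij: "i \<in> carrier R" "canon i \<in> Q <+>\<^bsub>Rhat\<^esub> PIdl\<^bsub>Rhat\<^esub> x"
          "j \<in> carrier R" "canon j \<in> Q <+>\<^bsub>Rhat\<^esub> PIdl\<^bsub>Rhat\<^esub> y" by (auto simp: contraction_def)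
        then obtain p c where p: "p \<in> Q" "c \<in> carrier Rhat" "canon i = p \<oplus>\<^bsub>Rhat\<^esub> c \<otimes>\<^bsub>Rhat\<^esub> x"
          by (auto simp: hat.mem_PIdl elim!: hat.set_add_memE)
        from ij obtain q d where q: "q \<in> Q" "d \<in> carrier Rhat" "canon j = q \<oplus>\<^bsub>Rhat\<^esub> d \<otimes>\<^bsub>Rhat\<^esub> y"
          by (auto simp: hat.mem_PIdl elim!: hat.set_add_memE)
        have cj: "canon j \<in> carrier Rhat" by (rule canon_carrier[OF ij(3)])
        have c: "p \<in> carrier Rhat" "q \<in> carrier Rhat" using p q hat.ideal_carr[OF Qid(1)] by auto
        have "canon (i \<otimes> j) = canon j \<otimes>\<^bsub>Rhat\<^esub> p \<oplus>\<^bsub>Rhat\<^esub> (c \<otimes>\<^bsub>Rhat\<^esub> x) \<otimes>\<^bsub>Rhat\<^esub> canon j"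
          using ij(1,3) p(2,3) c cj xy by (simp add: canon_mult hat.l_distr hat.m_comm[of p])
        also have "(c \<otimes>\<^bsub>Rhat\<^esub> x) \<otimes>\<^bsub>Rhat\<^esub> canon j =
            (c \<otimes>\<^bsub>Rhat\<^esub> x) \<otimes>\<^bsub>Rhat\<^esub> q \<oplus>\<^bsub>Rhat\<^esub> (c \<otimes>\<^bsub>Rhat\<^esub> d) \<otimes>\<^bsub>Rhat\<^esub> (x \<otimes>\<^bsub>Rhat\<^esub> y)"
          using q(2,3) p(2) c xy by (simp add: hat.r_distr hat.m_ac)
        also have "canon j \<otimes>\<^bsub>Rhat\<^esub> p \<oplus>\<^bsub>Rhat\<^esub>
            ((c \<otimes>\<^bsub>Rhat\<^esub> x) \<otimes>\<^bsub>Rhat\<^esub> q \<oplus>\<^bsub>Rhat\<^esub> (c \<otimes>\<^bsub>Rhat\<^esub> d) \<otimes>\<^bsub>Rhat\<^esub> (x \<otimes>\<^bsub>Rhat\<^esub> y)) \<in> Q"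
          using hat.ideal_mult_left[OF Qid(1) p(1) cj] hat.ideal_mult_left[OF Qid(1) q(1), of "c \<otimes>\<^bsub>Rhat\<^esub> x"]
            hat.ideal_mult_left[OF Qid(1) xy(3), of "c \<otimes>\<^bsub>Rhat\<^esub> d"] p(2) q(2) xy(1)
          by (intro hat.ideal_add[OF Qid(1)]) auto
        finally show "i \<otimes> j \<in> contr Q" using ij by (simp add: contraction_def)
      qed
      ultimately show False using gabriel_upward[OF F _ contraction_ideal[OF Qid(1)]] Qid by blast
    qed
  qed
  then show thesis using that Qid by blast
qed

lemma ideal_smult_le:
  assumes "submodule V R E" "\<And>r x. r \<in> a \<Longrightarrow> x \<in> X \<Longrightarrow> r \<odot>\<^bsub>E\<^esub> x \<in> V"
  shows "ideal_smult R E a X \<subseteq> V"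
  using assms unfolding ideal_smult_def gen_submodule_def by blast

lemma linear_on_endo: "submodule N R E \<Longrightarrow> module_endo R E N f \<Longrightarrow> linear_on N f"
  using sub_carr by (auto simp: linear_on_def module_endo_def)

text \<open>Stated for strongly coprime submodules so that it serves both characterizations: simple
  divisible submodules are strongly coprime, and the third condition includes this property.\<close>

lemma strongly_coprime_imp_prime:
  assumes N: "submodule N R E" and s: "strongly_coprime R E N"
  shows "primeideal (Ann N) Rhat"
proof (rule primeidealI)
  have Nc: "N \<subseteq> carrier E" using sub_carr[OF N] by blast
  show "ideal (Ann N) Rhat" by (rule Ann_ideal[OF Nc])
  show "cring Rhat" by (rule Rhat_cring)
  obtain e where e: "e \<in> N" "e \<noteq> \<zero>\<^bsub>E\<^esub>" using s sub_zero[OF N] by (auto simp: strongly_coprime_def)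
  then have "act \<one>\<^bsub>Rhat\<^esub> e \<noteq> \<zero>\<^bsub>E\<^esub>" using Nc act_one by auto
  then have "\<one>\<^bsub>Rhat\<^esub> \<notin> Ann N" using e(1) by (auto simp: hat_ann_def)
  then show "carrier Rhat \<noteq> Ann N" by auto
  fix x y assume xy: "x \<in> carrier Rhat" "y \<in> carrier Rhat" "x \<otimes>\<^bsub>Rhat\<^esub> y \<in> Ann N"
  have "x \<in> Ann N" if "y \<notin> Ann N"
  proof -
    have "module_endo R E N (act y)"
      using act_linear[OF N xy(2)] act_submodule[OF N xy(2)] by (auto simp: module_endo_def linear_on_def)
    moreover have "\<exists>e\<in>N. act y e \<noteq> \<zero>\<^bsub>E\<^esub>" using that xy by (auto simp: hat_ann_def)
    ultimately have onto: "act y ` N = N" using s by (auto simp: strongly_coprime_def)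
    have zero: "act x (act y e) = \<zero>\<^bsub>E\<^esub>" if "e \<in> N" for e
      using xy that Nc act_mult[of x y e] by (auto simp: hat_ann_def)
    have "act x e = \<zero>\<^bsub>E\<^esub>" if "e \<in> N" for e
    proof -
      have "e \<in> act y ` N" unfolding onto by (rule that)
      then obtain e' where "e' \<in> N" "e = act y e'" by blast
      then show ?thesis using zero by simp
    qed
    then show ?thesis using xy by (simp add: hat_ann_def)
  qed
  then show "x \<in> Ann N \<or> y \<in> Ann N" by blast
qed

section \<open>Divisibility and annihilators\<close>

context
  fixes F :: "'a set set"
  assumes F: "gabriel_topology R F"
begin

lemma F_subset: "a \<in> F \<Longrightarrow> a \<subseteq> carrier R"
  using ideal_carr[OF gabriel_ideal[OF F]] by blast

text \<open>The generated submodule \<open>aX\<close> is replaced by its universal property, a form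
  that passes easily through images and preimages.\<close>

lemma F_div_iff:
  assumes X: "submodule X R E"
  shows "F_divisible R E F X \<longleftrightarrow>
    (\<forall>a\<in>F. \<forall>V. submodule V R E \<longrightarrow> (\<forall>r\<in>a. \<forall>x\<in>X. r \<odot>\<^bsub>E\<^esub> x \<in> V) \<longrightarrow> X \<subseteq> V)"
proof -
  have "ideal_smult R E a X = X \<longleftrightarrow>
      (\<forall>V. submodule V R E \<longrightarrow> (\<forall>r\<in>a. \<forall>x\<in>X. r \<odot>\<^bsub>E\<^esub> x \<in> V) \<longrightarrow> X \<subseteq> V)" if a: "a \<in> F" for a
  proof -
    have le: "ideal_smult R E a X \<subseteq> X"
      using F_subset[OF a] sub_smult[OF X] by (intro ideal_smult_le[OF X]) auto
    show ?thesis
    proof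
      assume eq: "ideal_smult R E a X = X"
      show "\<forall>V. submodule V R E \<longrightarrow> (\<forall>r\<in>a. \<forall>x\<in>X. r \<odot>\<^bsub>E\<^esub> x \<in> V) \<longrightarrow> X \<subseteq> V"
        using ideal_smult_le[of _ a X] unfolding eq by blast
    next
      assume "\<forall>V. submodule V R E \<longrightarrow> (\<forall>r\<in>a. \<forall>x\<in>X. r \<odot>\<^bsub>E\<^esub> x \<in> V) \<longrightarrow> X \<subseteq> V"
      then have "X \<subseteq> ideal_smult R E a X" unfolding ideal_smult_def gen_submodule_def by blast
      then show "ideal_smult R E a X = X" using le by blast
    qed
  qed
  then show ?thesis by (simp add: F_divisible_def)
qed

text \<open>A test submodule \<open>V\<close> for the image is pulled back along \<open>f\<close>,
  where divisibility of \<open>N\<close> applies.\<close>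

lemma F_divisible_image:
  assumes N: "submodule N R E" "F_divisible R E F N" and f: "linear_on N f"
  shows "F_divisible R E F (f ` N)"
  unfolding F_div_iff[OF linear_image_submodule[OF N(1) f]]
proof (intro ballI allI impI)
  fix a V assume a: "a \<in> F" and V: "submodule V R E" "\<forall>r\<in>a. \<forall>x\<in>f ` N. r \<odot>\<^bsub>E\<^esub> x \<in> V"
  have "r \<odot>\<^bsub>E\<^esub> x \<in> {e \<in> N. f e \<in> V}" if "r \<in> a" "x \<in> N" for r x
    using that V(2) f F_subset[OF a] sub_smult[OF N(1)] by (auto simp: linear_on_def subset_iff)
  then have "N \<subseteq> {e \<in> N. f e \<in> V}"
    using N(2) a linear_preimage_submodule[OF N(1) f V(1)] unfolding F_div_iff[OF N(1)] by blast
  then show "f ` N \<subseteq> V" by blast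
qed

text \<open>If the annihilator were in \<open>F\<close>, testing divisibility against the zero
  submodule would give \<open>N = 0\<close>.\<close>

lemma mod_ann_notin:
  assumes N: "submodule N R E" "F_divisible R E F N" "N \<noteq> {\<zero>\<^bsub>E\<^esub>}"
  shows "mod_ann R E N \<notin> F"
proof
  assume "mod_ann R E N \<in> F"
  note N(2)[unfolded F_div_iff[OF N(1)], THEN bspec, OF this, rule_format, OF zero_submodule]
  then have "N \<subseteq> {\<zero>\<^bsub>E\<^esub>}" by (simp add: mod_ann_def)
  then show False using N sub_zero by blast
qed

text \<open>By upward closure no \<open>a \<in> F\<close> lies inside \<open>contr Q\<close>. An
  \<open>r \<in> a\<close> outside it is a nonzerodivisor modulo \<open>Q\<close>; under the duality
  this means that \<open>r\<close> maps \<open>annE Q\<close> onto itself.\<close>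

lemma annE_divisible:
  assumes Q: "primeideal Q Rhat" "contr Q \<notin> F"
  shows "F_divisible R E F (annE Q)"
proof -
  have id: "ideal Q Rhat" using Q(1) by (rule primeideal.axioms(1))
  have V: "submodule (annE Q) R E" using hat.ideal_carr[OF id] by (intro annE_submodule) auto
  show ?thesis
    unfolding F_div_iff[OF V]
  proof (intro ballI allI impI)
    fix a U assume a: "a \<in> F" and U: "submodule U R E" "\<forall>r\<in>a. \<forall>x\<in>annE Q. r \<odot>\<^bsub>E\<^esub> x \<in> U"
    have "\<not> a \<subseteq> contr Q" using gabriel_upward[OF F a contraction_ideal[OF id]] Q by blast
    then obtain r where r: "r \<in> a" "canon r \<notin> Q" "r \<in> carrier R"
      using F_subset[OF a] by (auto simp: contraction_def)
    define W where "W = (\<lambda>e. r \<odot>\<^bsub>E\<^esub> e) ` annE Q"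
    have W: "submodule W R E"
      unfolding W_def by (rule linear_image_submodule[OF V linear_smult[OF V r(3)]])
    have "Ann W \<subseteq> Q"
    proof
      fix x assume x: "x \<in> Ann W"
      then have xc: "x \<in> carrier Rhat" by (simp add: hat_ann_def)
      have "x \<otimes>\<^bsub>Rhat\<^esub> canon r \<in> Ann (annE Q)"
        using x xc r canon_carrier[OF r(3)] sub_carr[OF V] by (auto simp: hat_ann_def W_def act_mult act_canon)
      then have "x \<otimes>\<^bsub>Rhat\<^esub> canon r \<in> Q" by (simp add: Ann_annE[OF id])
      then show "x \<in> Q" using primeideal.I_prime[OF Q(1) xc canon_carrier[OF r(3)]] r by blast
    qed
    then have "annE Q \<subseteq> annE (Ann W)" by (auto simp: annE_def)
    also have "\<dots> = W" by (rule annE_Ann[OF W])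
    also have "\<dots> \<subseteq> U" using U r by (auto simp: W_def)
    finally show "annE Q \<subseteq> U" .
  qed
qed

text \<open>The image of a nonzero endomorphism is a nonzero divisible submodule of
  \<open>N\<close>, hence all of \<open>N\<close>.\<close>

lemma simple_imp_strongly_coprime:
  assumes N: "submodule N R E" and s: "simple_F_divisible R E F N"
  shows "strongly_coprime R E N"
  unfolding strongly_coprime_def
proof (intro conjI allI impI)
  show "N \<noteq> {\<zero>\<^bsub>E\<^esub>}" using s by (simp add: simple_F_divisible_def)
  fix f assume f: "module_endo R E N f \<and> (\<exists>x\<in>N. f x \<noteq> \<zero>\<^bsub>E\<^esub>)"
  then have lin: "linear_on N f" using linear_on_endo[OF N] by blast
  have "submodule (f ` N) R E" "F_divisible R E F (f ` N)"
    using linear_image_submodule[OF N lin] F_divisible_image[OF N _ lin] s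
    by (auto simp: simple_F_divisible_def)
  moreover have "f ` N \<noteq> {\<zero>\<^bsub>E\<^esub>}" "f ` N \<subseteq> N" using f by (auto simp: module_endo_def)
  ultimately show "f ` N = N" using s unfolding simple_F_divisible_def by blast
qed

lemma simple_iff_Ann_maximal:
  assumes N: "submodule N R E" "N \<noteq> {\<zero>\<^bsub>E\<^esub>}"
  shows "simple_F_divisible R E F N \<longleftrightarrow> primeideal (Ann N) Rhat \<and> contr (Ann N) \<notin> F \<and>
    (\<forall>Q. primeideal Q Rhat \<and> contr Q \<notin> F \<and> Ann N \<subseteq> Q \<longrightarrow> Q = Ann N)"
proof
  have Nc: "N \<subseteq> carrier E" using sub_carr[OF N(1)] by blast
  assume s: "simple_F_divisible R E F N"
  show "primeideal (Ann N) Rhat \<and> contr (Ann N) \<notin> F \<and>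
    (\<forall>Q. primeideal Q Rhat \<and> contr Q \<notin> F \<and> Ann N \<subseteq> Q \<longrightarrow> Q = Ann N)"
  proof (intro conjI allI impI; (elim conjE)?)
    show "primeideal (Ann N) Rhat"
      by (rule strongly_coprime_imp_prime[OF N(1) simple_imp_strongly_coprime[OF N(1) s]])
    show "contr (Ann N) \<notin> F"
      using mod_ann_notin[OF N(1) _ N(2)] s by (simp add: contr_Ann[OF Nc] simple_F_divisible_def)
    fix Q assume Q: "primeideal Q Rhat" "contr Q \<notin> F" "Ann N \<subseteq> Q"
    have id: "ideal Q Rhat" using Q(1) by (rule primeideal.axioms(1))
    have V: "submodule (annE Q) R E" using hat.ideal_carr[OF id] by (intro annE_submodule) auto
    have "annE Q \<subseteq> annE (Ann N)" using Q(3) by (auto simp: annE_def)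
    then have VN: "annE Q \<subseteq> N" by (simp add: annE_Ann[OF N(1)])
    have "annE Q \<noteq> {\<zero>\<^bsub>E\<^esub>}"
    proof
      assume "annE Q = {\<zero>\<^bsub>E\<^esub>}"
      then have "Q = carrier Rhat" using Ann_annE[OF id] act_zero_r by (auto simp: hat_ann_def)
      then show False using hat.prime_one[OF Q(1)] by simp
    qed
    then have "annE Q = N" using s VN V annE_divisible[OF Q(1,2)] unfolding simple_F_divisible_def by blast
    then show "Q = Ann N" using Ann_annE[OF id] by simp
  qed
next
  have Nc: "N \<subseteq> carrier E" using sub_carr[OF N(1)] by blast
  assume "primeideal (Ann N) Rhat \<and> contr (Ann N) \<notin> F \<and>
    (\<forall>Q. primeideal Q Rhat \<and> contr Q \<notin> F \<and> Ann N \<subseteq> Q \<longrightarrow> Q = Ann N)"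
  then have P: "primeideal (Ann N) Rhat" "contr (Ann N) \<notin> F"
    and max: "\<And>Q. primeideal Q Rhat \<Longrightarrow> contr Q \<notin> F \<Longrightarrow> Ann N \<subseteq> Q \<Longrightarrow> Q = Ann N" by simp_all
  have "F_divisible R E F N" using annE_divisible[OF P] by (simp add: annE_Ann[OF N(1)])
  moreover have "V = N" if V: "submodule V R E" "V \<noteq> {\<zero>\<^bsub>E\<^esub>}" "V \<subseteq> N" "F_divisible R E F V" for V
  proof -
    have Vc: "V \<subseteq> carrier E" using sub_carr[OF V(1)] by blast
    have "contr (Ann V) \<notin> F" using mod_ann_notin[OF V(1,4,2)] by (simp add: contr_Ann[OF Vc])
    then obtain Q where Q: "primeideal Q Rhat" "Ann V \<subseteq> Q" "contr Q \<notin> F"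
      using prime_outside_topology[OF F Ann_ideal[OF Vc]] by blast
    \<comment> \<open>Maximality collapses \<open>Ann N \<subseteq> Ann V \<subseteq> Q\<close> to
      equalities, and \<open>annE\<close> recovers \<open>V = N\<close>.\<close>
    have "Ann N \<subseteq> Ann V" using V(3) by (auto simp: hat_ann_def)
    moreover have "Q = Ann N" by (rule max[OF Q(1,3) subset_trans[OF calculation Q(2)]])
    ultimately have "Ann V = Ann N" using Q(2) by (intro subset_antisym) simp_all
    then show ?thesis using annE_Ann[OF V(1)] annE_Ann[OF N(1)] by metis
  qed
  ultimately show "simple_F_divisible R E F N" using N(2) unfolding simple_F_divisible_def by blast
qed

end

section \<open>Primes of the completion under going up\<close>

lemma going_up:
  assumes "going_up_to_completion R m" "primeideal P Rhat" "primeideal q R" "contr P \<subseteq> q"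
  obtains Q where "primeideal Q Rhat" "P \<subseteq> Q" "contr Q = q"
proof -
  have "primeideal (contr P) R" by (rule contraction_prime[OF assms(2)])
  then have "\<exists>Q. primeideal Q Rhat \<and> P \<subseteq> Q \<and> contr Q = q"
    using assms(1)[unfolded going_up_to_completion_def, rule_format, of "contr P" q P] assms(2-4) by simp
  then show thesis using that by blast
qed

text \<open>Noetherian induction on the common contraction \<open>p\<close>: if \<open>P \<subset> Q\<close> lie over \<open>p\<close>, let \<open>q\<close> be
  minimal over \<open>p + (x)\<close>, lift \<open>q\<close> to \<open>Q' \<supseteq> Q\<close> by going up, and choose \<open>P' \<subseteq> Q'\<close> minimal over
  \<open>P + (x)\<close>. Both \<open>P'\<close> and \<open>Q'\<close> lie over \<open>q\<close>, and they differ because \<open>Q'\<close> has height at least two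
  over \<open>P\<close>.\<close>

lemma going_up_incomparable:
  assumes gu: "going_up_to_completion R m"
    and PQ: "primeideal P Rhat" "primeideal Q Rhat" "P \<subseteq> Q" "contr P = contr Q"
  shows "P = Q"
proof (rule ccontr)
  assume "P \<noteq> Q"
  define bad where "bad P Q \<longleftrightarrow> primeideal P Rhat \<and> primeideal Q Rhat \<and> P \<subset> Q \<and> contr Q = contr P" for P Q
  define S where "S = {contr P |P. \<exists>Q. bad P Q}"
  have id: "ideal p R" if "p \<in> S" for p
    using that contraction_prime by (auto simp: S_def bad_def dest: primeideal.axioms(1))
  have "bad P Q" using PQ \<open>P \<noteq> Q\<close> by (auto simp: bad_def)
  then have "contr P \<in> S" unfolding S_def by blast
  then have "\<exists>p\<in>S. \<forall>q\<in>S. p \<subseteq> q \<longrightarrow> q = p" using ideal_set_has_maximal[OF id] by blast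
  then obtain p where p: "p \<in> S" "\<And>q. q \<in> S \<Longrightarrow> p \<subseteq> q \<Longrightarrow> q = p" by blast
  then obtain P Q where PQ: "primeideal P Rhat" "primeideal Q Rhat" "P \<subset> Q" "contr P = p" "contr Q = p"
    by (auto simp: S_def bad_def)
  have pp: "primeideal p R" using contraction_prime[OF PQ(1)] PQ by simp
  have "p \<noteq> carrier R" using prime_one[OF pp] by auto
  then have pm: "p \<subseteq> m" using proper_ideal_subset_m[OF id[OF p(1)]] by blast
  have ne: "P \<noteq> carrier Rhat" "Q \<noteq> carrier Rhat"
    using hat.prime_one[OF PQ(1)] hat.prime_one[OF PQ(2)] by auto
  \<comment> \<open>The only prime over \<open>m\<close> is \<open>Ann {e\<^sub>0}\<close>, so a
    strict inclusion cannot occur there; this leaves room for \<open>x\<close>.\<close>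
  have "p \<noteq> m"
  proof
    assume "p = m"
    then have "P = Ann {e\<^sub>0}" "Q = Ann {e\<^sub>0}"
      using PQ(4,5) proper_ideal_over_m[OF primeideal.axioms(1)[OF PQ(1)] ne(1)]
        proper_ideal_over_m[OF primeideal.axioms(1)[OF PQ(2)] ne(2)] by simp_all
    then show False using PQ by simp
  qed
  then obtain x where x: "x \<in> m" "x \<notin> p" using pm by blast
  have xc: "x \<in> carrier R" using x ideal_carr[OF m_ideal] by blast
  obtain q where q: "primeideal q R" "insert x p \<subseteq> q" "q \<subseteq> m"
    "\<And>L. primeideal L R \<Longrightarrow> insert x p \<subseteq> L \<Longrightarrow> L \<subseteq> q \<Longrightarrow> L = q"
    using exists_minimal_prime[OF m_prime, of "insert x p"] x pm by blast
  obtain Q' where Q': "primeideal Q' Rhat" "Q \<subseteq> Q'" "contr Q' = q"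
    using going_up[OF gu PQ(2) q(1)] q(2) PQ(5) by auto
  have xQ': "canon x \<in> Q'" using Q' q by (auto simp: contraction_def)
  have QQ': "Q \<noteq> Q'" using Q' q x PQ by blast
  obtain P' where P': "primeideal P' Rhat" "insert (canon x) P \<subseteq> P'" "P' \<subseteq> Q'"
    "\<And>L. primeideal L Rhat \<Longrightarrow> insert (canon x) P \<subseteq> L \<Longrightarrow> L \<subseteq> P' \<Longrightarrow> L = P'"
    using hat.exists_minimal_prime[OF Q'(1), of "insert (canon x) P"] xQ' PQ Q' by blast
  \<comment> \<open>The contraction contains \<open>p\<close> and \<open>x\<close> and lies below
    \<open>q\<close>, which is minimal with this property.\<close>
  have "contr P' = q"
  proof (rule q(4)[OF contraction_prime[OF P'(1)]])
    show "insert x p \<subseteq> contr P'" using PQ(4) P'(2) xc by (auto simp: contraction_def)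
    show "contr P' \<subseteq> q" using P'(3) Q'(3) by (auto simp: contraction_def)
  qed
  \<comment> \<open>Equality would make \<open>Q'\<close> minimal over \<open>P + (x)\<close>
    despite the chain \<open>P \<subset> Q \<subset> Q'\<close>, against Krull's theorem. Otherwise
    \<open>P' \<subset> Q'\<close> is a bad pair over \<open>q\<close>, which is larger than the
    maximal \<open>p\<close>.\<close>
  show False
  proof (cases "P' = Q'")
    case True
    show False
    proof (rule noetherian_cring.principal_ideal_theorem[OF Rhat_noetherian PQ(1,2) P'(1) PQ(3)])
      show "Q \<subset> P'" "canon x \<in> P'" using True Q' QQ' xQ' by auto
      show "L = P'" if "primeideal L Rhat" "P \<subseteq> L" "canon x \<in> L" "L \<subseteq> P'" for L
        using P'(4) that by blast
    qed
  next
    case False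
    then have "bad P' Q'" using P' Q' \<open>contr P' = q\<close> by (auto simp: bad_def)
    then have "q \<in> S" unfolding S_def using \<open>contr P' = q\<close> by blast
    then have "q = p" using p(2) q by blast
    then show False using q x by blast
  qed
qed

text \<open>Going up lifts a prime \<open>q\<close> above \<open>contr (Ann N)\<close> to a prime
  above \<open>Ann N\<close>, so maximality descends to the contraction. Conversely, membership in
  \<open>F_star\<close> forces every competing \<open>Q\<close> to have the same contraction as
  \<open>Ann N\<close>, and \<open>going_up_incomparable\<close> identifies the two.\<close>

lemma simple_iff_strongly_coprime:
  assumes F: "gabriel_topology R F" and gu: "going_up_to_completion R m"
    and N: "submodule N R E" "N \<noteq> {\<zero>\<^bsub>E\<^esub>}"
  shows "simple_F_divisible R E F N \<longleftrightarrow> strongly_coprime R E N \<and> mod_ann R E N \<in> F_star R F"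
proof
  have Nc: "N \<subseteq> carrier E" using sub_carr[OF N(1)] by blast
  assume s: "simple_F_divisible R E F N"
  then have P: "primeideal (Ann N) Rhat" "contr (Ann N) \<notin> F"
    and max: "\<And>Q. primeideal Q Rhat \<Longrightarrow> contr Q \<notin> F \<Longrightarrow> Ann N \<subseteq> Q \<Longrightarrow> Q = Ann N"
    using simple_iff_Ann_maximal[OF F N] by blast+
  have "contr (Ann N) \<in> F_star R F"
    unfolding F_star_def
  proof (intro CollectI conjI allI impI; (elim conjE)?)
    show "primeideal (contr (Ann N)) R" by (rule contraction_prime[OF P(1)])
    show "contr (Ann N) \<notin> F" by (rule P)
    fix q assume q: "primeideal q R" "q \<notin> F" "contr (Ann N) \<subseteq> q"
    then obtain Q where "primeideal Q Rhat" "Ann N \<subseteq> Q" "contr Q = q"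
      using going_up[OF gu P(1) q(1)] by blast
    then show "q = contr (Ann N)" using max[of Q] q(2) by simp
  qed
  then show "strongly_coprime R E N \<and> mod_ann R E N \<in> F_star R F"
    using simple_imp_strongly_coprime[OF F N(1) s] contr_Ann[OF Nc] by simp
next
  have Nc: "N \<subseteq> carrier E" using sub_carr[OF N(1)] by blast
  assume *: "strongly_coprime R E N \<and> mod_ann R E N \<in> F_star R F"
  have P: "primeideal (Ann N) Rhat" using strongly_coprime_imp_prime[OF N(1)] * by blast
  have st: "contr (Ann N) \<in> F_star R F" using * contr_Ann[OF Nc] by simp
  have "Q = Ann N" if Q: "primeideal Q Rhat" "contr Q \<notin> F" "Ann N \<subseteq> Q" for Q
  proof -
    have "contr (Ann N) \<subseteq> contr Q" using Q(3) by (auto simp: contraction_def)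
    then have "contr Q = contr (Ann N)"
      using st Q contraction_prime[OF Q(1)] unfolding F_star_def by blast
    then show ?thesis using going_up_incomparable[OF gu P Q(1,3)] by simp
  qed
  then show "simple_F_divisible R E F N"
    using simple_iff_Ann_maximal[OF F N] P st unfolding F_star_def by blast
qed

end

theorem theorem3p5:
  fixes R :: "'a ring" and m :: "'a set" and F :: "'a set set"
    and E :: "('a, 'b) module" and N :: "'b set"
  assumes "noetherian_local R m"
    and "gabriel_topology R F"
    and "injective_hull_residue R m E"
    and "submodule N R E"
    and "N \<noteq> {\<zero>\<^bsub>E\<^esub>}"
  shows "(simple_F_divisible R E F N \<longleftrightarrow>
            (primeideal (hat_ann R m E N) (completion R m) \<and>
             contraction R m (hat_ann R m E N) \<notin> F \<and>
             (\<forall>Q. primeideal Q (completion R m) \<and> contraction R m Q \<notin> F \<and>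
                  hat_ann R m E N \<subseteq> Q \<longrightarrow> Q = hat_ann R m E N)))
       \<and> (going_up_to_completion R m \<longrightarrow>
            (simple_F_divisible R E F N \<longleftrightarrow>
               strongly_coprime R E N \<and> mod_ann R E N \<in> F_star R F))"
proof -
  obtain e where e: "e \<in> carrier E" "{r \<in> carrier R. r \<odot>\<^bsub>E\<^esub> e = \<zero>\<^bsub>E\<^esub>} = m"
    and ess: "\<And>V. submodule V R E \<Longrightarrow> \<exists>v\<in>V. v \<noteq> \<zero>\<^bsub>E\<^esub> \<Longrightarrow>
      \<exists>v\<in>V \<inter> {r \<odot>\<^bsub>E\<^esub> e |r. r \<in> carrier R}. v \<noteq> \<zero>\<^bsub>E\<^esub>"
    using assms(3) unfolding injective_hull_residue_def by blast
  have "noetherian_local_ring R m"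
    using assms(1) by (simp add: noetherian_local_def noetherian_local_ring_def plain_cring_def
        noetherian_cring_def noetherian_local_ring_axioms_def)
  moreover have "module R E" using assms(3) by (simp add: injective_hull_residue_def)
  moreover have "residue_hull_axioms R m E e"
  proof
    fix V v assume V: "submodule V R E" "v \<in> V" "v \<noteq> \<zero>\<^bsub>E\<^esub>"
    then have "\<exists>v\<in>V \<inter> {r \<odot>\<^bsub>E\<^esub> e |r. r \<in> carrier R}. v \<noteq> \<zero>\<^bsub>E\<^esub>" using ess[OF V(1)] by blast
    then show "\<exists>t\<in>carrier R. t \<odot>\<^bsub>E\<^esub> e \<in> V \<and> t \<odot>\<^bsub>E\<^esub> e \<noteq> \<zero>\<^bsub>E\<^esub>" by blast
  qed (use e assms(3) in \<open>auto simp: injective_hull_residue_def\<close>)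
  ultimately interpret residue_hull R m E e by (rule residue_hull.intro)
  show ?thesis
    using simple_iff_Ann_maximal[OF assms(2,4,5)] simple_iff_strongly_coprime[OF assms(2) _ assms(4,5)]
    by blast
qed

end
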